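(* Let $\mathbf{G}=(J,\mu,E)$ be a graphing and let $\alpha\in\mathsf{bmm}_+(\rho_{\mathbf{G}})$ with Radon–Nikodym derivative $f_\alpha=\frac{d\alpha}{d\eta_{\mathbf{G}}}$. Suppose $f_\alpha$ is exposed by a function $g\in L^\infty(E,\eta_{\mathbf{G}})$, i.e. $\int_E f_\alpha g\,d\eta_{\mathbf{G}}>\int_E f_\beta g\,d\eta_{\mathbf{G}}$ for every $\beta\in\mathsf{bmm}_+(\rho_{\mathbf{G}})$ with $f_\beta\ne f_\alpha$ in $L^1(E,\eta_{\mathbf{G}})$. Then $f_\alpha$ is $\{0,1\}$-valued $\eta_{\mathbf{G}}$-almost everywhere.
   Context: A graphing $\mathbf{G}=(J,\mu,E)$: $(J,\mu)$ a standard Borel probability space, $E\subseteq\binom{J}{2}$ Borel with bounded degrees, satisfying $\int_A\deg(B,x)\,d\mu(x)=\int_B\deg(A,x)\,d\mu(x)$ for all measurable $A,B\subseteq J$. Edge measure: $\eta_{\mathbf{G}}(F)=\frac12\int_J\deg_F(x)\,d\mu(x)$. Rank: $\rho_{\mathbf{G}}(F)=1-\int_J\frac{1}{|V(\mathbf{G}^F_x)|}\,d\mu(x)$, where $\mathbf{G}^F_x$ is the component of $x$ in $(J,\mu,F)$ and $1/\infty=0$. $\mathsf{mm}_+(\rho_{\mathbf{G}})$ is the set of measures $\alpha$ on $E$ with $0\le\alpha(A)\le\rho_{\mathbf{G}}(A)$ for all Borel $A$ (these satisfy $\alpha\le\eta_{\mathbf{G}}$, hence have Radon–Nikodym derivatives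 w.r.t. $\eta_{\mathbf{G}}$), and $\mathsf{bmm}_+(\rho_{\mathbf{G}})=\{\alpha\in\mathsf{mm}_+(\rho_{\mathbf{G}}):\alpha(E)=\rho_{\mathbf{G}}(E)\}$. *)

theory Defs
  imports "HOL-Analysis.Analysis" "HOL-Probability.Probability" "HOL-Library.Uprod"
begin

text \<open>Vertices: a Polish space (any standard Borel space carries a Polish topology
generating its Borel sets). Undirected edges are unordered pairs (type uprod).\<close>

definition adj :: "'a uprod set \<Rightarrow> ('a \<times> 'a) set" where
  "adj F = {(x, y). Upair x y \<in> F}"

definition deg_in :: "'a uprod set \<Rightarrow> 'a set \<Rightarrow> 'a \<Rightarrow> nat" where
  "deg_in F B x = card {y \<in> B. Upair x y \<in> F}"

definition deg :: "'a uprod set \<Rightarrow> 'a \<Rightarrow> nat" where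
  "deg F x = deg_in F UNIV x"

text \<open>Borel sets of unordered pairs: quotient sigma-algebra of the product.\<close>
definition edge_sets :: "'a measure \<Rightarrow> 'a uprod set \<Rightarrow> 'a uprod set set" where
  "edge_sets M E = {A. A \<subseteq> E \<and> {(x, y). Upair x y \<in> A} \<in> sets (M \<Otimes>\<^sub>M M)}"

definition graphing :: "'a::polish_space measure \<Rightarrow> 'a uprod set \<Rightarrow> bool" where
  "graphing M E \<longleftrightarrow>
     prob_space M \<and> sets M = sets borel \<and>
     (\<forall>x. Upair x x \<notin> E) \<and>
     adj E \<in> sets (M \<Otimes>\<^sub>M M) \<and>
     (\<exists>D::nat. \<forall>x. finite {y. Upair x y \<in> E} \<and> deg E x \<le> D) \<and>
     (\<forall>A\<in>sets M. \<forall>B\<in>sets M.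
        (\<integral>\<^sup>+ x\<in>A. of_nat (deg_in E B x) \<partial>M) = (\<integral>\<^sup>+ x\<in>B. of_nat (deg_in E A x) \<partial>M))"

definition eta :: "'a measure \<Rightarrow> 'a uprod set \<Rightarrow> ennreal" where
  "eta M F = ennreal (1/2) * (\<integral>\<^sup>+ x. of_nat (deg F x) \<partial>M)"

definition eta_measure :: "'a measure \<Rightarrow> 'a uprod set \<Rightarrow> 'a uprod measure" where
  "eta_measure M E = measure_of E (edge_sets M E) (eta M)"

text \<open>Vertex set of the connected component of x in (J, F).
  Infinite components have card 0, and 1/0 = 0 in Isabelle, matching 1/infinity = 0.\<close>
definition component :: "'a uprod set \<Rightarrow> 'a \<Rightarrow> 'a set" where
  "component F x = {y. (x, y) \<in> (adj F)\<^sup>*}"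

definition rank :: "'a measure \<Rightarrow> 'a uprod set \<Rightarrow> real" where
  "rank M F = 1 - (\<integral> x. 1 / real (card (component F x)) \<partial>M)"

definition mm_plus :: "'a measure \<Rightarrow> 'a uprod set \<Rightarrow> 'a uprod measure set" where
  "mm_plus M E = {\<alpha>. sets \<alpha> = edge_sets M E \<and> space \<alpha> = E \<and>
      (\<forall>A\<in>edge_sets M E. emeasure \<alpha> A \<le> ennreal (rank M A))}"

definition bmm_plus :: "'a measure \<Rightarrow> 'a uprod set \<Rightarrow> 'a uprod measure set" where
  "bmm_plus M E = {\<alpha> \<in> mm_plus M E. emeasure \<alpha> E = ennreal (rank M E)}"

end

(*
Let eta be the edge measure.  Order the edges linearly by g, breaking ties by a Borel injection,
and let F consist of the edges that are the largest edge of the boundary of some finite vertex set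
(the wired maximal spanning forest).  Then eta(F Int A) <= rho(A) for every Borel A, with equality
when A = {g > t} for some t.  Hence the measure 1_F eta lies in bmm_+, and it dominates every other
element of bmm_+ on all the sets {g > t}, so it maximises the integral of g.  As alpha is exposed by g, its density must be 1_F.

Both facts about F reduce to eta(H) = rho(H) for subsets H of F.  Add the edges of H in decreasing
order: each edge merges two clusters, at least one of which is finite.  By the elder rule it kills
the vertex representing one of the merged clusters.  Every edge kills one vertex and every vertex
dies at most once; in a finite component of H exactly one vertex survives, and by mass transport
the survivors in infinite components form a null set.

Mass transport over components and all measurability claims rest on enumerating neighbours by Borel
functions, which comes from the Lusin-Souslin theorem that a Borel set in a product of Polish spaces
with at most one point over each x has Borel projection.
*)
theory Submission
  imports Defs
begin

section \<open>Injective projections of Borel sets\<close>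

text \<open>The model is the greedy algorithm for a maximum-weight spanning tree: the edges it
  accepts span every upper level set of the weight. The obstacle is infinite components. Accepting
  every edge that closes no cycle would take too much there: on a graphing whose components are
  4-regular trees it takes all edges, of edge measure 2, while the rank never exceeds 1. Demanding a
  finite side treats infinite clusters as already joined at infinity, and this brings the count down
  to at most one edge per vertex. Infinite components also have no root towards which edges could be
  oriented, so the pairing of edges with vertices uses an injective Borel function \<open>h\<close>
  as the age of a vertex, and mass transport replaces counting. Since components are countable,
  measurability comes down to enumerating them by Borel functions; this is where descriptive set
  theory enters.\<close>

lemma borel_cells_exist:
  "\<exists>P :: nat \<Rightarrow> 'z::{metric_space,second_countable_topology} \<Rightarrow> nat.
     (\<forall>n. P n \<in> borel \<rightarrow>\<^sub>M count_space UNIV) \<and>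
     (\<forall>n a b. P n a = P n b \<longrightarrow> dist a b < 1 / real (Suc n))"
proof -
  obtain D :: "'z set" where D: "countable D" "\<And>X. open X \<Longrightarrow> X \<noteq> {} \<Longrightarrow> \<exists>d\<in>D. d \<in> X"
    using countable_dense_setE by metis
  define d where "d = from_nat_into D"
  have dense: "\<exists>i. dist (d i) z < r" if r: "r > 0" for z r
  proof -
    obtain x where "x \<in> D" "x \<in> ball z r"
      using D(2)[OF open_ball, of z r] r centre_in_ball[of z r] by blast
    then show ?thesis
      using from_nat_into_surj[OF D(1)] by (metis d_def mem_ball dist_commute)
  qed
  \<comment> \<open>Half of the target diameter: two points with the same label lie within this
    radius of one point of the dense sequence.\<close>
  define P where "P n z = (LEAST i. dist (d i) z < 1 / (2 * real (Suc n)))" for n z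
  have "P n \<in> borel \<rightarrow>\<^sub>M count_space UNIV" for n
    unfolding P_def by measurable
  moreover have "dist a b < 1 / real (Suc n)" if "P n a = P n b" for n a b
  proof -
    have *: "dist (d (P n z)) z < 1 / (2 * real (Suc n))" for z
      unfolding P_def by (rule LeastI_ex) (rule dense, simp)
    have "dist a b \<le> dist (d (P n a)) a + dist (d (P n a)) b"
      by (metis dist_triangle dist_commute)
    also have "\<dots> < 1 / (2 * real (Suc n)) + 1 / (2 * real (Suc n))"
      using *[of a] *[of b] that by (metis add_strict_mono)
    finally show ?thesis by (simp add: field_simps)
  qed
  ultimately show ?thesis by blast
qed

text \<open>An injective form of analyticity: the witness in the extra coordinates is determined by
  the point. The coordinates are real numbers because the witness for an open set is a reciprocal
  distance.\<close>

definition inj_closed_proj :: "'z::topological_space set \<Rightarrow> bool" where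
  "inj_closed_proj B \<longleftrightarrow> (\<exists>C :: ('z \<times> (nat \<Rightarrow> real)) set. closed C \<and> inj_on fst C \<and> fst ` C = B)"

lemma inj_closed_proj_closed:
  assumes "closed (B :: 'z::topological_space set)" shows "inj_closed_proj B"
  unfolding inj_closed_proj_def
  by (rule exI[of _ "B \<times> {\<lambda>_. 0}"]) (use assms in \<open>auto intro!: closed_Times inj_onI\<close>)

lemma continuous_on_snd_coordinate:
  "continuous_on UNIV (\<lambda>p :: 'z::topological_space \<times> (nat \<Rightarrow> real). snd p k)"
  by (rule continuous_on_product_then_coordinatewise[OF continuous_on_snd[OF continuous_on_id]])

lemma continuous_reindex:
  "continuous_on UNIV (\<lambda>p :: 'z::topological_space \<times> (nat \<Rightarrow> real). (fst p, \<lambda>k. snd p (\<sigma> k)))"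
  by (rule continuous_on_Pair[OF continuous_on_fst[OF continuous_on_id]
        continuous_on_coordinatewise_then_product[OF continuous_on_snd_coordinate]])

text \<open>The witness of a point is s = 1/d, where d is its distance to the complement. The
  equation s * d = 1 is closed and has no solution outside \<open>U\<close>. Forcing all coordinates
  to equal coordinate 0 leaves one witness per point.\<close>

lemma inj_closed_proj_open:
  assumes "open (U :: 'z::metric_space set)" shows "inj_closed_proj U"
\<comment> \<open>\<open>infdist\<close> to the empty set is 0 by convention, so the reciprocal
  distance fails here; but \<open>UNIV\<close> is closed.\<close>
proof (cases "U = UNIV")
  case True then show ?thesis by (simp add: inj_closed_proj_closed)
next
  case False
  define C :: "('z \<times> (nat \<Rightarrow> real)) set"
    where "C = {p. snd p 0 * infdist (fst p) (- U) = 1} \<inter> (\<Inter>k. {p. snd p k = snd p 0})"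
  note coord = continuous_on_snd_coordinate
  have "closed C"
    unfolding C_def by (intro closed_Int closed_INT ballI closed_Collect_eq continuous_intros coord)
  moreover have "inj_on fst C"
    unfolding C_def by (intro inj_onI prod_eqI ext) (auto, metis mult_cancel_right zero_neq_one mult_zero_right)
  moreover have "fst ` C = U"
  proof safe
    fix z f assume "(z, f) \<in> C"
    then have "infdist z (- U) \<noteq> 0" by (auto simp: C_def)
    then show "fst (z, f) \<in> U" by (metis ComplI fst_conv infdist_zero)
  next
    fix z assume "z \<in> U"
    then have "infdist z (- U) \<noteq> 0"
      using in_closed_iff_infdist_zero[of "- U" z] assms False by auto
    then have "(z, \<lambda>_. 1 / infdist z (- U)) \<in> C" by (auto simp: C_def)
    then show "z \<in> fst ` C" by force
  qed
  ultimately show ?thesis unfolding inj_closed_proj_def by blast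
qed



text \<open>The countably many witnesses are interleaved into one by \<open>prod_encode\<close>;
  since each is unique, so is the packed one.\<close>

lemma inj_closed_proj_Inter:
  fixes B :: "nat \<Rightarrow> 'z::topological_space set"
  assumes "\<And>n. inj_closed_proj (B n)" shows "inj_closed_proj (\<Inter>n. B n)"
proof -
  obtain C :: "nat \<Rightarrow> ('z \<times> (nat \<Rightarrow> real)) set"
    where C: "\<And>n. closed (C n)" "\<And>n. inj_on fst (C n)" "\<And>n. fst ` C n = B n"
    using assms unfolding inj_closed_proj_def by metis
  define K where "K = (\<Inter>n. (\<lambda>p. (fst p, \<lambda>k. snd p (prod_encode (n, k)))) -` C n)"
  have "closed K"
    unfolding K_def using C(1) by (intro closed_INT ballI closed_vimage continuous_reindex)
  moreover have "inj_on fst K"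
  proof (rule inj_onI)
    fix p q assume pq: "p \<in> K" "q \<in> K" "fst p = fst q"
    have "snd p (prod_encode (n, k)) = snd q (prod_encode (n, k))" for n k
    proof -
      have "(fst p, \<lambda>k. snd p (prod_encode (n, k))) = (fst q, \<lambda>k. snd q (prod_encode (n, k)))"
        using pq by (intro inj_onD[OF C(2)[of n]]) (auto simp: K_def)
      then show ?thesis by (auto dest: fun_cong)
    qed
    then have "snd p j = snd q j" for j by (metis prod_decode_inverse surj_pair)
    with pq(3) show "p = q" by (intro prod_eqI ext)
  qed
  moreover have "fst ` K = (\<Inter>n. B n)"
  proof safe
    fix z f n assume "(z, f) \<in> K"
    then show "fst (z, f) \<in> B n" using C(3)[of n] by (force simp: K_def)
  next
    fix z assume "z \<in> (\<Inter>n. B n)"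
    then have "\<forall>n. \<exists>f. (z, f) \<in> C n" using C(3) by force
    then obtain f where f: "\<And>n. (z, f n) \<in> C n" by metis
    define g where "g j = (case prod_decode j of (n, k) \<Rightarrow> f n k)" for j
    have "(z, g) \<in> K" using f by (auto simp: K_def g_def)
    then show "z \<in> fst ` K" by force
  qed
  ultimately show ?thesis unfolding inj_closed_proj_def by blast
qed

text \<open>Coordinate 0 stores the index of the set, the remaining coordinates its witness.
  Disjointness makes the index unique, which keeps the projection injective.\<close>

lemma inj_closed_proj_disjoint_Union:
  fixes B :: "nat \<Rightarrow> 'z::metric_space set"
  assumes "\<And>n. inj_closed_proj (B n)" "disjoint_family B" shows "inj_closed_proj (\<Union>n. B n)"
proof -
  obtain C :: "nat \<Rightarrow> ('z \<times> (nat \<Rightarrow> real)) set"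
    where C: "\<And>n. closed (C n)" "\<And>n. inj_on fst (C n)" "\<And>n. fst ` C n = B n"
    using assms unfolding inj_closed_proj_def by metis
  define K where "K = {p. \<exists>n. snd p 0 = real n \<and> (fst p, \<lambda>k. snd p (Suc k)) \<in> C n}"
  note coord = continuous_on_snd_coordinate
  \<comment> \<open>For closedness: the open interval of radius 1 around \<open>n\<close> contains
    no other natural number, so near coordinate value \<open>n\<close> only \<open>C n\<close>
    matters.\<close>
  have K_eq: "- K = (\<lambda>p. snd p 0) -` (- \<nat>) \<union>
      (\<Union>n. (\<lambda>p. snd p 0) -` {real n - 1 <..< real n + 1} \<inter> (\<lambda>p. (fst p, \<lambda>k. snd p (Suc k))) -` (- C n))"
    (is "_ = ?A \<union> ?B")
  proof (intro set_eqI iffI)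
    fix p assume "p \<in> - K"
    show "p \<in> ?A \<union> ?B"
    proof (cases "snd p 0 \<in> \<nat>")
      case True
      then obtain n where "snd p 0 = real n" by (auto simp: Nats_def)
      with \<open>p \<in> - K\<close> show ?thesis by (intro UnI2 UN_I[of n]) (auto simp: K_def)
    qed simp
  next
    fix p assume "p \<in> ?A \<union> ?B"
    then show "p \<in> - K"
    proof
      assume "p \<in> ?B"
      then obtain n where n: "real n - 1 < snd p 0" "snd p 0 < real n + 1"
        "(fst p, \<lambda>k. snd p (Suc k)) \<notin> C n" by auto
      have "m = n" if "snd p 0 = real m" for m using that n(1,2) by linarith
      with n(3) show ?thesis unfolding K_def by blast
    qed (auto simp: K_def)
  qed
  have "open (- K)"
    unfolding K_eq using C(1)
    by (intro open_Un open_UN ballI open_Int open_vimage coord continuous_reindex)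
      (auto simp: open_Compl)
  then have "closed K" by (simp add: closed_def)
  moreover have "inj_on fst K"
  proof (rule inj_onI)
    fix p q assume pq: "p \<in> K" "q \<in> K" "fst p = fst q"
    obtain n where n: "snd p 0 = real n" "(fst p, \<lambda>k. snd p (Suc k)) \<in> C n" using pq by (auto simp: K_def)
    obtain m where m: "snd q 0 = real m" "(fst q, \<lambda>k. snd q (Suc k)) \<in> C m" using pq by (auto simp: K_def)
    have "fst p \<in> B n" using imageI[OF n(2), of fst] C(3)[of n] by simp
    moreover have "fst p \<in> B m" using imageI[OF m(2), of fst] C(3)[of m] pq(3) by simp
    ultimately have [simp]: "m = n" using assms(2) by (auto simp: disjoint_family_on_def)
    have "(fst p, \<lambda>k. snd p (Suc k)) = (fst q, \<lambda>k. snd q (Suc k))"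
      using n m pq by (intro inj_onD[OF C(2)[of n]]) auto
    then have *: "snd p (Suc k) = snd q (Suc k)" for k by (auto dest: fun_cong)
    have "snd p j = snd q j" for j using * n m by (cases j) auto
    with pq(3) show "p = q" by (intro prod_eqI ext)
  qed
  moreover have "fst ` K = (\<Union>n. B n)"
  proof safe
    fix z f assume "(z, f) \<in> K"
    then obtain n where "(z, \<lambda>k. f (Suc k)) \<in> C n" by (auto simp: K_def)
    then show "fst (z, f) \<in> (\<Union>n. B n)" using C(3)[of n] by force
  next
    fix z n assume "z \<in> B n"
    then obtain f where f: "(z, f) \<in> C n" using C(3) by force
    have "(z, case_nat (real n) f) \<in> K" using f by (auto simp: K_def)
    then show "z \<in> fst ` K" by force
  qed
  ultimately show ?thesis unfolding inj_closed_proj_def by blast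
qed

lemma inj_closed_proj_Int:
  assumes "inj_closed_proj A" "inj_closed_proj B" shows "inj_closed_proj (A \<inter> B)"
proof -
  have "inj_closed_proj (\<Inter>n. case_nat A (\<lambda>_. B) n)"
    by (rule inj_closed_proj_Inter) (use assms in \<open>auto split: nat.split\<close>)
  also have "(\<Inter>n. case_nat A (\<lambda>_. B) n) = A \<inter> B"
    by (auto split: nat.splits)
  finally show ?thesis .
qed

text \<open>The induction carries the complement along, since the property is not visibly closed
  under complements. Unions are first made disjoint; the differences arising there are intersections
  with complements, which the stronger induction hypothesis covers.\<close>

lemma inj_closed_proj_borel:
  assumes "B \<in> sets (borel :: 'z::metric_space measure)" shows "inj_closed_proj B"
proof -
  have "B \<in> sigma_sets UNIV {S. open S}" using assms by (simp add: borel_def)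
  then have "inj_closed_proj B \<and> inj_closed_proj (- B)"
  proof induction
    case (Basic a) then show ?case
      by (auto intro: inj_closed_proj_open inj_closed_proj_closed)
  next
    case Empty then show ?case by (auto intro: inj_closed_proj_closed)
  next
    case (Compl a) then show ?case by (simp add: Compl_eq_Diff_UNIV[symmetric])
  next
    case (Union a)
    have fin: "inj_closed_proj (\<Inter>j\<in>{..<n}. - a j)" for n
    proof (induction n)
      case (Suc n)
      then show ?case using Union by (simp add: lessThan_Suc inj_closed_proj_Int)
    qed (simp add: inj_closed_proj_closed)
    have eq: "disjointed a n = a n \<inter> (\<Inter>j\<in>{..<n}. - a j)" for n
      by (auto simp: disjointed_def)
    have "inj_closed_proj (\<Union>n. disjointed a n)"
      using Union fin by (intro inj_closed_proj_disjoint_Union disjoint_family_disjointed)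
        (auto simp: eq intro!: inj_closed_proj_Int)
    moreover have "inj_closed_proj (\<Inter>n. - a n)"
      using Union by (intro inj_closed_proj_Inter) auto
    ultimately show ?case by (simp add: UN_disjointed_eq)
  qed
  then show ?thesis ..
qed

section \<open>Lusin separation of disjoint projections\<close>

definition borel_sep :: "'x::topological_space set \<Rightarrow> 'x set \<Rightarrow> bool" where
  "borel_sep A B \<longleftrightarrow> (\<exists>S\<in>sets borel. A \<subseteq> S \<and> S \<inter> B = {})"

lemma borel_sep_UN:
  fixes A B :: "nat \<Rightarrow> 'x::topological_space set"
  assumes "\<And>i j. borel_sep (A i) (B j)"
  shows "borel_sep (\<Union>i. A i) (\<Union>j. B j)"
proof -
  obtain S where S: "\<And>i j. S i j \<in> sets borel" "\<And>i j. A i \<subseteq> S i j" "\<And>i j. S i j \<inter> B j = {}"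
    using assms unfolding borel_sep_def by metis
  show ?thesis unfolding borel_sep_def
  proof (rule bexI[of _ "\<Union>i. \<Inter>j. S i j"], intro conjI)
    show "(\<Union>i. A i) \<subseteq> (\<Union>i. \<Inter>j. S i j)" by (intro UN_mono order_refl INT_greatest S(2))
    have "x \<notin> B j" if "x \<in> S i j" for x i j using S(3)[of i j] that by blast
    then show "(\<Union>i. \<Inter>j. S i j) \<inter> (\<Union>j. B j) = {}" by auto
    show "(\<Union>i. \<Inter>j. S i j) \<in> sets borel"
      using S(1) by (intro sets.countable_UN' sets.countable_INT'') auto
  qed
qed

lemma Cauchy_of_cells:
  fixes z :: "nat \<Rightarrow> 'z::metric_space"
  assumes "\<And>N m n. m \<ge> N \<Longrightarrow> n \<ge> N \<Longrightarrow> dist (z m) (z n) < 1 / real (Suc N)"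
  shows "Cauchy z"
proof (rule metric_CauchyI)
  fix e :: real assume "e > 0"
  then obtain N where "1 / real (Suc N) < e" using nat_approx_posE by metis
  with assms show "\<exists>M. \<forall>m\<ge>M. \<forall>n\<ge>M. dist (z m) (z n) < e" by (meson less_trans)
qed

text \<open>By contradiction: inseparability passes to some pair of cells of the two sets
  (\<open>borel_sep_UN\<close>), hence survives ever finer cells. These shrink to a point of
  \<open>C1\<close> and a point of \<open>C2\<close> with different projections, and a small ball
  around one projection does separate late cells.\<close>

lemma borel_sep_closed:
  fixes C1 C2 :: "('x::{complete_space,second_countable_topology} \<times> 't::{complete_space,second_countable_topology}) set"
  assumes C: "closed C1" "closed C2" and disj: "fst ` C1 \<inter> fst ` C2 = {}"
  shows "borel_sep (fst ` C1) (fst ` C2)"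
proof (rule ccontr)
  assume nsep: "\<not> ?thesis"
  obtain P :: "nat \<Rightarrow> 'x \<times> 't \<Rightarrow> nat"
    where P: "\<And>n a b. P n a = P n b \<Longrightarrow> dist a b < 1 / real (Suc n)"
    using borel_cells_exist[where 'z="'x \<times> 't"] by blast
  define Q where "Q = (\<lambda>n K L. \<exists>i j. L = (fst K \<inter> P n -` {i}, snd K \<inter> P n -` {j}))"
  have "\<exists>K. \<forall>n. ((n = 0 \<longrightarrow> K n = (C1, C2)) \<and> \<not> borel_sep (fst ` fst (K n)) (fst ` snd (K n))) \<and> Q n (K n) (K (Suc n))"
  proof (rule dependent_nat_choice)
    show "\<exists>K. (0 = (0::nat) \<longrightarrow> K = (C1, C2)) \<and> \<not> borel_sep (fst ` fst K) (fst ` snd K)"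
      using nsep by auto
  next
    fix K :: "('x \<times> 't) set \<times> ('x \<times> 't) set" and n :: nat
    assume K: "(n = 0 \<longrightarrow> K = (C1, C2)) \<and> \<not> borel_sep (fst ` fst K) (fst ` snd K)"
    have "\<exists>i j. \<not> borel_sep (fst ` (fst K \<inter> P n -` {i})) (fst ` (snd K \<inter> P n -` {j}))"
    proof (rule ccontr)
      assume "\<not> ?thesis"
      then have "borel_sep (\<Union>i. fst ` (fst K \<inter> P n -` {i})) (\<Union>j. fst ` (snd K \<inter> P n -` {j}))"
        by (intro borel_sep_UN) auto
      also have "(\<Union>i. fst ` (fst K \<inter> P n -` {i})) = fst ` fst K" by auto
      also have "(\<Union>i. fst ` (snd K \<inter> P n -` {i})) = fst ` snd K" by auto
      finally show False using K by simp
    qed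
    then show "\<exists>L. ((Suc n = 0 \<longrightarrow> L = (C1, C2)) \<and> \<not> borel_sep (fst ` fst L) (fst ` snd L)) \<and> Q n K L"
      unfolding Q_def by auto
  qed
  then obtain K where K0: "K 0 = (C1, C2)"
    and Ks: "\<And>n. \<not> borel_sep (fst ` fst (K n)) (fst ` snd (K n))" and KQ: "\<And>n. Q n (K n) (K (Suc n))"
    by metis
  \<comment> \<open>Applied to both sequences of cells. Completeness gives the limit, and closedness
    of the initial set alone keeps it inside; the later cells are merely Borel.\<close>
  have lim: "\<exists>l\<in>c (0::nat). \<forall>n. \<forall>p\<in>c (Suc n). dist p l \<le> 1 / real (Suc n)"
    if cl: "closed (c 0)" and ne: "\<And>n. c n \<noteq> {}" and step: "\<And>n. \<exists>i. c (Suc n) = c n \<inter> P n -` {i}"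
    for c :: "nat \<Rightarrow> ('x \<times> 't) set"
  proof -
    define z where "z n = (SOME p. p \<in> c (Suc n))" for n
    have z: "z n \<in> c (Suc n)" for n
      unfolding z_def using ne[of "Suc n"] by (simp add: some_in_eq)
    have dec: "c n \<subseteq> c m" if "m \<le> n" for m n
      using that by (rule lift_Suc_antimono_le[rotated]) (use step in blast)
    have close: "dist p q < 1 / real (Suc n)" if "p \<in> c (Suc n)" "q \<in> c (Suc n)" for p q n
      using step[of n] that by (intro P) auto
    have "Cauchy z"
      by (rule Cauchy_of_cells) (rule close; rule subsetD[OF dec z]; simp)
    then obtain l where l: "z \<longlonglongrightarrow> l" using Cauchy_convergent convergent_def by blast
    have "l \<in> c 0"
      by (rule closed_sequentially[OF cl _ l]) (rule allI subsetD[OF dec z] | simp)+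
    moreover have "dist p l \<le> 1 / real (Suc n)" if "p \<in> c (Suc n)" for n p
    proof (rule LIMSEQ_le_const2)
      show "(\<lambda>m. dist p (z m)) \<longlonglongrightarrow> dist p l" using l by (intro tendsto_intros)
      show "\<exists>N. \<forall>m\<ge>N. dist p (z m) \<le> 1 / real (Suc n)"
        using close[OF that] subsetD[OF dec z] by (meson less_imp_le not_less_eq_eq Suc_le_mono)
    qed
    ultimately show ?thesis by blast
  qed
  have ne: "fst (K n) \<noteq> {}" "snd (K n) \<noteq> {}" for n
    using Ks[of n] unfolding borel_sep_def by force+
  have step: "\<exists>i. fst (K (Suc n)) = fst (K n) \<inter> P n -` {i}" "\<exists>i. snd (K (Suc n)) = snd (K n) \<inter> P n -` {i}" for n
    using KQ[of n] unfolding Q_def by auto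
  have cl: "closed (fst (K 0))" "closed (snd (K 0))" using C by (simp_all add: K0)
  obtain a where a: "a \<in> C1" "\<And>n p. p \<in> fst (K (Suc n)) \<Longrightarrow> dist p a \<le> 1 / real (Suc n)"
    using lim[of "\<lambda>n. fst (K n)", OF cl(1) ne(1) step(1)] K0 by auto
  obtain b where b: "b \<in> C2" "\<And>n p. p \<in> snd (K (Suc n)) \<Longrightarrow> dist p b \<le> 1 / real (Suc n)"
    using lim[of "\<lambda>n. snd (K n)", OF cl(2) ne(2) step(2)] K0 by auto
  define r where "r = dist (fst a) (fst b) / 2"
  have "fst a \<noteq> fst b" using a(1) b(1) disj by blast
  then have "r > 0" by (simp add: r_def)
  then obtain n where n: "1 / real (Suc n) < r" using nat_approx_posE by metis
  have "borel_sep (fst ` fst (K (Suc n))) (fst ` snd (K (Suc n)))"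
    unfolding borel_sep_def
  proof (rule bexI[of _ "ball (fst a) r"], safe)
    fix x t assume "(x, t) \<in> fst (K (Suc n))"
    from a(2)[OF this] show "fst (x, t) \<in> ball (fst a) r"
      using n dist_fst_le[of "(x, t)" a] by (auto simp: dist_commute)
  next
    fix x t assume "(x, t) \<in> snd (K (Suc n))" and x: "fst (x, t) \<in> ball (fst a) r"
    from b(2)[OF this(1)] have "dist x (fst b) < r"
      using n dist_fst_le[of "(x, t)" b] by auto
    moreover have "dist (fst a) x < r" using x by simp
    ultimately have "dist (fst a) (fst b) < r + r"
      using dist_triangle[of "fst a" "fst b" x] by linarith
    then show "fst (x, t) \<in> {}" by (simp add: r_def)
  qed simp
  with Ks show False by blast
qed

lemma closed_reassoc:
  assumes "closed (C :: (('a::topological_space \<times> 'b::topological_space) \<times> 'c::topological_space) set)"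
  shows "closed {p. ((fst p, fst (snd p)), snd (snd p)) \<in> C}"
proof -
  have "closed ((\<lambda>p. ((fst p, fst (snd p)), snd (snd p))) -` C)"
    using assms by (intro closed_vimage continuous_intros)
  then show ?thesis by (simp add: vimage_def)
qed

lemma fst_image_reassoc:
  "fst ` {p. ((fst p, fst (snd p)), snd (snd p)) \<in> C} = fst ` fst ` C"
proof -
  have "x \<in> fst ` {p. ((fst p, fst (snd p)), snd (snd p)) \<in> C} \<longleftrightarrow> (\<exists>y z. ((x, y), z) \<in> C)" for x
    by (simp add: image_iff)
  moreover have "x \<in> fst ` fst ` C \<longleftrightarrow> (\<exists>y z. ((x, y), z) \<in> C)" for x
    by (simp add: image_iff Bex_def)
  ultimately show ?thesis by (intro set_eqI) (simp only:)
qed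

text \<open>A Borel subset of the product is itself a projection of a closed set, whose extra
  coordinates are absorbed into the second factor.\<close>

lemma borel_sep_borel:
  fixes K1 K2 :: "('x::{complete_space,second_countable_topology} \<times> 't::{complete_space,second_countable_topology}) set"
  assumes K: "K1 \<in> sets borel" "K2 \<in> sets borel" and disj: "fst ` K1 \<inter> fst ` K2 = {}"
  shows "borel_sep (fst ` K1) (fst ` K2)"
proof -
  have ex: "\<exists>C :: ('x \<times> ('t \<times> (nat \<Rightarrow> real))) set. closed C \<and> fst ` C = fst ` K" if K: "K \<in> sets borel" for K :: "('x \<times> 't) set"
  proof -
    from inj_closed_proj_borel[OF K, unfolded inj_closed_proj_def]
    obtain C :: "(('x \<times> 't) \<times> (nat \<Rightarrow> real)) set"
      where C: "closed C" "inj_on fst C" "fst ` C = K" by blast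
    have "fst ` {p. ((fst p, fst (snd p)), snd (snd p)) \<in> C} = fst ` K"
      unfolding C(3)[symmetric] by (rule fst_image_reassoc)
    with closed_reassoc[OF C(1)] show ?thesis by blast
  qed
  obtain C1 C2 :: "('x \<times> ('t \<times> (nat \<Rightarrow> real))) set"
    where "closed C1" "fst ` C1 = fst ` K1" "closed C2" "fst ` C2 = fst ` K2"
    using ex K by metis
  with borel_sep_closed[of C1 C2] disj show ?thesis by simp
qed

text \<open>\<open>B' i\<close> contains \<open>A i\<close> and misses every other
  \<open>A j\<close>. Subtracting the other \<open>B' j\<close> therefore makes the sets disjoint
  without removing a point of \<open>A i\<close>.\<close>

lemma borel_sep_family:
  fixes A :: "nat \<Rightarrow> 'x::topological_space set"
  assumes "\<And>i j. i \<noteq> j \<Longrightarrow> borel_sep (A i) (A j)"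
  shows "\<exists>B. (\<forall>i. B i \<in> sets borel \<and> A i \<subseteq> B i) \<and> disjoint_family B"
proof -
  define S where "S i j = (SOME S. S \<in> sets borel \<and> A i \<subseteq> S \<and> S \<inter> A j = {})" for i j
  have S: "S i j \<in> sets borel \<and> A i \<subseteq> S i j \<and> S i j \<inter> A j = {}" if "i \<noteq> j" for i j
    using assms[OF that] unfolding borel_sep_def S_def Bex_def by (rule someI_ex)
  define B' where "B' i = (\<Inter>j\<in>- {i}. S i j)" for i
  define B where "B i = B' i - (\<Union>j\<in>- {i}. B' j)" for i
  have ne: "- {i} \<noteq> {}" for i :: nat by (metis ComplI Suc_n_not_le_n empty_iff order_refl singletonD)
  have "B' i \<in> sets borel" for i
    unfolding B'_def using S ne by (intro sets.countable_INT'') auto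
  then have "B i \<in> sets borel" for i
    unfolding B_def by (intro sets.Diff sets.countable_UN') auto
  moreover have "A i \<subseteq> B i" for i
  proof
    fix x assume x: "x \<in> A i"
    then have "x \<in> S i j" if "i \<noteq> j" for j using S[OF that] by blast
    then have "x \<in> B' i" unfolding B'_def by auto
    moreover have "x \<notin> B' j" if "j \<noteq> i" for j
      using S[OF that] x that unfolding B'_def by auto
    ultimately show "x \<in> B i" unfolding B_def by auto
  qed
  moreover have "disjoint_family B"
    unfolding disjoint_family_on_def B_def by blast
  ultimately show ?thesis by blast
qed

text \<open>Injectivity makes the projections of different cells disjoint, hence separable by
  disjoint Borel sets. These let a point determine its own address, so that \<open>W\<close> needs
  only a countable union at each level instead of a union over all infinite branches. A point of
  \<open>W\<close> then yields a Cauchy sequence in \<open>C\<close> whose limit projects to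
  it.\<close>

lemma borel_inj_proj_closed:
  fixes C :: "('x::{complete_space,second_countable_topology} \<times> 't::{complete_space,second_countable_topology}) set"
  assumes C: "closed C" and inj: "inj_on fst C"
  shows "fst ` C \<in> sets borel"
proof -
  obtain P :: "nat \<Rightarrow> 'x \<times> 't \<Rightarrow> nat"
    where P: "\<And>n a b. P n a = P n b \<Longrightarrow> dist a b < 1 / real (Suc n)"
      and P_meas [measurable]: "\<And>n. P n \<in> borel \<rightarrow>\<^sub>M count_space UNIV"
    using borel_cells_exist[where 'z="'x \<times> 't"] by blast
  have [measurable]: "C \<in> sets borel" using C by simp
  have "\<exists>B. (\<forall>i. B i \<in> sets borel \<and> fst ` (C \<inter> P n -` {i}) \<subseteq> B i) \<and> disjoint_family B" for n
  proof (rule borel_sep_family, rule borel_sep_borel)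
    show "C \<inter> P n -` {i} \<in> sets borel" for i
      using measurable_sets[OF P_meas[of n], of "{i}"] by (intro sets.Int) auto
    show "C \<inter> P n -` {i} \<in> sets borel" for i
      using measurable_sets[OF P_meas[of n], of "{i}"] by (intro sets.Int) auto
    show "fst ` (C \<inter> P n -` {i}) \<inter> fst ` (C \<inter> P n -` {j}) = {}" if "i \<noteq> j" for i j
      using that inj by (auto dest!: inj_onD)
  qed
  then obtain B where B: "\<And>n i. B n i \<in> sets borel" "\<And>n i. fst ` (C \<inter> P n -` {i}) \<subseteq> B n i"
    "\<And>n. disjoint_family (B n)" by metis
  define W where "W = (\<Inter>n. \<Union>s\<in>{s :: nat list. length s = Suc n}.
    (\<Inter>m\<in>{..n}. B m (s ! m)) \<inter> closure (fst ` {z \<in> C. \<forall>m\<le>n. P m z = s ! m}))"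
  have "W \<in> sets borel"
    unfolding W_def using B(1)
    by (intro sets.countable_INT sets.countable_UN' sets.Int sets.finite_INT) auto
  moreover have "fst ` C \<subseteq> W"
  proof safe
    fix x t assume z: "(x, t) \<in> C"
    have "x \<in> (\<Union>s\<in>{s :: nat list. length s = Suc n}.
      (\<Inter>m\<in>{..n}. B m (s ! m)) \<inter> closure (fst ` {z \<in> C. \<forall>m\<le>n. P m z = s ! m}))" for n
    proof (rule UN_I, rule CollectI, rule length_map[THEN trans, OF length_upt[THEN trans]])
      define s where "s = map (\<lambda>m. P m (x, t)) [0..<Suc n]"
      have s: "s ! m = P m (x, t)" if "m \<le> n" for m
        using that by (simp add: s_def nth_map_upt[of _ "Suc n" 0, simplified] del: upt_Suc)
      show "x \<in> (\<Inter>m\<in>{..n}. B m (map (\<lambda>m. P m (x, t)) [0..<Suc n] ! m)) \<inter>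
        closure (fst ` {z \<in> C. \<forall>m\<le>n. P m z = map (\<lambda>m. P m (x, t)) [0..<Suc n] ! m})"
        unfolding s_def[symmetric]
      proof (intro IntI INT_I subsetD[OF closure_subset])
        fix m assume "m \<in> {..n}"
        then show "x \<in> B m (s ! m)" using B(2)[of m "P m (x, t)"] z s by force
      next
        show "x \<in> fst ` {z \<in> C. \<forall>m\<le>n. P m z = s ! m}" using z s by force
      qed
    qed simp
    then show "fst (x, t) \<in> W" by (simp add: W_def)
  qed
  moreover have "W \<subseteq> fst ` C"
  proof
    fix x assume x: "x \<in> W"
    then have "\<forall>n. \<exists>s :: nat list. length s = Suc n \<and> (\<forall>m\<le>n. x \<in> B m (s ! m)) \<and>
        x \<in> closure (fst ` {z \<in> C. \<forall>m\<le>n. P m z = s ! m})"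
      unfolding W_def by fastforce
    from choice[OF this] obtain s where s: "\<And>n m. m \<le> n \<Longrightarrow> x \<in> B m (s n ! m)"
      "\<And>n. x \<in> closure (fst ` {z \<in> C. \<forall>m\<le>n. P m z = s n ! m})" by auto
    \<comment> \<open>The addresses found at different levels agree on common entries, because the
      disjoint sets \<open>B m\<close> leave x only one possible entry \<open>m\<close>.\<close>
    define c where "c m = s m ! m" for m
    have "s n ! m = c m" if "m \<le> n" for m n
      using s(1)[OF that] s(1)[of m m] B(3)[of m] unfolding c_def disjoint_family_on_def by blast
    then have eq: "{z \<in> C. \<forall>m\<le>n. P m z = s n ! m} = {z \<in> C. \<forall>m\<le>n. P m z = c m}" for n by auto
    have "x \<in> closure (fst ` {z \<in> C. \<forall>m\<le>n. P m z = c m})" for n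
      using s(2)[of n] unfolding eq[of n] .
    then have "\<exists>y\<in>fst ` {z \<in> C. \<forall>m\<le>n. P m z = c m}. dist y x < 1 / real (Suc n)" for n
      unfolding closure_approachable by (meson of_nat_0_less_iff zero_less_Suc zero_less_divide_1_iff)
    then have "\<forall>n. \<exists>z. z \<in> C \<and> (\<forall>m\<le>n. P m z = c m) \<and> dist (fst z) x < 1 / real (Suc n)"
      by blast
    from choice[OF this] obtain z where z: "\<And>n. z n \<in> C" "\<And>n m. m \<le> n \<Longrightarrow> P m (z n) = c m"
      "\<And>n. dist (fst (z n)) x < 1 / real (Suc n)" by auto
    have "Cauchy z"
      by (rule Cauchy_of_cells, rule P) (simp add: z(2))
    then obtain l where l: "z \<longlonglongrightarrow> l" using Cauchy_convergent convergent_def by blast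
    then have "l \<in> C" using z(1) C closed_sequentially by blast
    have "(\<lambda>n. dist (fst (z n)) x) \<longlonglongrightarrow> 0"
      by (rule tendsto_sandwich[OF _ _ tendsto_const LIMSEQ_inverse_real_of_nat])
        (use z(3) in \<open>auto intro!: always_eventually less_imp_le simp: inverse_eq_divide\<close>)
    moreover have "(\<lambda>n. dist (fst (z n)) x) \<longlonglongrightarrow> dist (fst l) x"
      using l by (intro tendsto_intros)
    ultimately have "fst l = x" using LIMSEQ_unique by fastforce
    with \<open>l \<in> C\<close> show "x \<in> fst ` C" by blast
  qed
  ultimately show ?thesis by (metis subset_antisym)
qed

text \<open>\<open>R\<close> is replaced by a closed set with extra coordinates. Its projection to
  the first factor is a composition of two injective projections.\<close>

theorem Lusin_Souslin_projection:
  fixes R :: "('x::{complete_space,second_countable_topology} \<times> 'y::{complete_space,second_countable_topology}) set"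
  assumes R: "R \<in> sets borel" and inj: "inj_on fst R"
  shows "fst ` R \<in> sets borel"
proof -
  from inj_closed_proj_borel[OF R, unfolded inj_closed_proj_def]
  obtain C :: "(('x \<times> 'y) \<times> (nat \<Rightarrow> real)) set"
    where C: "closed C" "inj_on fst C" "fst ` C = R" by blast
  define C' where "C' = {p. ((fst p, fst (snd p)), snd (snd p)) \<in> C}"
  have "inj_on fst C'"
  proof (rule inj_onI)
    fix p q assume pq: "p \<in> C'" "q \<in> C'" "fst p = fst q"
    have "(fst p, fst (snd p)) = (fst q, fst (snd q))"
      using pq C(3) by (intro inj_onD[OF inj]) (force simp: C'_def)+
    with pq have "((fst p, fst (snd p)), snd (snd p)) = ((fst q, fst (snd q)), snd (snd q))"
      by (intro inj_onD[OF C(2)]) (auto simp: C'_def)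
    with pq(3) show "p = q" by (simp add: prod_eq_iff)
  qed
  moreover have "closed C'" unfolding C'_def by (rule closed_reassoc[OF C(1)])
  moreover have "fst ` C' = fst ` R" unfolding C(3)[symmetric] C'_def by (rule fst_image_reassoc)
  ultimately show ?thesis using borel_inj_proj_closed[of C'] by simp
qed

section \<open>Enumerating neighbours\<close>

text \<open>Base 3 rather than 2 avoids ambiguous expansions: the term at the first difference is
  twice the largest possible tail.\<close>

lemma ternary_sum_less:
  fixes a b :: "nat \<Rightarrow> real"
  assumes a: "\<And>n. a n \<in> {0, 1}" and b: "\<And>n. b n \<in> {0, 1}"
    and eq: "\<And>n. n < N \<Longrightarrow> a n = b n" and N: "a N = 0" "b N = 1"
  shows "(\<Sum>n. a n * (1/3)^n) < (\<Sum>n. b n * (1/3)^n)"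
proof -
  have geo: "summable (\<lambda>n. (1/3 :: real)^n)" by (rule summable_geometric) simp
  have sum: "summable (\<lambda>n. c n * (1/3)^n)" if "\<And>n. c n \<in> {0, 1}" for c :: "nat \<Rightarrow> real"
  proof (rule summable_comparison_test'[OF geo, of 0])
    show "norm (c n * (1/3)^n) \<le> (1/3)^n" for n using that[of n] by auto
  qed
  define f where "f n = (b n - a n) * (1/3)^n" for n
  have sf: "summable f"
    unfolding f_def left_diff_distrib by (intro summable_diff sum a b)
  have "suminf f = (\<Sum>n. f (n + Suc N)) + (\<Sum>i<Suc N. f i)"
    by (rule suminf_split_initial_segment[OF sf])
  also have "(\<Sum>i<Suc N. f i) = (1/3)^N" using eq N by (simp add: f_def)
  finally have 1: "suminf f = (\<Sum>n. f (n + Suc N)) + (1/3)^N" .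
  have geoN: "(\<lambda>n. (1/3 :: real)^(n + Suc N)) sums ((1/3)^N / 2)"
  proof -
    have "(\<lambda>n. (1/3 :: real)^n) sums (1 / (1 - 1/3))" by (rule geometric_sums) simp
    from sums_mult2[OF this, of "(1/3)^Suc N"] show ?thesis by (simp add: power_add)
  qed
  have "(\<Sum>n. - ((1/3 :: real)^(n + Suc N))) \<le> (\<Sum>n. f (n + Suc N))"
  proof (rule suminf_le)
    fix n
    have "b (n + Suc N) - a (n + Suc N) \<ge> -1" using a[of "n + Suc N"] b[of "n + Suc N"] by auto
    from mult_right_mono[OF this, of "(1/3)^(n + Suc N)"]
    show "- ((1/3 :: real)^(n + Suc N)) \<le> f (n + Suc N)" by (simp add: f_def)
    show "summable (\<lambda>n. - ((1/3 :: real)^(n + Suc N)))"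
      using geoN by (intro summable_minus) (rule sums_summable)
    show "summable (\<lambda>n. f (n + Suc N))" using sf by (rule summable_ignore_initial_segment)
  qed
  also have "(\<Sum>n. - ((1/3 :: real)^(n + Suc N))) = - ((1/3)^N / 2)"
    using sums_minus[OF geoN] by (rule sums_unique[symmetric])
  finally have "suminf f > 0" unfolding 1 using zero_less_power[of "1/3::real" N] by linarith
  moreover have "suminf f = (\<Sum>n. b n * (1/3)^n) - (\<Sum>n. a n * (1/3)^n)"
    unfolding f_def left_diff_distrib by (rule suminf_diff[symmetric]) (intro sum a b)+
  ultimately show ?thesis by simp
qed

text \<open>The ternary digits of \<open>h x\<close> record which sets of a countable basis contain
  x. By the Hausdorff property these memberships determine x.\<close>

lemma borel_injection_real_exists:
  "\<exists>h :: 'a::{second_countable_topology,t2_space} \<Rightarrow> real. h \<in> borel_measurable borel \<and> inj h"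
proof -
  obtain B :: "'a set set" where B: "countable B" "topological_basis B"
    using ex_countable_basis by blast
  define U where "U = from_nat_into B"
  have "B \<noteq> {}"
  proof
    assume "B = {}"
    with topological_basisE[OF B(2) open_UNIV UNIV_I] show False by blast
  qed
  then have rU: "range U = B" unfolding U_def using B(1) by (rule range_from_nat_into)
  have [measurable]: "U n \<in> sets borel" for n
    using topological_basis_open[OF B(2)] rU by (intro borel_open) auto
  define h :: "'a \<Rightarrow> real" where "h x = (\<Sum>n. indicator (U n) x * (1/3)^n)" for x
  have "h \<in> borel_measurable borel" unfolding h_def by measurable
  moreover have "inj h"
  proof (rule injI, rule ccontr)
    fix x y assume h: "h x = h y" and ne: "x \<noteq> y"
    then obtain V where V: "open V" "x \<in> V" "y \<notin> V" using hausdorff[OF ne] by blast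
    from topological_basisE[OF B(2) V(1,2)] obtain W where "W \<in> B" "x \<in> W" "W \<subseteq> V" .
    then have ex: "\<exists>n. (x \<in> U n) \<noteq> (y \<in> U n)" using V rU by (metis rangeE subsetD)
    define N where "N = (LEAST n. (x \<in> U n) \<noteq> (y \<in> U n))"
    have N: "(x \<in> U N) \<noteq> (y \<in> U N)" unfolding N_def by (rule LeastI_ex[OF ex])
    have lt: "(x \<in> U n) = (y \<in> U n)" if "n < N" for n
      using not_less_Least[of n] that unfolding N_def by blast
    have "h x < h y \<or> h y < h x"
    proof (cases "x \<in> U N")
      case True
      then have "h y < h x" unfolding h_def
        using N lt by (intro ternary_sum_less[of _ _ N]) (auto simp: indicator_def)
      then show ?thesis ..
    next
      case False
      then have "h x < h y" unfolding h_def
        using N lt by (intro ternary_sum_less[of _ _ N]) (auto simp: indicator_def)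
      then show ?thesis ..
    qed
    with h show False by simp
  qed
  ultimately show ?thesis by blast
qed

lemma borel_measurable_coordinate:
  "(\<lambda>p :: 'a::{second_countable_topology} \<times> (nat \<Rightarrow> 'a). snd p i) \<in> borel_measurable borel"
  by (intro borel_measurable_continuous_onI
      continuous_on_product_then_coordinatewise[OF continuous_on_snd[OF continuous_on_id]])

text \<open>The neighbours of \<open>x\<close>, listed in increasing order, form the unique point over \<open>x\<close> of a Borel set.
  Borelness of the degree comes first, by downward induction: among the points of degree at most \<open>d\<close>,
  those of degree \<open>d\<close> are an injective projection.\<close>

lemma neighbour_enumeration:
  fixes R :: "('a::{complete_space,second_countable_topology} \<times> 'a) set"
  assumes R: "R \<in> sets borel" and fin: "\<And>x. finite {y. (x, y) \<in> R}" and bound: "\<And>x. card {y. (x, y) \<in> R} \<le> D"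
  shows "(\<lambda>x. card {y. (x, y) \<in> R}) \<in> borel \<rightarrow>\<^sub>M count_space UNIV"
    and "\<exists>f. (\<forall>i. f i \<in> borel_measurable borel) \<and>
          (\<forall>x. bij_betw (\<lambda>i. f i x) {..<card {y. (x, y) \<in> R}} {y. (x, y) \<in> R})"
proof -
  obtain h :: "'a \<Rightarrow> real" where h [measurable]: "h \<in> borel_measurable borel" and inj: "inj h"
    using borel_injection_real_exists by blast
  define S where "S x = {y. (x, y) \<in> R}" for x
  \<comment> \<open>Entries from \<open>d\<close> on are padded by the base point itself, so that an
    increasing list of \<open>d\<close> neighbours is one point in the Polish space of
    sequences.\<close>
  define W :: "nat \<Rightarrow> ('a \<times> (nat \<Rightarrow> 'a)) set" where
    "W d = {p. (\<forall>i<d. (fst p, snd p i) \<in> R) \<and> (\<forall>i. Suc i < d \<longrightarrow> h (snd p i) < h (snd p (Suc i))) \<and> (\<forall>i\<ge>d. snd p i = fst p)}" for d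
  note borel_measurable_coordinate [measurable] R [measurable]
  have [measurable]: "(\<lambda>p :: 'a \<times> (nat \<Rightarrow> 'a). fst p) \<in> borel_measurable borel"
    by (intro borel_measurable_continuous_onI continuous_intros)
  have W [measurable]: "W d \<in> sets borel" for d
    unfolding W_def by measurable
  have sorted: "sorted_wrt (<) (map (\<lambda>i. h (t i)) [0..<d])" if "(x, t) \<in> W d" for x t d
  proof -
    have "h (t i) < h (t j)" if "i < j" "j < d" for i j
      using that
    proof (induction j)
      case (Suc j)
      have "h (t j) < h (t (Suc j))" using \<open>(x, t) \<in> W d\<close> Suc by (auto simp: W_def)
      with Suc show ?case by (cases "i = j") auto
    qed simp
    then show ?thesis by (auto simp: sorted_wrt_iff_nth_less)
  qed
  have card_le: "d \<le> card (S x) \<and> (card (S x) = d \<longrightarrow> map (\<lambda>i. h (t i)) [0..<d] = sorted_list_of_set (h ` S x))"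
    if Wt: "(x, t) \<in> W d" for x t d
  proof -
    have sub: "set (map (\<lambda>i. h (t i)) [0..<d]) \<subseteq> h ` S x" using Wt by (auto simp: W_def S_def)
    have dist: "distinct (map (\<lambda>i. h (t i)) [0..<d])" and sort: "sorted (map (\<lambda>i. h (t i)) [0..<d])"
      using sorted[OF Wt] by (simp_all add: strict_sorted_iff del: distinct_map)
    have fin': "finite (h ` S x)" using fin by (simp add: S_def)
    have ch: "card (h ` S x) = card (S x)" using inj by (intro card_image) (auto simp: inj_on_def)
    have cd: "card (set (map (\<lambda>i. h (t i)) [0..<d])) = d" using distinct_card[OF dist] by simp
    have "d \<le> card (S x)" using card_mono[OF fin' sub] ch cd by simp
    moreover have "map (\<lambda>i. h (t i)) [0..<d] = sorted_list_of_set (h ` S x)" if "card (S x) = d"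
    proof -
      have "set (map (\<lambda>i. h (t i)) [0..<d]) = h ` S x"
        using card_subset_eq[OF fin' sub] cd ch that by simp
      then show ?thesis
        using sorted_distinct_set_unique[OF sort dist, of "sorted_list_of_set (h ` S x)"] fin' by simp
    qed
    ultimately show ?thesis by blast
  qed
  have ex: "\<exists>t. (x, t) \<in> W (card (S x))" for x
  proof -
    define xs where "xs = sorted_list_of_set (h ` S x)"
    have fin': "finite (h ` S x)" using fin by (simp add: S_def)
    have "card (h ` S x) = card (S x)" using inj by (intro card_image) (auto simp: inj_on_def)
    then have len: "length xs = card (S x)" by (simp add: xs_def)
    define t where "t i = (if i < card (S x) then the_inv h (xs ! i) else x)" for i
    have mem: "xs ! i \<in> h ` S x" if "i < card (S x)" for i
      using nth_mem[of i xs] that len fin' by (simp add: xs_def)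
    have ht: "h (t i) = xs ! i" if "i < card (S x)" for i
      using that mem[OF that] inj by (auto simp: t_def the_inv_f_f)
    have tS: "t i \<in> S x" if "i < card (S x)" for i
      using that mem[OF that] inj by (auto simp: t_def the_inv_f_f)
    have "sorted_wrt (<) xs" unfolding xs_def by (rule strict_sorted_list_of_set)
    then have "h (t i) < h (t (Suc i))" if "Suc i < card (S x)" for i
      using that len by (auto simp: ht sorted_wrt_iff_nth_less)
    then have "(x, t) \<in> W (card (S x))" using tS by (auto simp: W_def S_def t_def)
    then show ?thesis by (rule exI[of _ t])
  qed
  have unique: "t = t'" if "(x, t) \<in> W d" "(x, t') \<in> W d" "card (S x) = d" for x t t' d
  proof
    fix i
    have "map (\<lambda>i. h (t i)) [0..<d] = map (\<lambda>i. h (t' i)) [0..<d]"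
      using card_le[OF that(1)] card_le[OF that(2)] that(3) by simp
    then have "h (t i) = h (t' i)" if "i < d" for i using that by simp
    then show "t i = t' i" using that(1,2) inj by (cases "i < d") (auto simp: W_def inj_eq)
  qed
  have ge: "{x. d \<le> card (S x)} \<in> sets borel" if "d \<le> Suc D" for d
    using that
  proof (induction rule: inc_induct)
    case base
    have "{x. Suc D \<le> card (S x)} = {}" using bound by (auto simp: S_def not_le less_Suc_eq_le)
    then show ?case by simp
  next
    case (step d)
    note [measurable] = step.IH
    define K where "K = W d \<inter> {p. fst p \<notin> {x. Suc d \<le> card (S x)}}"
    have K: "card (S x) = d" if "(x, t) \<in> K" for x t
      using that card_le[of x t d] by (auto simp: K_def)
    have "fst ` K \<in> sets borel"
    proof (rule Lusin_Souslin_projection)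
      show "K \<in> sets borel" unfolding K_def by measurable
      show "inj_on fst K"
        using K unique by (auto simp: inj_on_def K_def)
    qed
    moreover have "{x. d \<le> card (S x)} = {x. Suc d \<le> card (S x)} \<union> fst ` K"
    proof safe
      fix x assume "d \<le> card (S x)" "x \<notin> fst ` K"
      with ex[of x] show "Suc d \<le> card (S x)"
        by (cases "card (S x) = d") (force simp: K_def)+
    qed (use K in auto)
    ultimately show ?case using step.IH by simp
  qed
  have card_meas [measurable]: "(\<lambda>x. card (S x)) \<in> borel \<rightarrow>\<^sub>M count_space UNIV"
  proof (subst measurable_count_space_eq2_countable, safe)
    fix d
    have "(\<lambda>x. card (S x)) -` {d} \<inter> space borel = {x. d \<le> card (S x)} - {x. Suc d \<le> card (S x)}" by auto
    moreover have "{x. d \<le> card (S x)} - {x. Suc d \<le> card (S x)} \<in> sets borel"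
    proof (cases "d \<le> D")
      case False
      then have "\<not> d \<le> card (S x)" for x using bound[of x] unfolding S_def by linarith
      then have "{x. d \<le> card (S x)} = {}" by blast
      then show ?thesis by simp
    qed (use ge in auto)
    ultimately show "(\<lambda>x. card (S x)) -` {d} \<inter> space borel \<in> sets borel" by simp
  qed auto
  then show "(\<lambda>x. card {y. (x, y) \<in> R}) \<in> borel \<rightarrow>\<^sub>M count_space UNIV" by (simp add: S_def)
  define t where "t x = (SOME t. (x, t) \<in> W (card (S x)))" for x
  have t: "(x, t x) \<in> W (card (S x))" for x unfolding t_def by (rule someI_ex[OF ex])
  have t_unique: "u = t x" if "(x, u) \<in> W (card (S x))" for x u
    using unique[OF that t] by simp
  define f where "f i x = t x i" for i x
  have "f i \<in> borel_measurable borel" for i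
  proof (rule measurableI)
    fix B :: "'a set" assume [measurable]: "B \<in> sets borel"
    \<comment> \<open>The part of the graph of \<open>t\<close> whose entry \<open>i\<close> lies in
      \<open>B\<close>. Its injective projection is the preimage of \<open>B\<close> under
      \<open>f i\<close>.\<close>
    define K where "K = {p. p \<in> W (card (S (fst p))) \<and> snd p i \<in> B}"
    have "fst ` K \<in> sets borel"
    proof (rule Lusin_Souslin_projection)
      have "K = {p. \<exists>d. card (S (fst p)) = d \<and> p \<in> W d \<and> snd p i \<in> B}" by (auto simp: K_def)
      also have "\<dots> \<in> sets borel" by measurable
      finally show "K \<in> sets borel" .
      show "inj_on fst K"
      proof (rule inj_onI)
        fix p q assume "p \<in> K" "q \<in> K" "fst p = fst q"
        then show "p = q" using t_unique[of "fst p" "snd p"] t_unique[of "fst q" "snd q"]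
          by (cases p; cases q) (auto simp: K_def)
      qed
    qed
    moreover have "f i -` B \<inter> space borel = fst ` K"
    proof (intro set_eqI iffI)
      fix x assume "x \<in> f i -` B \<inter> space borel"
      then have "(x, t x) \<in> K" using t by (simp add: K_def f_def)
      then show "x \<in> fst ` K" by force
    next
      fix x assume "x \<in> fst ` K"
      then obtain u where "(x, u) \<in> K" by auto
      then show "x \<in> f i -` B \<inter> space borel" using t_unique[of x u] by (auto simp: K_def f_def)
    qed
    ultimately show "f i -` B \<inter> space borel \<in> sets borel" by simp
  qed simp
  moreover have "bij_betw (\<lambda>i. f i x) {..<card (S x)} (S x)" for x
  proof -
    have "inj_on (\<lambda>i. f i x) {..<card (S x)}"
    proof -
      have "distinct (map (\<lambda>i. h (t x i)) [0..<card (S x)])"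
        using sorted[OF t] by (simp add: strict_sorted_iff del: distinct_map)
      then have "inj_on (\<lambda>i. h (t x i)) {..<card (S x)}" by (simp add: distinct_map atLeast0LessThan)
      then show ?thesis unfolding f_def inj_on_def by auto
    qed
    moreover have "(\<lambda>i. f i x) ` {..<card (S x)} \<subseteq> S x" using t[of x] by (auto simp: W_def S_def f_def)
    moreover have "finite (S x)" using fin by (simp add: S_def)
    ultimately show ?thesis
      by (simp add: bij_betw_def card_subset_eq card_image)
  qed
  ultimately show "\<exists>f. (\<forall>i. f i \<in> borel_measurable borel) \<and>
          (\<forall>x. bij_betw (\<lambda>i. f i x) {..<card {y. (x, y) \<in> R}} {y. (x, y) \<in> R})"
    unfolding S_def by blast
qed

section \<open>Mass transport\<close>

text \<open>A partial measure-preserving bijection. Preservation is tested on functions of the pair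
  (x, f x) rather than on sets: in this form it composes easily and sums directly to mass
  transport.\<close>

definition mp_iso :: "'a measure \<Rightarrow> 'a set \<Rightarrow> ('a \<Rightarrow> 'a) \<Rightarrow> 'a set \<Rightarrow> ('a \<Rightarrow> 'a) \<Rightarrow> bool" where
  "mp_iso M A f B g \<longleftrightarrow> A \<in> sets M \<and> B \<in> sets M \<and> f \<in> M \<rightarrow>\<^sub>M M \<and> g \<in> M \<rightarrow>\<^sub>M M \<and>
     (\<forall>x\<in>A. f x \<in> B \<and> g (f x) = x) \<and> (\<forall>y\<in>B. g y \<in> A \<and> f (g y) = y) \<and>
     (\<forall>m\<in>borel_measurable (M \<Otimes>\<^sub>M M).
        (\<integral>\<^sup>+x. m (x, f x) * indicator A x \<partial>M) = (\<integral>\<^sup>+y. m (g y, y) * indicator B y \<partial>M))"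

text \<open>The graphs may overlap. Countable families of such graphs are closed under composition
  and countable union, which is how the property reaches the connectedness relation.\<close>

definition mp_relation :: "'a measure \<Rightarrow> ('a \<times> 'a) set \<Rightarrow> bool" where
  "mp_relation M R \<longleftrightarrow> (\<exists>A f B g. (\<forall>k::nat. mp_iso M (A k) (f k) (B k) (g k)) \<and>
     R = {(x, y). \<exists>k. x \<in> A k \<and> y = f k x})"

lemma mp_iso_id: "mp_iso M (space M) (\<lambda>x. x) (space M) (\<lambda>x. x)"
  by (auto simp: mp_iso_def)

lemma mp_iso_integral:
  assumes "mp_iso M A f B g" "m \<in> borel_measurable (M \<Otimes>\<^sub>M M)"
  shows "(\<integral>\<^sup>+x. m (x, f x) * indicator A x \<partial>M) = (\<integral>\<^sup>+y. m (g y, y) * indicator B y \<partial>M)"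
  using assms by (simp add: mp_iso_def)

text \<open>The identity for the first map is applied to m(x, f2 y) cut down to y in
  \<open>A2\<close>, and the one for the second map to m(g1 y, z) cut down to y in
  \<open>B1\<close>.\<close>

lemma mp_iso_comp:
  assumes 1: "mp_iso M A1 f1 B1 g1" and 2: "mp_iso M A2 f2 B2 g2"
  shows "mp_iso M (A1 \<inter> f1 -` A2) (f2 \<circ> f1) (B2 \<inter> g2 -` B1) (g1 \<circ> g2)"
proof -
  have [measurable]: "f1 \<in> M \<rightarrow>\<^sub>M M" "f2 \<in> M \<rightarrow>\<^sub>M M" "g1 \<in> M \<rightarrow>\<^sub>M M" "g2 \<in> M \<rightarrow>\<^sub>M M"
    "A1 \<in> sets M" "A2 \<in> sets M" "B1 \<in> sets M" "B2 \<in> sets M"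
    using 1 2 by (auto simp: mp_iso_def)
  have "A1 \<inter> f1 -` A2 = A1 \<inter> (f1 -` A2 \<inter> space M)" "B2 \<inter> g2 -` B1 = B2 \<inter> (g2 -` B1 \<inter> space M)"
    using sets.sets_into_space[of A1 M] sets.sets_into_space[of B2 M] by auto
  then have sets: "A1 \<inter> f1 -` A2 \<in> sets M" "B2 \<inter> g2 -` B1 \<in> sets M" by simp_all
  have "(\<integral>\<^sup>+x. m (x, (f2 \<circ> f1) x) * indicator (A1 \<inter> f1 -` A2) x \<partial>M) =
        (\<integral>\<^sup>+z. m ((g1 \<circ> g2) z, z) * indicator (B2 \<inter> g2 -` B1) z \<partial>M)"
    if [measurable]: "m \<in> borel_measurable (M \<Otimes>\<^sub>M M)" for m
  proof -
    have "(\<integral>\<^sup>+x. m (x, (f2 \<circ> f1) x) * indicator (A1 \<inter> f1 -` A2) x \<partial>M) =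
        (\<integral>\<^sup>+x. (\<lambda>(x, y). m (x, f2 y) * indicator A2 y) (x, f1 x) * indicator A1 x \<partial>M)"
      by (intro nn_integral_cong) (simp add: indicator_def)
    also have "\<dots> = (\<integral>\<^sup>+y. (\<lambda>(x, y). m (x, f2 y) * indicator A2 y) (g1 y, y) * indicator B1 y \<partial>M)"
      by (rule mp_iso_integral[OF 1]) measurable
    also have "\<dots> = (\<integral>\<^sup>+y. (\<lambda>(y, z). m (g1 y, z) * indicator B1 y) (y, f2 y) * indicator A2 y \<partial>M)"
      by (intro nn_integral_cong) (simp add: indicator_def)
    also have "\<dots> = (\<integral>\<^sup>+z. (\<lambda>(y, z). m (g1 y, z) * indicator B1 y) (g2 z, z) * indicator B2 z \<partial>M)"
      by (rule mp_iso_integral[OF 2]) measurable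
    also have "\<dots> = (\<integral>\<^sup>+z. m ((g1 \<circ> g2) z, z) * indicator (B2 \<inter> g2 -` B1) z \<partial>M)"
      by (intro nn_integral_cong) (auto simp: indicator_def)
    finally show ?thesis .
  qed
  moreover have "\<forall>x\<in>A1 \<inter> f1 -` A2. (f2 \<circ> f1) x \<in> B2 \<inter> g2 -` B1 \<and> (g1 \<circ> g2) ((f2 \<circ> f1) x) = x"
    "\<forall>z\<in>B2 \<inter> g2 -` B1. (g1 \<circ> g2) z \<in> A1 \<inter> f1 -` A2 \<and> (f2 \<circ> f1) ((g1 \<circ> g2) z) = z"
    using 1 2 by (auto simp: mp_iso_def)
  moreover have "f2 \<circ> f1 \<in> M \<rightarrow>\<^sub>M M" "g1 \<circ> g2 \<in> M \<rightarrow>\<^sub>M M" by measurable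
  ultimately show ?thesis using sets unfolding mp_iso_def by blast
qed

lemma mp_relationE:
  assumes "mp_relation M R"
  obtains A f B g where "\<And>k::nat. mp_iso M (A k) (f k) (B k) (g k)"
    "\<And>x y. (x, y) \<in> R \<longleftrightarrow> (\<exists>k. x \<in> A k \<and> y = f k x)"
  using assms unfolding mp_relation_def by blast

lemma mp_relationI:
  assumes "\<And>k::'i::countable. mp_iso M (A k) (f k) (B k) (g k)"
    and R: "\<And>x y. (x, y) \<in> R \<longleftrightarrow> (\<exists>k. x \<in> A k \<and> y = f k x)"
  shows "mp_relation M R"
proof -
  define e :: "nat \<Rightarrow> 'i" where "e = from_nat"
  have "(x, y) \<in> R \<longleftrightarrow> (\<exists>k. x \<in> A (e k) \<and> y = f (e k) x)" for x y
    unfolding R e_def by (metis from_nat_to_nat)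
  then have "R = {(x, y). \<exists>k. x \<in> A (e k) \<and> y = f (e k) x}" by auto
  with assms(1) show ?thesis unfolding mp_relation_def
    by (intro exI[of _ "\<lambda>k. A (e k)"] exI[of _ "\<lambda>k. f (e k)"] exI[of _ "\<lambda>k. B (e k)"] exI[of _ "\<lambda>k. g (e k)"]) simp
qed

lemma mp_relation_Id: "space M = UNIV \<Longrightarrow> mp_relation M Id"
  by (rule mp_relationI[where 'i=nat and A="\<lambda>_. space M" and B="\<lambda>_. space M", OF mp_iso_id]) auto

lemma mp_relation_UN:
  assumes "\<And>n::nat. mp_relation M (R n)"
  shows "mp_relation M (\<Union>n. R n)"
proof -
  have "\<forall>n. \<exists>T. (\<forall>k::nat. mp_iso M (fst (T k)) (fst (snd (T k))) (fst (snd (snd (T k)))) (snd (snd (snd (T k))))) \<and>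
      R n = {(x, y). \<exists>k. x \<in> fst (T k) \<and> y = fst (snd (T k)) x}"
  proof
    fix n
    from assms[of n, unfolded mp_relation_def] obtain A f B g
      where T: "\<forall>k::nat. mp_iso M (A k) (f k) (B k) (g k)" "R n = {(x, y). \<exists>k. x \<in> A k \<and> y = f k x}" by blast
    show "\<exists>T. (\<forall>k::nat. mp_iso M (fst (T k)) (fst (snd (T k))) (fst (snd (snd (T k)))) (snd (snd (snd (T k))))) \<and>
      R n = {(x, y). \<exists>k. x \<in> fst (T k) \<and> y = fst (snd (T k)) x}"
      by (rule exI[of _ "\<lambda>k. (A k, f k, B k, g k)"]) (simp add: T)
  qed
  from choice[OF this] obtain T where
    T: "\<And>n k::nat. mp_iso M (fst (T n k)) (fst (snd (T n k))) (fst (snd (snd (T n k)))) (snd (snd (snd (T n k))))"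
      "\<And>n. R n = {(x, y). \<exists>k. x \<in> fst (T n k) \<and> y = fst (snd (T n k)) x}" by blast
  show ?thesis
  proof (rule mp_relationI)
    fix p :: "nat \<times> nat"
    show "mp_iso M (fst (T (fst p) (snd p))) (fst (snd (T (fst p) (snd p))))
      (fst (snd (snd (T (fst p) (snd p))))) (snd (snd (snd (T (fst p) (snd p)))))" by (rule T(1))
    show "(x, y) \<in> (\<Union>n. R n) \<longleftrightarrow>
      (\<exists>p. x \<in> fst (T (fst p) (snd p)) \<and> y = fst (snd (T (fst p) (snd p))) x)" for x y
      by (simp add: T(2))
  qed
qed

lemma mp_relation_relcomp:
  assumes "mp_relation M R" "mp_relation M S"
  shows "mp_relation M (R O S)"
proof -
  from assms(1) obtain A1 f1 B1 g1 where 1: "\<And>k::nat. mp_iso M (A1 k) (f1 k) (B1 k) (g1 k)"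
    "\<And>x y. (x, y) \<in> R \<longleftrightarrow> (\<exists>k. x \<in> A1 k \<and> y = f1 k x)" by (rule mp_relationE) blast
  from assms(2) obtain A2 f2 B2 g2 where 2: "\<And>k::nat. mp_iso M (A2 k) (f2 k) (B2 k) (g2 k)"
    "\<And>x y. (x, y) \<in> S \<longleftrightarrow> (\<exists>k. x \<in> A2 k \<and> y = f2 k x)" by (rule mp_relationE) blast
  show ?thesis
  proof (rule mp_relationI)
    fix p :: "nat \<times> nat"
    show "mp_iso M (A1 (fst p) \<inter> f1 (fst p) -` A2 (snd p)) (f2 (snd p) \<circ> f1 (fst p))
      (B2 (snd p) \<inter> g2 (snd p) -` B1 (fst p)) (g1 (fst p) \<circ> g2 (snd p))"
      by (rule mp_iso_comp[OF 1(1) 2(1)])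
    show "(x, y) \<in> R O S \<longleftrightarrow> (\<exists>p. x \<in> A1 (fst p) \<inter> f1 (fst p) -` A2 (snd p) \<and> y = (f2 (snd p) \<circ> f1 (fst p)) x)" for x y
      by (auto simp: relcomp_unfold 1(2) 2(2))
  qed
qed

lemma mp_relation_rtrancl:
  assumes "space M = UNIV" "mp_relation M R"
  shows "mp_relation M (R\<^sup>*)"
proof -
  have "mp_relation M (R ^^ n)" for n
    by (induction n) (use assms in \<open>auto intro: mp_relation_Id mp_relation_relcomp\<close>)
  then have "mp_relation M (\<Union>n. R ^^ n)" by (rule mp_relation_UN)
  then show ?thesis by (simp add: rtrancl_is_UN_relpow)
qed

lemma nn_integral_count_space_single:
  assumes "\<And>y. y \<noteq> a \<Longrightarrow> F y = 0"
  shows "(\<integral>\<^sup>+y. F y \<partial>count_space UNIV) = F a"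
  using nn_integral_count_space'[of "{a}" UNIV F] assms by auto

text \<open>Along a single graph the exchange is part of \<open>mp_iso\<close>. A pair lying on
  several graphs must be counted once, so \<open>G\<close> assigns it to the first of them.\<close>

theorem mass_transport:
  fixes M :: "'a::{second_countable_topology,t2_space} measure"
  assumes R: "mp_relation M R" and M: "sets M = sets borel" and m: "m \<in> borel_measurable (M \<Otimes>\<^sub>M M)"
  shows "(\<integral>\<^sup>+x. \<integral>\<^sup>+y. m (x, y) \<partial>count_space {y. (x, y) \<in> R} \<partial>M) =
         (\<integral>\<^sup>+y. \<integral>\<^sup>+x. m (x, y) \<partial>count_space {x. (x, y) \<in> R} \<partial>M)"
proof -
  note [measurable_cong] = M
  note m [measurable]
  from R obtain A f B g where iso: "\<And>k::nat. mp_iso M (A k) (f k) (B k) (g k)"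
    and R_iff: "\<And>x y. (x, y) \<in> R \<longleftrightarrow> (\<exists>k. x \<in> A k \<and> y = f k x)" by (rule mp_relationE) blast
  have [measurable]: "A k \<in> sets M" "B k \<in> sets M" "f k \<in> M \<rightarrow>\<^sub>M M" "g k \<in> M \<rightarrow>\<^sub>M M" for k
    using iso[of k] by (auto simp: mp_iso_def)
  have [measurable]: "f k \<in> borel_measurable M" "g k \<in> borel_measurable M" for k
    using iso[of k] unfolding mp_iso_def measurable_cong_sets[OF refl M] by auto
  define G where "G k = {p. fst p \<in> A k \<and> snd p = f k (fst p) \<and> (\<forall>l<k. \<not> (fst p \<in> A l \<and> snd p = f l (fst p)))}" for k
  have sp: "space M = UNIV" using sets_eq_imp_space_eq[OF M] by simp
  have [measurable]: "fst \<in> borel_measurable (M \<Otimes>\<^sub>M M)" "snd \<in> borel_measurable (M \<Otimes>\<^sub>M M)"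
    unfolding measurable_cong_sets[OF refl M, symmetric] by simp_all
  have G [measurable]: "G k \<in> sets (M \<Otimes>\<^sub>M M)" for k
  proof -
    have "G k = {p \<in> space (M \<Otimes>\<^sub>M M). fst p \<in> A k \<and> snd p = f k (fst p) \<and> (\<forall>l<k. \<not> (fst p \<in> A l \<and> snd p = f l (fst p)))}"
      by (auto simp: G_def sp space_pair_measure)
    also have "\<dots> \<in> sets (M \<Otimes>\<^sub>M M)" by measurable
    finally show ?thesis .
  qed
  have G_inv: "fst p = g k (snd p) \<and> snd p \<in> B k" if "p \<in> G k" for p k
    using that iso[of k] by (auto simp: G_def mp_iso_def)
  have ind: "(\<Sum>k. indicator (G k) p) = (indicator R p :: ennreal)" for p
  proof -
    have "disjoint_family G" by (auto simp: disjoint_family_on_def G_def) (metis linorder_neqE_nat)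
    moreover have "(\<Union>k. G k) = R"
    proof (rule set_eqI)
      fix p :: "'a \<times> 'a"
      have "p \<in> R \<longleftrightarrow> (\<exists>k. fst p \<in> A k \<and> snd p = f k (fst p))" using R_iff[of "fst p" "snd p"] by simp
      also have "\<dots> \<longleftrightarrow> (\<exists>k. p \<in> G k)"
        unfolding G_def mem_Collect_eq using exists_least_iff[of "\<lambda>k. fst p \<in> A k \<and> snd p = f k (fst p)"] by blast
      finally show "p \<in> (\<Union>k. G k) \<longleftrightarrow> p \<in> R" by auto
    qed
    ultimately show ?thesis using suminf_indicator[of G p] by simp
  qed
  have 1: "(\<integral>\<^sup>+y. m (x, y) \<partial>count_space {y. (x, y) \<in> R}) =
      (\<Sum>k. m (x, f k x) * indicator (G k) (x, f k x) * indicator (A k) x)" for x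
  proof -
    have "(\<integral>\<^sup>+y. m (x, y) \<partial>count_space {y. (x, y) \<in> R}) = (\<integral>\<^sup>+y. m (x, y) * indicator R (x, y) \<partial>count_space UNIV)"
      by (subst nn_integral_count_space_indicator) (auto intro!: nn_integral_cong simp: indicator_def)
    also have "\<dots> = (\<integral>\<^sup>+y. (\<Sum>k. m (x, y) * indicator (G k) (x, y)) \<partial>count_space UNIV)"
      by (simp add: ind)
    also have "\<dots> = (\<Sum>k. \<integral>\<^sup>+y. m (x, y) * indicator (G k) (x, y) \<partial>count_space UNIV)"
      by (rule nn_integral_suminf) simp
    also have "\<dots> = (\<Sum>k. m (x, f k x) * indicator (G k) (x, f k x))"
      by (intro suminf_cong nn_integral_count_space_single) (auto simp: G_def indicator_def)
    also have "\<dots> = (\<Sum>k. m (x, f k x) * indicator (G k) (x, f k x) * indicator (A k) x)"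
      by (intro suminf_cong) (auto simp: G_def indicator_def)
    finally show ?thesis .
  qed
  have 2: "(\<integral>\<^sup>+x. m (x, y) \<partial>count_space {x. (x, y) \<in> R}) =
      (\<Sum>k. m (g k y, y) * indicator (G k) (g k y, y) * indicator (B k) y)" for y
  proof -
    have "(\<integral>\<^sup>+x. m (x, y) \<partial>count_space {x. (x, y) \<in> R}) = (\<integral>\<^sup>+x. m (x, y) * indicator R (x, y) \<partial>count_space UNIV)"
      by (subst nn_integral_count_space_indicator) (auto intro!: nn_integral_cong simp: indicator_def)
    also have "\<dots> = (\<integral>\<^sup>+x. (\<Sum>k. m (x, y) * indicator (G k) (x, y)) \<partial>count_space UNIV)"
      by (simp add: ind)
    also have "\<dots> = (\<Sum>k. \<integral>\<^sup>+x. m (x, y) * indicator (G k) (x, y) \<partial>count_space UNIV)"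
      by (rule nn_integral_suminf) simp
    also have "\<dots> = (\<Sum>k. m (g k y, y) * indicator (G k) (g k y, y))"
      by (intro suminf_cong nn_integral_count_space_single) (auto simp: indicator_def dest: G_inv)
    also have "\<dots> = (\<Sum>k. m (g k y, y) * indicator (G k) (g k y, y) * indicator (B k) y)"
      by (intro suminf_cong) (auto simp: indicator_def dest: G_inv)
    finally show ?thesis .
  qed
  have "(\<integral>\<^sup>+x. \<integral>\<^sup>+y. m (x, y) \<partial>count_space {y. (x, y) \<in> R} \<partial>M) =
      (\<Sum>k. \<integral>\<^sup>+x. (\<lambda>p. m p * indicator (G k) p) (x, f k x) * indicator (A k) x \<partial>M)"
    unfolding 1 by (rule nn_integral_suminf) measurable
  also have "\<dots> = (\<Sum>k. \<integral>\<^sup>+y. (\<lambda>p. m p * indicator (G k) p) (g k y, y) * indicator (B k) y \<partial>M)"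
  proof (rule suminf_cong)
    fix k
    show "(\<integral>\<^sup>+x. (\<lambda>p. m p * indicator (G k) p) (x, f k x) * indicator (A k) x \<partial>M) =
      (\<integral>\<^sup>+y. (\<lambda>p. m p * indicator (G k) p) (g k y, y) * indicator (B k) y \<partial>M)"
      by (rule mp_iso_integral[OF iso]) measurable
  qed
  also have "\<dots> = (\<integral>\<^sup>+y. \<integral>\<^sup>+x. m (x, y) \<partial>count_space {x. (x, y) \<in> R} \<partial>M)"
    unfolding 2 by (rule nn_integral_suminf[symmetric]) measurable
  finally show ?thesis .
qed

text \<open>Outside \<open>A k\<close> the map falls back to x itself, which belongs to the class by
  reflexivity; the enumeration therefore has repetitions.\<close>

lemma mp_relation_enumeration:
  assumes R: "mp_relation M R" and refl: "\<And>x. (x, x) \<in> R"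
  shows "\<exists>\<phi> :: nat \<Rightarrow> 'a \<Rightarrow> 'a. (\<forall>k. \<phi> k \<in> M \<rightarrow>\<^sub>M M) \<and> (\<forall>x. {y. (x, y) \<in> R} = range (\<lambda>k. \<phi> k x))"
proof -
  from R obtain A f B g where iso: "\<And>k::nat. mp_iso M (A k) (f k) (B k) (g k)"
    and R_iff: "\<And>x y. (x, y) \<in> R \<longleftrightarrow> (\<exists>k. x \<in> A k \<and> y = f k x)" by (rule mp_relationE) blast
  have [measurable]: "A k \<in> sets M" "f k \<in> M \<rightarrow>\<^sub>M M" for k
    using iso[of k] by (auto simp: mp_iso_def)
  define \<phi> where "\<phi> k x = (if x \<in> A k then f k x else x)" for k x
  have "\<phi> k \<in> M \<rightarrow>\<^sub>M M" for k unfolding \<phi>_def by measurable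
  moreover have "{y. (x, y) \<in> R} = range (\<lambda>k. \<phi> k x)" for x
    using R_iff refl by (auto simp: \<phi>_def)
  ultimately show ?thesis by blast
qed

lemma sum_lessThan_delta_mult:
  assumes "\<And>k. k < n \<Longrightarrow> F k = (if k = i then c else (0::ennreal))" "\<not> i < n \<Longrightarrow> c = 0"
  shows "(\<Sum>k<(n::nat). F k) = c"
proof -
  have "(\<Sum>k<n. F k) = (\<Sum>k<n. if k = i then c else 0)" using assms(1) by (intro sum.cong) auto
  also have "\<dots> = c" using assms(2) by (cases "i < n") simp_all
  finally show ?thesis .
qed

section \<open>Adjacency as a union of measure-preserving partial maps\<close>

lemma adj_sym: "(x, y) \<in> adj E \<longleftrightarrow> (y, x) \<in> adj E"
  by (simp add: adj_def Upair.abs_eq[symmetric]) (metis Upair_inject)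

text \<open>The identity in \<open>graphing\<close> says that the measure \<open>\<nu>\<close> of
  directed edges gives \<open>A \<times> B\<close> and \<open>B \<times> A\<close> the same mass.
  Rectangles determine a finite measure, so \<open>\<nu>\<close> is invariant under reversal.
  Restricting to edges that are the i-th at one end and the j-th at the other gives the partial
  bijections.\<close>

lemma graphing_mp_relation_adj:
  fixes M :: "'a::polish_space measure"
  assumes G: "graphing M E"
  shows "mp_relation M (adj E)"
proof -
  interpret prob_space M using G by (simp add: graphing_def)
  have M: "sets M = sets borel" using G by (simp add: graphing_def)
  have sp: "space M = UNIV" using sets_eq_imp_space_eq[OF M] by simp
  have MM: "sets (M \<Otimes>\<^sub>M M) = sets (borel :: ('a \<times> 'a) measure)"
    using sets_pair_measure_cong[OF M M] unfolding borel_prod .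
  obtain D where D: "\<And>x. finite {y. Upair x y \<in> E}" "\<And>x. deg E x \<le> D"
    using G unfolding graphing_def by blast
  define N where "N x = {y. (x, y) \<in> adj E}" for x
  define d where "d x = card (N x)" for x
  have fin: "finite (N x)" for x using D(1)[of x] by (simp add: N_def adj_def)
  have dD: "d x \<le> D" for x using D(2)[of x] by (simp add: d_def N_def adj_def deg_def deg_in_def)
  have E: "adj E \<in> sets borel" using G MM by (simp add: graphing_def)
  have d_borel: "d \<in> borel \<rightarrow>\<^sub>M count_space UNIV"
    unfolding d_def N_def using fin dD unfolding d_def N_def by (rule neighbour_enumeration(1)[OF E])
  have "\<exists>f. (\<forall>i. f i \<in> borel_measurable borel) \<and> (\<forall>x. bij_betw (\<lambda>i. f i x) {..<d x} (N x))"
    unfolding d_def N_def using fin dD unfolding d_def N_def by (rule neighbour_enumeration(2)[OF E])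
  then obtain f where f_borel: "\<And>i::nat. f i \<in> borel_measurable borel"
    and bij: "\<And>x. bij_betw (\<lambda>i. f i x) {..<d x} (N x)" by blast
  have f_mem: "f i x \<in> N x" if "i < d x" for i x using bij[of x] that by (auto simp: bij_betw_def)
  have f_inj: "i = j" if "f i x = f j x" "i < d x" "j < d x" for i j x
    using bij[of x] that by (auto simp: bij_betw_def inj_on_def)
  have f_ex: "\<exists>i<d x. f i x = y" if "y \<in> N x" for x y
    using that unfolding bij_betw_imp_surj_on[OF bij, of x, symmetric] by auto

  have [measurable]: "d \<in> M \<rightarrow>\<^sub>M count_space UNIV"
    using d_borel by (simp add: measurable_cong_sets[OF M refl])
  have f_MM [measurable]: "f i \<in> M \<rightarrow>\<^sub>M M" for i
    using f_borel[of i] by (simp add: measurable_cong_sets[OF M M])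
  have f_M [measurable]: "f i \<in> borel_measurable M" for i
    using f_borel[of i] by (simp add: measurable_cong_sets[OF M refl])
  note [measurable_cong] = M
  have fstsnd [measurable]: "fst \<in> borel_measurable (M \<Otimes>\<^sub>M M)" "snd \<in> borel_measurable (M \<Otimes>\<^sub>M M)"
    unfolding measurable_cong_sets[OF refl M, symmetric] by simp_all
  \<comment> \<open>\<open>Q\<close> lives on pairs of an index and a vertex with the index below
    the degree; its image under (i, x) to (x, f i x) is the measure of directed edges.\<close>
  define Q where "Q = density (count_space {..<D} \<Otimes>\<^sub>M M) (\<lambda>(i, x). indicator {..<d x} i)"
  define \<nu> where "\<nu> = distr Q (M \<Otimes>\<^sub>M M) (\<lambda>(i, x). (x, f i x))"
  have Q1 [measurable]: "(\<lambda>(i, x). indicator {..<d x} i :: ennreal) \<in> borel_measurable (count_space {..<D} \<Otimes>\<^sub>M M)"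
  proof (rule measurable_pair_measure_countable1)
    fix i
    have "(\<lambda>x. if i < d x then 1 else 0 :: ennreal) \<in> borel_measurable M" by measurable
    then show "(\<lambda>y. (\<lambda>(i, x). indicator {..<d x} i :: ennreal) (i, y)) \<in> borel_measurable M"
      by (simp add: indicator_def)
  qed simp
  have Q2 [measurable]: "(\<lambda>(i, x). (x, f i x)) \<in> (count_space {..<D} \<Otimes>\<^sub>M M) \<rightarrow>\<^sub>M (M \<Otimes>\<^sub>M M)"
    by (rule measurable_pair_measure_countable1) simp_all
  have Q2' [measurable]: "(\<lambda>(i, x). (x, f i x)) \<in> Q \<rightarrow>\<^sub>M (M \<Otimes>\<^sub>M M)" using Q2 by (simp add: Q_def)
  interpret C: sigma_finite_measure "count_space {..<D}" by (rule sigma_finite_measure_count_space_finite) simp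
  interpret P: pair_sigma_finite "count_space {..<D}" M ..
  have int_\<nu>: "(\<integral>\<^sup>+p. m p \<partial>\<nu>) = (\<integral>\<^sup>+x. (\<Sum>i<d x. m (x, f i x)) \<partial>M)"
    if m: "m \<in> borel_measurable (M \<Otimes>\<^sub>M M)" for m :: "'a \<times> 'a \<Rightarrow> ennreal"
  proof -
    note mQ = measurable_compose[OF Q2 m]
    have "(\<integral>\<^sup>+p. m p \<partial>\<nu>) = (\<integral>\<^sup>+q. m ((\<lambda>(i, x). (x, f i x)) q) \<partial>Q)"
      unfolding \<nu>_def by (rule nn_integral_distr[OF Q2']) (simp add: m)
    also have "\<dots> = (\<integral>\<^sup>+q. (\<lambda>(i, x). indicator {..<d x} i) q * m ((\<lambda>(i, x). (x, f i x)) q) \<partial>(count_space {..<D} \<Otimes>\<^sub>M M))"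
      unfolding Q_def by (rule nn_integral_density[OF Q1 mQ])
    also have "\<dots> = (\<integral>\<^sup>+x. \<integral>\<^sup>+i. indicator {..<d x} i * m (x, f i x) \<partial>count_space {..<D} \<partial>M)"
      by (subst P.nn_integral_snd[symmetric, OF borel_measurable_times_ennreal[OF Q1 mQ]]) simp
    also have "\<dots> = (\<integral>\<^sup>+x. (\<Sum>i<d x. m (x, f i x)) \<partial>M)"
    proof (rule nn_integral_cong)
      fix x
      have "(\<integral>\<^sup>+i. indicator {..<d x} i * m (x, f i x) \<partial>count_space {..<D}) = (\<Sum>i<D. indicator {..<d x} i * m (x, f i x))"
        by (rule nn_integral_count_space_finite) simp
      also have "\<dots> = (\<Sum>i<d x. indicator {..<d x} i * m (x, f i x))"
        using dD[of x] by (intro sum.mono_neutral_right) auto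
      finally show "(\<integral>\<^sup>+i. indicator {..<d x} i * m (x, f i x) \<partial>count_space {..<D}) = (\<Sum>i<d x. m (x, f i x))"
        by simp
    qed
    finally show ?thesis .
  qed
  have \<nu>_rect: "emeasure \<nu> (A \<times> B) = (\<integral>\<^sup>+x\<in>A. of_nat (deg_in E B x) \<partial>M)"
    if [measurable]: "A \<in> sets M" "B \<in> sets M" for A B
  proof -
    have "emeasure \<nu> (A \<times> B) = (\<integral>\<^sup>+p. indicator (A \<times> B) p \<partial>\<nu>)"
      by (simp add: \<nu>_def)
    also have "\<dots> = (\<integral>\<^sup>+x. (\<Sum>i<d x. indicator (A \<times> B) (x, f i x)) \<partial>M)"
      by (rule int_\<nu>) measurable
    also have "\<dots> = (\<integral>\<^sup>+x\<in>A. of_nat (deg_in E B x) \<partial>M)"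
    proof (rule nn_integral_cong)
      fix x
      have "(\<Sum>i<d x. indicator B (f i x)) = (\<Sum>y\<in>N x. indicator B y :: ennreal)"
        by (rule sum.reindex_bij_betw[OF bij])
      also have "\<dots> = of_nat (card (N x \<inter> B))" using fin[of x] by (simp add: indicator_def sum.If_cases Int_def)
      also have "N x \<inter> B = {y \<in> B. Upair x y \<in> E}" by (auto simp: N_def adj_def)
      finally have "(\<Sum>i<d x. indicator B (f i x)) = (of_nat (deg_in E B x) :: ennreal)" by (simp add: deg_in_def)
      then show "(\<Sum>i<d x. indicator (A \<times> B) (x, f i x)) = of_nat (deg_in E B x) * (indicator A x :: ennreal)"
        by (auto simp: indicator_times sum_distrib_left[symmetric] mult.commute)
    qed
    finally show ?thesis .
  qed
  have swap: "(\<lambda>(x, y). (y, x)) \<in> \<nu> \<rightarrow>\<^sub>M (M \<Otimes>\<^sub>M M)" by (simp add: \<nu>_def measurable_pair_swap')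
  have sets_\<nu>: "sets \<nu> = sets (M \<Otimes>\<^sub>M M)" by (simp add: \<nu>_def)
  have \<nu>_swap: "\<nu> = distr \<nu> (M \<Otimes>\<^sub>M M) (\<lambda>(x, y). (y, x))"
  proof (rule measure_eqI_generator_eq[OF Int_stable_pair_measure_generator pair_measure_closed, of M M _ _ "\<lambda>_. UNIV"])
    fix X assume "X \<in> {a \<times> b |a b. a \<in> sets M \<and> b \<in> sets M}"
    then obtain A B where X: "X = A \<times> B" and AB: "A \<in> sets M" "B \<in> sets M" by blast
    have "emeasure (distr \<nu> (M \<Otimes>\<^sub>M M) (\<lambda>(x, y). (y, x))) X = emeasure \<nu> ((\<lambda>(x, y). (y, x)) -` (A \<times> B) \<inter> space \<nu>)"
      unfolding X by (rule emeasure_distr[OF swap]) (simp add: pair_measureI AB)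
    also have "(\<lambda>(x, y). (y, x)) -` (A \<times> B) \<inter> space \<nu> = B \<times> A"
      by (auto simp: \<nu>_def space_pair_measure sp)
    also have "emeasure \<nu> (B \<times> A) = emeasure \<nu> (A \<times> B)"
      using G AB unfolding \<nu>_rect[OF AB] \<nu>_rect[OF AB(2,1)] graphing_def by metis
    finally show "emeasure \<nu> X = emeasure (distr \<nu> (M \<Otimes>\<^sub>M M) (\<lambda>(x, y). (y, x))) X" by (simp add: X)
  next
    show "sets \<nu> = sigma_sets (space M \<times> space M) {a \<times> b |a b. a \<in> sets M \<and> b \<in> sets M}"
      "sets (distr \<nu> (M \<Otimes>\<^sub>M M) (\<lambda>(x, y). (y, x))) = sigma_sets (space M \<times> space M) {a \<times> b |a b. a \<in> sets M \<and> b \<in> sets M}"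
      by (simp_all add: sets_\<nu> sets_pair_measure)
    show "range (\<lambda>_::nat. UNIV) \<subseteq> {a \<times> b |a b. a \<in> sets M \<and> b \<in> sets M}"
      using sets.top[of M] sp by (auto intro!: exI[of _ UNIV])
    show "(\<Union>i::nat. UNIV) = space M \<times> space M" by (simp add: sp)
    \<comment> \<open>The degree bound makes the total mass finite, as the uniqueness theorem for
      measures on a generator requires.\<close>
    fix i :: nat
    have "emeasure \<nu> (UNIV \<times> UNIV) = (\<integral>\<^sup>+x\<in>UNIV. of_nat (deg_in E UNIV x) \<partial>M)"
      using sets.top[of M] sp by (intro \<nu>_rect) simp_all
    also have "\<dots> \<le> (\<integral>\<^sup>+x. of_nat D \<partial>M)"
      using D(2) by (intro nn_integral_mono) (auto simp: deg_def)
    also have "\<dots> < \<infinity>" by (simp add: emeasure_space_1 ennreal_of_nat_eq_real_of_nat)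
    finally show "emeasure \<nu> UNIV \<noteq> \<infinity>" by simp
  qed
  have edge_mtp: "(\<integral>\<^sup>+x. (\<Sum>i<d x. m (x, f i x)) \<partial>M) = (\<integral>\<^sup>+x. (\<Sum>i<d x. m (f i x, x)) \<partial>M)"
    if [measurable]: "m \<in> borel_measurable (M \<Otimes>\<^sub>M M)" for m :: "'a \<times> 'a \<Rightarrow> ennreal"
  proof -
    have sw [measurable]: "(\<lambda>(x, y). m (y, x)) \<in> borel_measurable (M \<Otimes>\<^sub>M M)" by measurable
    have "(\<integral>\<^sup>+x. (\<Sum>i<d x. m (x, f i x)) \<partial>M) = (\<integral>\<^sup>+p. m p \<partial>\<nu>)" by (simp add: int_\<nu>)
    also have "\<dots> = (\<integral>\<^sup>+p. m p \<partial>distr \<nu> (M \<Otimes>\<^sub>M M) (\<lambda>(x, y). (y, x)))" using \<nu>_swap by simp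
    also have "\<dots> = (\<integral>\<^sup>+p. m ((\<lambda>(x, y). (y, x)) p) \<partial>\<nu>)" by (rule nn_integral_distr[OF swap]) (simp add: that)
    also have "\<dots> = (\<integral>\<^sup>+p. (\<lambda>(x, y). m (y, x)) p \<partial>\<nu>)" by (intro nn_integral_cong) auto
    also have "\<dots> = (\<integral>\<^sup>+x. (\<Sum>i<d x. m (f i x, x)) \<partial>M)" using int_\<nu>[OF sw] by simp
    finally show ?thesis .
  qed
  show ?thesis
  proof (rule mp_relationI)
    fix k :: "nat \<times> nat"
    obtain i j where k: "k = (i, j)" by (cases k)
    define A where "A = (\<lambda>(i, j). {x. i < d x \<and> j < d (f i x) \<and> f j (f i x) = x})"
    define B where "B = (\<lambda>(i, j). {y. j < d y \<and> i < d (f j y) \<and> f i (f j y) = y})"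
    have A: "A k \<in> sets M"
    proof -
      have "{x \<in> space M. i < d x \<and> j < d (f i x) \<and> f j (f i x) = x} \<in> sets M" by measurable
      then show ?thesis by (simp only: A_def k sp prod.case UNIV_I simp_thms)
    qed
    have B: "B k \<in> sets M"
    proof -
      have "{y \<in> space M. j < d y \<and> i < d (f j y) \<and> f i (f j y) = y} \<in> sets M" by measurable
      then show ?thesis by (simp only: B_def k sp prod.case UNIV_I simp_thms)
    qed
    have int: "(\<integral>\<^sup>+x. m (x, f i x) * indicator (A k) x \<partial>M) = (\<integral>\<^sup>+y. m (f j y, y) * indicator (B k) y \<partial>M)"
      if [measurable]: "m \<in> borel_measurable (M \<Otimes>\<^sub>M M)" for m :: "'a \<times> 'a \<Rightarrow> ennreal"
    proof -
      \<comment> \<open>Keeps only edges with label \<open>i\<close> at the first end and label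
        \<open>j\<close> at the second, so that each of the two sums over neighbours has at most one
        nonzero term.\<close>
      define m' where "m' p = (if i < d (fst p) \<and> j < d (snd p) \<and> snd p = f i (fst p) \<and> fst p = f j (snd p) then m p else 0)" for p
      have m': "m' \<in> borel_measurable (M \<Otimes>\<^sub>M M)"
      proof -
        define u v u' v' where "u p = d (fst p)" and "v p = d (snd p)" and "u' p = f i (fst p)" and "v' p = f j (snd p)"
          for p :: "'a \<times> 'a"
        have [measurable]: "u \<in> (M \<Otimes>\<^sub>M M) \<rightarrow>\<^sub>M count_space UNIV" "v \<in> (M \<Otimes>\<^sub>M M) \<rightarrow>\<^sub>M count_space UNIV"
          "u' \<in> borel_measurable (M \<Otimes>\<^sub>M M)" "v' \<in> borel_measurable (M \<Otimes>\<^sub>M M)"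
          unfolding u_def v_def u'_def v'_def
          using measurable_compose[OF measurable_fst, of d] measurable_compose[OF measurable_snd, of d]
            measurable_compose[OF measurable_fst f_M] measurable_compose[OF measurable_snd f_M] by simp_all
        have "(\<lambda>p. if i < u p \<and> j < v p \<and> snd p = u' p \<and> fst p = v' p then m p else 0) \<in> borel_measurable (M \<Otimes>\<^sub>M M)"
          by measurable
        then show ?thesis unfolding m'_def u_def v_def u'_def v'_def .
      qed
      have "(\<integral>\<^sup>+x. m (x, f i x) * indicator (A k) x \<partial>M) = (\<integral>\<^sup>+x. (\<Sum>l<d x. m' (x, f l x)) \<partial>M)"
        by (intro nn_integral_cong sum_lessThan_delta_mult[where i=i, symmetric])
          (auto simp: m'_def A_def k indicator_def dest: f_inj)
      also have "\<dots> = (\<integral>\<^sup>+x. (\<Sum>l<d x. m' (f l x, x)) \<partial>M)" by (rule edge_mtp[OF m'])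
      also have "\<dots> = (\<integral>\<^sup>+y. m (f j y, y) * indicator (B k) y \<partial>M)"
        by (intro nn_integral_cong sum_lessThan_delta_mult[where i=j])
          (auto simp: m'_def B_def k indicator_def dest: f_inj)
      finally show ?thesis .
    qed
    have "f i x \<in> B k \<and> f j (f i x) = x" if "x \<in> A k" for x
      using that unfolding A_def B_def k prod.case mem_Collect_eq by metis
    moreover have "f j y \<in> A k \<and> f i (f j y) = y" if "y \<in> B k" for y
      using that unfolding A_def B_def k prod.case mem_Collect_eq by metis
    ultimately have "mp_iso M (A k) (f (fst k)) (B k) (f (snd k))"
      unfolding mp_iso_def k fst_conv snd_conv using A B int f_MM[of i] f_MM[of j] unfolding k by blast
    then show "mp_iso M ((\<lambda>(i, j). {x. i < d x \<and> j < d (f i x) \<and> f j (f i x) = x}) k) (f (fst k))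
       ((\<lambda>(i, j). {y. j < d y \<and> i < d (f j y) \<and> f i (f j y) = y}) k) (f (snd k))"
      unfolding A_def B_def .
  next
    fix x y
    show "(x, y) \<in> adj E \<longleftrightarrow> (\<exists>k. x \<in> (\<lambda>(i, j). {x. i < d x \<and> j < d (f i x) \<and> f j (f i x) = x}) k \<and> y = f (fst k) x)"
    proof
      assume "(x, y) \<in> adj E"
      then have "y \<in> N x" "x \<in> N y" using adj_sym[of x y E] by (auto simp: N_def)
      then obtain i j where "i < d x" "f i x = y" "j < d y" "f j y = x" using f_ex by metis
      then show "\<exists>k. x \<in> (\<lambda>(i, j). {x. i < d x \<and> j < d (f i x) \<and> f j (f i x) = x}) k \<and> y = f (fst k) x"
        by (intro exI[of _ "(i, j)"]) auto
    next
      assume "\<exists>k. x \<in> (\<lambda>(i, j). {x. i < d x \<and> j < d (f i x) \<and> f j (f i x) = x}) k \<and> y = f (fst k) x"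
      then obtain i where "i < d x" "y = f i x" by auto
      then show "(x, y) \<in> adj E" using f_mem[of i x] by (simp add: N_def)
    qed
  qed
qed

section \<open>Clusters and the elder rule\<close>

lemma component_refl [simp]: "x \<in> component F x" by (simp add: component_def)

lemma component_mono: "F \<subseteq> F' \<Longrightarrow> component F x \<subseteq> component F' x"
  unfolding component_def adj_def using rtrancl_mono[of "{(x, y). Upair x y \<in> F}" "{(x, y). Upair x y \<in> F'}"] by auto

lemma component_step: "y \<in> component F x \<Longrightarrow> Upair y z \<in> F \<Longrightarrow> z \<in> component F x"
  unfolding component_def adj_def by (auto intro: rtrancl_into_rtrancl)

lemma component_subsetI:
  assumes "x \<in> S" "\<And>u v. u \<in> S \<Longrightarrow> Upair u v \<in> F \<Longrightarrow> v \<in> S"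
  shows "component F x \<subseteq> S"
proof
  fix y assume "y \<in> component F x"
  then have "(x, y) \<in> (adj F)\<^sup>*" by (simp add: component_def)
  then show "y \<in> S" by induction (use assms in \<open>auto simp: adj_def\<close>)
qed

lemma component_sym: "y \<in> component F x \<longleftrightarrow> x \<in> component F y"
proof -
  have "sym ((adj F)\<^sup>*)" by (intro sym_rtrancl symI) (simp add: adj_sym)
  then show ?thesis unfolding component_def by (auto dest: symD)
qed

lemma component_eq:
  assumes "y \<in> component F x" shows "component F y = component F x"
proof -
  have "component F b \<subseteq> component F a" if "b \<in> component F a" for a b
    using that by (intro component_subsetI) (auto intro: component_step)
  with assms component_sym[of y F x] show ?thesis by blast
qed

definition edge_cut :: "'a uprod set \<Rightarrow> 'a set \<Rightarrow> 'a uprod set" where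
  "edge_cut F S = {e \<in> F. \<exists>u v. e = Upair u v \<and> u \<in> S \<and> v \<notin> S}"

lemma edge_cutI: "Upair u v \<in> F \<Longrightarrow> u \<in> S \<Longrightarrow> v \<notin> S \<Longrightarrow> Upair u v \<in> edge_cut F S"
  unfolding edge_cut_def by blast

lemma cut_component_empty: "edge_cut F (component F x) = {}"
  unfolding edge_cut_def using component_step[of _ F x] by auto

lemma component_subset_if_cut_empty:
  assumes "x \<in> S" "edge_cut F S = {}" shows "component F x \<subseteq> S"
proof (rule component_subsetI)
  show "v \<in> S" if "u \<in> S" "Upair u v \<in> F" for u v
    using edge_cutI[of u v F S] that assms(2) by auto
qed (rule assms(1))

lemma finite_cut:
  assumes "\<And>x. finite {y. Upair x y \<in> F}" "finite S"
  shows "finite (edge_cut F S)"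
proof (rule finite_subset)
  show "edge_cut F S \<subseteq> (\<Union>u\<in>S. Upair u ` {y. Upair u y \<in> F})" unfolding edge_cut_def by blast
  show "finite (\<Union>u\<in>S. Upair u ` {y. Upair u y \<in> F})" using assms by blast
qed

definition edges_above :: "('a uprod \<Rightarrow> 'a uprod \<Rightarrow> bool) \<Rightarrow> 'a uprod set \<Rightarrow> 'a uprod \<Rightarrow> 'a uprod set" where
  "edges_above lt H e = {e' \<in> H. lt e e'}"

definition up_closed :: "('a uprod \<Rightarrow> 'a uprod \<Rightarrow> bool) \<Rightarrow> 'a uprod set \<Rightarrow> 'a uprod set \<Rightarrow> bool" where
  "up_closed lt H U \<longleftrightarrow> U \<subseteq> H \<and> (\<forall>e\<in>U. \<forall>e'\<in>H. lt e e' \<longrightarrow> e' \<in> U)"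

text \<open>The first condition forbids cycles, as the smallest edge of a cycle would join two
  vertices of one cluster. The clusters are those of \<open>H\<close> itself, so that the notion
  applies to parts of the forest.\<close>

definition wired :: "('a uprod \<Rightarrow> 'a uprod \<Rightarrow> bool) \<Rightarrow> 'a uprod set \<Rightarrow> bool" where
  "wired lt H \<longleftrightarrow> (\<forall>u v. Upair u v \<in> H \<longrightarrow> v \<notin> component (edges_above lt H (Upair u v)) u \<and>
     (finite (component (edges_above lt H (Upair u v)) u) \<or> finite (component (edges_above lt H (Upair u v)) v)))"

definition leader :: "('a \<Rightarrow> real) \<Rightarrow> 'a set \<Rightarrow> 'a \<Rightarrow> bool" where
  "leader h S x \<longleftrightarrow> x \<in> S \<and> (\<forall>w\<in>S. h x \<le> h w)"

text \<open>The elder rule: adding \<open>e\<close> merges two clusters of the edges above it, and the leader of the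
  younger one dies.  An infinite cluster has no leader and counts as older than every finite one.\<close>

definition kills :: "('a uprod \<Rightarrow> 'a uprod \<Rightarrow> bool) \<Rightarrow> ('a \<Rightarrow> real) \<Rightarrow> 'a uprod set \<Rightarrow> 'a uprod \<Rightarrow> 'a \<Rightarrow> bool" where
  "kills lt h H e z \<longleftrightarrow> e \<in> H \<and> (\<exists>u v. e = Upair u v \<and>
     finite (component (edges_above lt H e) u) \<and> leader h (component (edges_above lt H e) u) z \<and>
     (infinite (component (edges_above lt H e) v) \<or> (\<exists>w\<in>component (edges_above lt H e) v. h w < h z)))"

text \<open>The cluster of \<open>u\<close> is the smallest candidate for the finite vertex set: if
  \<open>e\<close> is the largest edge leaving a finite set that contains \<open>u\<close>, no
  larger edge leaves this set, so the cluster stays inside it.\<close>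

definition wired_forest :: "('a uprod \<Rightarrow> 'a uprod \<Rightarrow> bool) \<Rightarrow> 'a uprod set \<Rightarrow> 'a uprod set" where
  "wired_forest lt E = {e \<in> E. \<exists>u v. e = Upair u v \<and>
     finite (component (edges_above lt E e) u) \<and> v \<notin> component (edges_above lt E e) u}"

lemma leader_exists:
  assumes "finite S" "S \<noteq> {}" shows "\<exists>z. leader h S z"
proof -
  have "Min (h ` S) \<in> h ` S" using assms by (intro Min_in) auto
  then obtain z where "z \<in> S" "h z = Min (h ` S)" by auto
  with assms(1) show ?thesis unfolding leader_def by (intro exI[of _ z]) auto
qed

lemma leader_unique: "inj h \<Longrightarrow> leader h S x \<Longrightarrow> leader h S y \<Longrightarrow> x = y"
  unfolding leader_def by (intro injD[of h] antisym) auto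

section \<open>Deaths of vertices along a linear order of the edges\<close>

locale edge_order =
  fixes lt :: "'a uprod \<Rightarrow> 'a uprod \<Rightarrow> bool" and h :: "'a \<Rightarrow> real"
  assumes lt_irrefl: "\<not> lt e e" and lt_trans: "lt e f \<Longrightarrow> lt f k \<Longrightarrow> lt e k"
    and lt_total: "e \<noteq> f \<Longrightarrow> lt e f \<or> lt f e" and inj_h: "inj h"
begin

lemma max_exists: "finite B \<Longrightarrow> B \<noteq> {} \<Longrightarrow> \<exists>e\<in>B. \<forall>f\<in>B. f = e \<or> lt f e"
proof (induction rule: finite_ne_induct)
  case (insert x B)
  then obtain e where e: "e \<in> B" "\<forall>f\<in>B. f = e \<or> lt f e" by blast
  show ?case
  proof (cases "lt e x")
    case True
    then show ?thesis using e lt_trans by (intro bexI[of _ x]) auto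
  next
    case False
    then show ?thesis using e lt_total by (intro bexI[of _ e]) auto
  qed
qed auto

lemma above_mono: "lt e f \<Longrightarrow> edges_above lt H f \<subseteq> edges_above lt H e"
  unfolding edges_above_def by (auto intro: lt_trans)

lemma above_chain: "edges_above lt H f \<subseteq> edges_above lt H e \<or> edges_above lt H e \<subseteq> edges_above lt H f"
  using above_mono[of e f H] above_mono[of f e H] lt_total[of e f] by (cases "e = f") auto

lemma up_closed_above: "up_closed lt H (edges_above lt H e)"
  unfolding up_closed_def edges_above_def by (auto intro: lt_trans)

lemma up_closed_insert_above: "e \<in> H \<Longrightarrow> up_closed lt H (insert e (edges_above lt H e))"
  unfolding up_closed_def edges_above_def by (auto intro: lt_trans)

lemma up_closed_chain:
  assumes U: "up_closed lt H U" and U': "up_closed lt H U'" shows "U \<subseteq> U' \<or> U' \<subseteq> U"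
proof (rule ccontr)
  assume "\<not> ?thesis"
  then obtain e f where "e \<in> U" "e \<notin> U'" "f \<in> U'" "f \<notin> U" by blast
  moreover from this have "lt e f \<or> lt f e" by (intro lt_total) auto
  ultimately show False using U U' unfolding up_closed_def by auto
qed

text \<open>No edge above \<open>e\<close> leaves the cluster of x in \<open>U\<close>, so this
  cluster does not grow while the edges between \<open>U\<close> and \<open>e\<close> are
  added.\<close>

lemma cluster_eq_component_above:
  assumes U: "up_closed lt H U" and e: "e \<in> edge_cut H (component U x)"
    and max: "\<forall>f\<in>edge_cut H (component U x). f = e \<or> lt f e"
  shows "component (edges_above lt H e) x = component U x"
proof
  have "e \<notin> U" using e cut_component_empty[of U x] unfolding edge_cut_def by blast
  moreover have "e \<in> H" using e by (simp add: edge_cut_def)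
  ultimately have "lt e f" if "f \<in> U" for f
    using U that lt_total unfolding up_closed_def by metis
  then have "U \<subseteq> edges_above lt H e" using U unfolding edges_above_def up_closed_def by blast
  then show "component U x \<subseteq> component (edges_above lt H e) x" by (rule component_mono)
  show "component (edges_above lt H e) x \<subseteq> component U x"
  proof (rule component_subset_if_cut_empty)
    have "f \<notin> edge_cut (edges_above lt H e) (component U x)" for f
    proof
      assume f: "f \<in> edge_cut (edges_above lt H e) (component U x)"
      then have "f \<in> edge_cut H (component U x)" "lt e f" unfolding edge_cut_def edges_above_def by auto
      with max have "f = e \<or> lt f e" by blast
      with \<open>lt e f\<close> show False using lt_irrefl lt_trans by metis
    qed
    then show "edge_cut (edges_above lt H e) (component U x) = {}" by blast
  qed simp
qed

text \<open>Once \<open>f\<close> has killed z, the merged cluster is infinite or contains an older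
  vertex. Every smaller edge sees a cluster of z that includes all of it, so z never again leads a
  finite cluster.\<close>

lemma kills_unique_edge:
  assumes "kills lt h H e z" "kills lt h H f z"
  shows "e = f"
proof (rule ccontr)
  have *: False if ke: "kills lt h H e z" and kf: "kills lt h H f z" and "lt e f" for e f
  proof -
    obtain u where u: "finite (component (edges_above lt H e) u)" "leader h (component (edges_above lt H e) u) z"
      using ke unfolding kills_def by blast
    obtain u' v' where f: "f \<in> H" "f = Upair u' v'" and z: "z \<in> component (edges_above lt H f) u'"
      and or: "infinite (component (edges_above lt H f) v') \<or> (\<exists>w\<in>component (edges_above lt H f) v'. h w < h z)"
      using kf unfolding kills_def leader_def by blast
    have sub: "edges_above lt H f \<subseteq> edges_above lt H e" by (rule above_mono) fact
    have zu: "component (edges_above lt H e) z = component (edges_above lt H e) u"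
      using u(2) by (intro component_eq) (simp add: leader_def)
    have "u' \<in> component (edges_above lt H f) z" using z component_sym by fast
    then have "u' \<in> component (edges_above lt H e) z" using component_mono[OF sub] by blast
    moreover have "Upair u' v' \<in> edges_above lt H e" using f \<open>lt e f\<close> by (simp add: edges_above_def)
    ultimately have "v' \<in> component (edges_above lt H e) z" by (rule component_step)
    then have "component (edges_above lt H f) v' \<subseteq> component (edges_above lt H e) u"
      using component_mono[OF sub, of v'] component_eq[of v' "edges_above lt H e" z] zu by simp
    with or u show False
      unfolding leader_def by (meson finite_subset not_le subsetD)
  qed
  assume "e \<noteq> f"
  with lt_total *[of e f] *[of f e] assms show False by blast
qed

text \<open>Of two finite clusters, the one whose leader has the larger \<open>h\<close> loses it;
  if one cluster is infinite, the finite one loses its leader. \<open>wired\<close> supplies a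
  finite side and disjoint clusters, so the two leaders cannot tie.\<close>

lemma kills_unique_vertex:
  assumes W: "wired lt H" and H: "Upair u v \<in> H"
  shows "\<exists>!z. kills lt h H (Upair u v) z" and "kills lt h H (Upair u v) z \<Longrightarrow> z \<in> component H u"
proof -
  define C where "C = component (edges_above lt H (Upair u v))"
  have K: "kills lt h H (Upair u v) z \<longleftrightarrow>
      finite (C u) \<and> leader h (C u) z \<and> (infinite (C v) \<or> (\<exists>w\<in>C v. h w < h z)) \<or>
      finite (C v) \<and> leader h (C v) z \<and> (infinite (C u) \<or> (\<exists>w\<in>C u. h w < h z))" for z
    unfolding kills_def C_def using H by auto
  have nv: "v \<notin> C u" and fin: "finite (C u) \<or> finite (C v)" using W H unfolding wired_def C_def by blast+
  have disj: "C u \<inter> C v = {}"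
    using nv component_eq component_sym unfolding C_def by (metis disjoint_iff component_refl)
  have ne: "C w \<noteq> {}" for w unfolding C_def by (metis component_refl empty_iff)
  show "\<exists>!z. kills lt h H (Upair u v) z"
  proof (cases "finite (C u) \<and> finite (C v)")
    case True
    obtain z z' where z: "leader h (C u) z" "leader h (C v) z'" using leader_exists True ne by metis
    have "z \<noteq> z'" using z disj unfolding leader_def by blast
    then have "h z < h z' \<or> h z' < h z" using inj_h by (metis injD linorder_neqE_linordered_idom)
    then show ?thesis
    proof
      assume lt: "h z < h z'"
      have "\<not> (\<exists>w\<in>C v. h w < h z)" using z lt unfolding leader_def by force
      moreover have "\<exists>w\<in>C u. h w < h z'" using z lt unfolding leader_def by blast
      ultimately have "kills lt h H (Upair u v) y \<longleftrightarrow> y = z'" for y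
        unfolding K using True z leader_unique[OF inj_h] by metis
      then show ?thesis by simp
    next
      assume lt: "h z' < h z"
      have "\<not> (\<exists>w\<in>C u. h w < h z')" using z lt unfolding leader_def by force
      moreover have "\<exists>w\<in>C v. h w < h z" using z lt unfolding leader_def by blast
      ultimately have "kills lt h H (Upair u v) y \<longleftrightarrow> y = z" for y
        unfolding K using True z leader_unique[OF inj_h] by metis
      then show ?thesis by simp
    qed
  next
    case False
    have one: "\<exists>!z. leader h (C w) z" if "finite (C w)" for w
      using leader_exists[OF that ne] leader_unique[OF inj_h, of "C w"] by blast
    from fin False consider "finite (C u)" "infinite (C v)" | "infinite (C u)" "finite (C v)" by blast
    then show ?thesis
      by cases (simp_all add: K one)
  qed
  assume "kills lt h H (Upair u v) z"
  then have "z \<in> C u \<or> z \<in> C v" unfolding K leader_def by blast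
  moreover have "C w \<subseteq> component H w" for w unfolding C_def by (rule component_mono) (auto simp: edges_above_def)
  moreover have "component H v = component H u"
    by (rule component_eq) (rule component_step[OF component_refl H])
  ultimately show "z \<in> component H u" by blast
qed

section \<open>Clusters of vertices that are never killed\<close>

context
  fixes H :: "'a uprod set"
  assumes fin: "\<And>x. finite {y. Upair x y \<in> H}"
begin

text \<open>Take the largest edge leaving the cluster. As it does not kill x, the cluster on its
  other side is finite and contains no older vertex, so the merged cluster is again finite and led
  by x.\<close>

lemma unkilled_grow:
  assumes x: "\<nexists>e. kills lt h H e x" and U: "up_closed lt H U" and S: "finite (component U x)"
    and l: "leader h (component U x) x" and ne: "component U x \<noteq> component H x"
  shows "\<exists>u v. u \<in> component H x \<and> Upair u v \<in> H \<and> component (edges_above lt H (Upair u v)) x = component U x \<and>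
    (\<exists>U'. up_closed lt H U' \<and> finite (component U' x) \<and> leader h (component U' x) x \<and>
      card (component U x) < card (component U' x))"
proof -
  define S where "S = component U x"
  have SH: "S \<subseteq> component H x" unfolding S_def using U by (intro component_mono) (simp add: up_closed_def)
  have "edge_cut H S \<noteq> {}"
    using component_subset_if_cut_empty[of x S H] SH ne unfolding S_def by auto
  then obtain e where e: "e \<in> edge_cut H S" "\<forall>f\<in>edge_cut H S. f = e \<or> lt f e"
    using max_exists[OF finite_cut[OF fin]] S unfolding S_def by blast
  from e(1) obtain u v where uv: "e = Upair u v" "u \<in> S" "v \<notin> S" and eH: "e \<in> H" unfolding edge_cut_def by blast
  have eq: "component (edges_above lt H e) x = S"
    using cluster_eq_component_above[OF U] e unfolding S_def by blast
  have eq_u: "component (edges_above lt H e) u = S" using component_eq[of u "edges_above lt H e" x] uv eq by simp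
  have "\<not> kills lt h H e x" using x by blast
  then have "\<not> (infinite (component (edges_above lt H e) v) \<or> (\<exists>w\<in>component (edges_above lt H e) v. h w < h x))"
    using eH uv(1) eq_u S l unfolding kills_def S_def by metis
  then have fv: "finite (component (edges_above lt H e) v)" and lv: "\<forall>w\<in>component (edges_above lt H e) v. h x \<le> h w"
    by (auto simp: not_less)
  define U' where "U' = insert e (edges_above lt H e)"
  have sub: "component U' x \<subseteq> S \<union> component (edges_above lt H e) v"
  proof (rule component_subsetI)
    show "x \<in> S \<union> component (edges_above lt H e) v" by (simp add: S_def)
    fix a b assume a: "a \<in> S \<union> component (edges_above lt H e) v" and ab: "Upair a b \<in> U'"
    show "b \<in> S \<union> component (edges_above lt H e) v"
    proof (cases "Upair a b = e")
      case True then show ?thesis using uv by auto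
    next
      case False
      then have "Upair a b \<in> edges_above lt H e" using ab by (simp add: U'_def)
      then show ?thesis using a component_step[of a "edges_above lt H e" _ b] unfolding eq[symmetric] by blast
    qed
  qed
  have "finite (component U' x)" using sub S fv unfolding S_def by (meson finite_Un finite_subset)
  moreover have "leader h (component U' x) x"
    using sub l lv unfolding leader_def S_def by auto
  moreover have "card (component U x) < card (component U' x)"
  proof (rule psubset_card_mono)
    have "component (edges_above lt H e) x \<subseteq> component U' x" unfolding U'_def by (rule component_mono) blast
    moreover from this have "v \<in> component U' x"
      using uv eq component_step[of u U' x v] by (auto simp: U'_def)
    ultimately show "component U x \<subset> component U' x" using eq uv unfolding S_def by blast
  qed fact
  moreover have "up_closed lt H U'" unfolding U'_def by (rule up_closed_insert_above[OF eH])
  moreover have "u \<in> component H x" using uv SH by blast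
  ultimately show ?thesis using eH uv(1) eq unfolding S_def by blast
qed

text \<open>\<open>unkilled_grow\<close> is iterated from the one-vertex cluster of the empty edge
  set. The second alternative covers finite components, where growth stops.\<close>

lemma unkilled_clusters:
  assumes x: "\<nexists>e. kills lt h H e x"
  shows "\<exists>U. up_closed lt H U \<and> finite (component U x) \<and> leader h (component U x) x \<and>
    (n \<le> card (component U x) \<or> component U x = component H x)"
proof (induction n)
  case 0
  have "component {} x = {x}" by (auto simp: component_def adj_def)
  then show ?case by (intro exI[of _ "{}"]) (auto simp: up_closed_def leader_def)
next
  case (Suc n)
  then obtain U where U: "up_closed lt H U" "finite (component U x)" "leader h (component U x) x"
    "n \<le> card (component U x) \<or> component U x = component H x" by blast
  show ?case
  proof (cases "component U x = component H x")
    case False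
    from unkilled_grow[OF x U(1-3) False] U(4) False show ?thesis by (meson Suc_leI le_less_trans)
  qed (use U in blast)
qed

text \<open>Up-closed sets form a chain, so a cluster of x that is strictly larger than
  \<open>component U x\<close> contains it, and so does a cluster that exhausts the component. A
  leader of a set also leads every subset to which it belongs.\<close>

lemma unkilled_leader:
  assumes x: "\<nexists>e. kills lt h H e x" and U: "up_closed lt H U" and S: "finite (component U x)"
  shows "leader h (component U x) x"
proof -
  obtain U' where U': "up_closed lt H U'" "finite (component U' x)" "leader h (component U' x) x"
    "Suc (card (component U x)) \<le> card (component U' x) \<or> component U' x = component H x"
    using unkilled_clusters[OF x] by blast
  have "component U x \<subseteq> component U' x"
    using up_closed_chain[OF U U'(1)]
  proof
    assume "U' \<subseteq> U"
    then have "card (component U' x) \<le> card (component U x)" by (intro card_mono S component_mono)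
    with U'(4) have "component U' x = component H x" by simp
    then show ?thesis using U unfolding up_closed_def by (metis component_mono)
  qed (rule component_mono)
  with U'(3) show ?thesis unfolding leader_def by auto
qed

text \<open>If the leader were killed, the opposite cluster at the killing edge would lie in the
  same finite component and hold a vertex with smaller \<open>h\<close>.\<close>

lemma unkilled_iff_leader:
  assumes S: "finite (component H x)"
  shows "(\<nexists>e. kills lt h H e x) \<longleftrightarrow> leader h (component H x) x"
proof
  assume "\<nexists>e. kills lt h H e x"
  then show "leader h (component H x) x" using S by (intro unkilled_leader) (auto simp: up_closed_def)
next
  assume l: "leader h (component H x) x"
  show "\<nexists>e. kills lt h H e x"
  proof
    assume "\<exists>e. kills lt h H e x"
    then obtain e u v where e: "e \<in> H" "e = Upair u v" and xu: "x \<in> component (edges_above lt H e) u"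
      and or: "infinite (component (edges_above lt H e) v) \<or> (\<exists>w\<in>component (edges_above lt H e) v. h w < h x)"
      unfolding kills_def leader_def by blast
    have sub: "component (edges_above lt H e) y \<subseteq> component H y" for y
      by (rule component_mono) (auto simp: edges_above_def)
    have "u \<in> component H x" using xu sub component_sym by (metis subsetD)
    then have "v \<in> component H x" using e by (auto intro: component_step)
    then have "component (edges_above lt H e) v \<subseteq> component H x" using sub component_eq by metis
    with or S l show False unfolding leader_def by (meson finite_subset not_le subsetD)
  qed
qed

text \<open>In an infinite component the clusters led by an unkilled vertex grow without bound. They
  are indexed by edges instead of arbitrary up-closed sets because the edges of a component can be
  enumerated measurably.\<close>

lemma unkilled_infinite_clusters:
  assumes x: "\<nexists>e. kills lt h H e x" and inf: "infinite (component H x)"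
  shows "infinite {y. \<exists>u\<in>component H x. \<exists>v. Upair u v \<in> H \<and>
     finite (component (edges_above lt H (Upair u v)) x) \<and> y \<in> component (edges_above lt H (Upair u v)) x}"
    (is "infinite ?Y")
proof
  assume Y: "finite ?Y"
  obtain U where U: "up_closed lt H U" "finite (component U x)" "leader h (component U x) x"
    and c: "Suc (card ?Y) \<le> card (component U x) \<or> component U x = component H x"
    using unkilled_clusters[OF x] by blast
  have ne: "component U x \<noteq> component H x" using U(2) inf by metis
  obtain u v where "u \<in> component H x" "Upair u v \<in> H" "component (edges_above lt H (Upair u v)) x = component U x"
    using unkilled_grow[OF x U ne] by blast
  then have "component U x \<subseteq> ?Y" using U(2) by (intro subsetI CollectI bexI[of _ u] exI[of _ v]) auto
  then have "card (component U x) \<le> card ?Y" by (rule card_mono[OF Y])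
  with c ne show False by simp
qed

text \<open>The edge sets above \<open>e\<close> and \<open>e'\<close> are comparable. In the larger
  one both vertices lie in the same finite cluster and both lead it. This bounds by 1 the mass that
  a vertex receives in \<open>unkilled_infinite_null\<close>.\<close>

lemma unkilled_same_cluster:
  assumes x: "\<nexists>e. kills lt h H e x" and x': "\<nexists>e. kills lt h H e x'"
    and y: "y \<in> component (edges_above lt H e) x" "finite (component (edges_above lt H e) x)"
    and y': "y \<in> component (edges_above lt H e') x'" "finite (component (edges_above lt H e') x')"
  shows "x = x'"
proof -
  have *: "x = x'" if x: "\<nexists>e. kills lt h H e x" and x': "\<nexists>e. kills lt h H e x'"
    and y: "y \<in> component (edges_above lt H e) x" "finite (component (edges_above lt H e) x)"
    and y': "y \<in> component (edges_above lt H e') x'" and sub: "edges_above lt H e' \<subseteq> edges_above lt H e" for x x' e e'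
  proof -
    have "x' \<in> component (edges_above lt H e') y" using y' component_sym by fast
    then have "x' \<in> component (edges_above lt H e) y" using component_mono[OF sub] by blast
    then have "component (edges_above lt H e) x' = component (edges_above lt H e) y" by (rule component_eq)
    also have "\<dots> = component (edges_above lt H e) x" by (rule component_eq[OF y(1)])
    finally have eq: "component (edges_above lt H e) x' = component (edges_above lt H e) x" .
    have "leader h (component (edges_above lt H e) x) x" using x y(2) by (intro unkilled_leader up_closed_above)
    moreover have "leader h (component (edges_above lt H e) x') x'"
      using x' y(2) eq by (intro unkilled_leader up_closed_above) simp_all
    ultimately show ?thesis unfolding eq by (rule leader_unique[OF inj_h])
  qed
  show ?thesis
    using above_chain[of H e' e] *[OF x x' y y'(1)] *[OF x' x y' y(1)] by blast
qed

end

text \<open>Clusters shrink when passing from \<open>E\<close> to \<open>H\<close>, so the finite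
  side stays finite and its other endpoint stays outside.\<close>

lemma wired_subset_wired_forest:
  assumes "H \<subseteq> wired_forest lt E" shows "wired lt H"
  unfolding wired_def
proof (intro allI impI)
  fix u v assume uv: "Upair u v \<in> H"
  define e where "e = Upair u v"
  have "e \<in> wired_forest lt E" using uv assms unfolding e_def by (rule subsetD[rotated])
  then obtain a b where ab: "e = Upair a b" "finite (component (edges_above lt E e) a)" "b \<notin> component (edges_above lt E e) a"
    unfolding wired_forest_def by blast
  have "H \<subseteq> E" using assms unfolding wired_forest_def by blast
  then have sub: "component (edges_above lt H e) y \<subseteq> component (edges_above lt E e) y" for y
    by (intro component_mono) (auto simp: edges_above_def)
  have "b \<notin> component (edges_above lt H e) a" "finite (component (edges_above lt H e) a)"
    using ab sub[of a] finite_subset by blast+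
  moreover have "a = u \<and> b = v \<or> a = v \<and> b = u" using ab(1) e_def by auto
  ultimately show "v \<notin> component (edges_above lt H (Upair u v)) u \<and>
     (finite (component (edges_above lt H (Upair u v)) u) \<or> finite (component (edges_above lt H (Upair u v)) v))"
    unfolding e_def[symmetric] using component_sym by metis
qed

text \<open>The largest edge of \<open>U\<close> leaving a finite forest component would be the
  largest edge of \<open>E\<close> leaving it, because \<open>U\<close> is up-closed, and would thus
  belong to the forest. An infinite forest component may be a proper part of a component of
  \<open>U\<close>, but then both contribute 1/card = 0 to the rank.\<close>

lemma component_wired_forest_Int:
  assumes fin: "\<And>x. finite {y. Upair x y \<in> E}" and U: "up_closed lt E U"
    and S: "finite (component (wired_forest lt E \<inter> U) x)"
  shows "component (wired_forest lt E \<inter> U) x = component U x"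
proof (rule antisym)
  show "component (wired_forest lt E \<inter> U) x \<subseteq> component U x" by (rule component_mono) blast
  define S where "S = component (wired_forest lt E \<inter> U) x"
  have UE: "U \<subseteq> E" using U by (simp add: up_closed_def)
  have finU: "finite {y. Upair a y \<in> U}" for a using UE by (intro finite_subset[OF _ fin[of a]]) blast
  have "edge_cut U S = {}"
  proof (rule ccontr)
    assume "edge_cut U S \<noteq> {}"
    then obtain e where e: "e \<in> edge_cut U S" "\<forall>f\<in>edge_cut U S. f = e \<or> lt f e"
      using max_exists[OF finite_cut[OF finU]] S unfolding S_def by blast
    from e(1) obtain u v where uv: "e = Upair u v" "u \<in> S" "v \<notin> S" and eU: "e \<in> U" unfolding edge_cut_def by blast
    have "component (edges_above lt E e) u \<subseteq> S"
    proof (rule component_subset_if_cut_empty[OF uv(2)])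
      have "f \<notin> edge_cut (edges_above lt E e) S" for f
      proof
        assume f: "f \<in> edge_cut (edges_above lt E e) S"
        then have "f \<in> E" "lt e f" unfolding edge_cut_def edges_above_def by auto
        with U eU have "f \<in> U" unfolding up_closed_def by blast
        with f have "f \<in> edge_cut U S" unfolding edge_cut_def by blast
        with e(2) have "f = e \<or> lt f e" by blast
        with \<open>lt e f\<close> show False using lt_irrefl lt_trans by metis
      qed
      then show "edge_cut (edges_above lt E e) S = {}" by blast
    qed
    then have "finite (component (edges_above lt E e) u)" "v \<notin> component (edges_above lt E e) u"
      using S uv(3) finite_subset unfolding S_def by blast+
    then have "e \<in> wired_forest lt E \<inter> U" using uv(1) eU UE unfolding wired_forest_def by blast
    then have "v \<in> S" using uv component_step unfolding S_def by metis
    with uv show False by blast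
  qed
  then show "component U x \<subseteq> component (wired_forest lt E \<inter> U) x"
    unfolding S_def by (intro component_subset_if_cut_empty) simp_all
qed

end

section \<open>Measurability in a graphing\<close>

locale graphing_space =
  fixes M :: "'a::polish_space measure" and E :: "'a uprod set"
  assumes graphing: "graphing M E"
begin

sublocale prob_space M using graphing by (simp add: graphing_def)

lemma sets_M [measurable_cong]: "sets M = sets borel" using graphing by (simp add: graphing_def)

lemma space_M [simp]: "space M = UNIV" using sets_eq_imp_space_eq[OF sets_M] by simp

lemma no_loops: "Upair x x \<notin> E" using graphing by (simp add: graphing_def)

lemma finite_nbrs: "finite {y. Upair x y \<in> E}" using graphing unfolding graphing_def by blast

lemma mp_relation_component: "mp_relation M {(x, y). y \<in> component E x}"
  unfolding component_def mem_Collect_eq case_prod_eta[of "\<lambda>p. p \<in> (adj E)\<^sup>*", simplified] Collect_mem_eq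
  by (intro mp_relation_rtrancl graphing_mp_relation_adj graphing) simp

text \<open>Lists a component, with repetitions, so that quantifiers and sums over it become
  countable ones with measurable terms.\<close>

definition visit :: "nat \<Rightarrow> 'a \<Rightarrow> 'a" where
  "visit = (SOME \<phi>. (\<forall>k. \<phi> k \<in> M \<rightarrow>\<^sub>M M) \<and> (\<forall>x. component E x = range (\<lambda>k. \<phi> k x)))"

lemma visit: "visit k \<in> M \<rightarrow>\<^sub>M M" "component E x = range (\<lambda>k. visit k x)"
proof -
  have "\<exists>\<phi> :: nat \<Rightarrow> 'a \<Rightarrow> 'a. (\<forall>k. \<phi> k \<in> M \<rightarrow>\<^sub>M M) \<and> (\<forall>x. component E x = range (\<lambda>k. \<phi> k x))"
    using mp_relation_enumeration[OF mp_relation_component] by simp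
  from someI_ex[OF this] show "visit k \<in> M \<rightarrow>\<^sub>M M" "component E x = range (\<lambda>k. visit k x)"
    unfolding visit_def[symmetric] by blast+
qed

lemma measurable_visit [measurable (raw)]:
  "c \<in> N \<rightarrow>\<^sub>M M \<Longrightarrow> (\<lambda>p. visit k (c p)) \<in> N \<rightarrow>\<^sub>M M"
  by (rule measurable_compose[OF _ visit(1)])

lemma Ex_component: "(\<exists>y\<in>component E x. P y) \<longleftrightarrow> (\<exists>k. P (visit k x))"
  by (simp add: visit(2))

lemma countable_component: "countable (component E x)" by (simp add: visit(2))

lemma mass_transport_component:
  assumes "(\<lambda>(x, y). m x y) \<in> borel_measurable (M \<Otimes>\<^sub>M M)"
  shows "(\<integral>\<^sup>+x. \<integral>\<^sup>+y. m x y \<partial>count_space (component E x) \<partial>M) =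
    (\<integral>\<^sup>+y. \<integral>\<^sup>+x. m x y \<partial>count_space (component E y) \<partial>M)"
proof -
  have "{x. y \<in> component E x} = component E y" for y using component_sym by fast
  with mass_transport[OF mp_relation_component sets_M assms] show ?thesis by simp
qed

lemma measurable_eq_M [measurable (raw)]:
  assumes "f \<in> N \<rightarrow>\<^sub>M M" "g \<in> N \<rightarrow>\<^sub>M M"
  shows "Measurable.pred N (\<lambda>p. f p = g p)"
proof -
  have [measurable]: "f \<in> borel_measurable N" "g \<in> borel_measurable N"
    using assms unfolding measurable_cong_sets[OF refl sets_M] .
  show ?thesis by measurable
qed

lemma measurable_count_component:
  fixes m :: "'b \<Rightarrow> 'a \<Rightarrow> ennreal"
  assumes m: "(\<lambda>(p, y). m p y) \<in> borel_measurable (N \<Otimes>\<^sub>M M)" and c [measurable]: "c \<in> N \<rightarrow>\<^sub>M M"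
  shows "(\<lambda>p. \<integral>\<^sup>+y. m p y \<partial>count_space (component E (c p))) \<in> borel_measurable N"
proof -
  \<comment> \<open>Only the first visit to a vertex counts, since \<open>visit\<close> repeats
    vertices.\<close>
  define G where "G k x = {y. y = visit k x \<and> (\<forall>l<k. visit l x \<noteq> visit k x)}" for k x
  have ind: "(\<Sum>k. indicator (G k x) y) = (indicator (component E x) y :: ennreal)" for x y
  proof -
    have "disjoint_family (\<lambda>k. G k x)"
      unfolding disjoint_family_on_def G_def by (auto, metis linorder_neqE_nat)
    moreover have "(\<Union>k. G k x) = component E x"
    proof (rule set_eqI)
      fix y
      have "y \<in> component E x \<longleftrightarrow> (\<exists>k. y = visit k x)" by (auto simp: visit(2))
      also have "\<dots> \<longleftrightarrow> (\<exists>k. y = visit k x \<and> (\<forall>l<k. \<not> y = visit l x))"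
        by (rule exists_least_iff)
      also have "\<dots> \<longleftrightarrow> (\<exists>k. y \<in> G k x)" unfolding G_def mem_Collect_eq by (intro ex_cong1) metis
      finally show "y \<in> (\<Union>k. G k x) \<longleftrightarrow> y \<in> component E x" by auto
    qed
    ultimately show ?thesis using suminf_indicator[of "\<lambda>k. G k x" y] by simp
  qed
  have eq: "(\<integral>\<^sup>+y. m p y \<partial>count_space (component E (c p))) =
      (\<Sum>k. if \<forall>l<k. visit l (c p) \<noteq> visit k (c p) then m p (visit k (c p)) else 0)" for p
  proof -
    have "(\<integral>\<^sup>+y. m p y \<partial>count_space (component E (c p))) =
        (\<integral>\<^sup>+y. m p y * indicator (component E (c p)) y \<partial>count_space UNIV)"
      by (subst nn_integral_count_space_indicator) auto
    also have "\<dots> = (\<integral>\<^sup>+y. (\<Sum>k. m p y * indicator (G k (c p)) y) \<partial>count_space UNIV)"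
      by (simp add: ind)
    also have "\<dots> = (\<Sum>k. \<integral>\<^sup>+y. m p y * indicator (G k (c p)) y \<partial>count_space UNIV)"
      by (rule nn_integral_suminf) simp
    also have "\<dots> = (\<Sum>k. m p (visit k (c p)) * indicator (G k (c p)) (visit k (c p)))"
      by (intro suminf_cong nn_integral_count_space_single) (auto simp: G_def indicator_def)
    also have "\<dots> = (\<Sum>k. if \<forall>l<k. visit l (c p) \<noteq> visit k (c p) then m p (visit k (c p)) else 0)"
      by (intro suminf_cong) (auto simp: G_def indicator_def)
    finally show ?thesis .
  qed
  have "(\<lambda>p. m p (visit k (c p))) \<in> borel_measurable N" for k
    using measurable_compose[OF measurable_Pair[OF measurable_ident measurable_visit[OF c]] m] by simp
  note [measurable] = this
  show ?thesis unfolding eq by measurable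
qed

lemma count_component_indicator:
  assumes "S \<subseteq> component E x"
  shows "(\<integral>\<^sup>+y. indicator S y \<partial>count_space (component E x)) = emeasure (count_space UNIV) S"
  using assms by (simp add: emeasure_count_space)

text \<open>An infinite \<open>S p\<close> has cardinality 0, and \<open>enn2real \<infinity> = 0\<close>, so the second claim needs no finiteness.\<close>

lemma measurable_card:
  assumes [measurable]: "Measurable.pred (N \<Otimes>\<^sub>M M) (\<lambda>(p, y). y \<in> S p)" and [measurable]: "c \<in> N \<rightarrow>\<^sub>M M"
    and sub: "\<And>p. S p \<subseteq> component E (c p)"
  shows "Measurable.pred N (\<lambda>p. finite (S p))" and "(\<lambda>p. real (card (S p))) \<in> borel_measurable N"
proof -
  define f :: "_ \<Rightarrow> ennreal" where "f p = (\<integral>\<^sup>+y. indicator (S p) y \<partial>count_space (component E (c p)))" for p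
  have "(\<lambda>(p, y). indicator (S p) y :: ennreal) = (\<lambda>q. if (\<lambda>(p, y). y \<in> S p) q then 1 else 0)"
    by (auto simp: fun_eq_iff indicator_def)
  also have "\<dots> \<in> borel_measurable (N \<Otimes>\<^sub>M M)" by measurable
  finally have f [measurable]: "f \<in> borel_measurable N"
    unfolding f_def by (intro measurable_count_component) measurable
  have f_eq: "f p = (if finite (S p) then of_nat (card (S p)) else \<infinity>)" for p
    unfolding f_def count_component_indicator[OF sub] by (simp add: emeasure_count_space)
  have "finite (S p) \<longleftrightarrow> f p < \<infinity>" for p by (simp add: f_eq of_nat_less_top)
  then show "Measurable.pred N (\<lambda>p. finite (S p))" by simp
  have "real (card (S p)) = enn2real (f p)" for p by (simp add: f_eq)
  then show "(\<lambda>p. real (card (S p))) \<in> borel_measurable N" by simp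
qed

text \<open>The parameter p lets the edge set vary with a point, as \<open>edges_above\<close>
  varies with its edge. Reachability in n steps is measurable by induction, because the last
  intermediate vertex is some \<open>visit k x\<close>.\<close>

lemma measurable_component:
  fixes F :: "'b \<Rightarrow> 'a uprod set"
  assumes F [measurable]: "Measurable.pred (N \<Otimes>\<^sub>M (M \<Otimes>\<^sub>M M)) (\<lambda>(p, x, y). Upair x y \<in> F p)"
    and sub: "\<And>p. F p \<subseteq> E"
  shows "Measurable.pred (N \<Otimes>\<^sub>M (M \<Otimes>\<^sub>M M)) (\<lambda>(p, x, y). y \<in> component (F p) x)"
proof -
  have step: "Measurable.pred (N \<Otimes>\<^sub>M (M \<Otimes>\<^sub>M M)) (\<lambda>(p, x, y). (x, y) \<in> adj (F p) ^^ n)" for n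
  proof (induction n)
    case 0
    show ?case by (simp add: split_beta') measurable
  next
    case (Suc n)
    have rew: "(x, y) \<in> adj (F p) ^^ Suc n \<longleftrightarrow> (\<exists>k. (x, visit k x) \<in> adj (F p) ^^ n \<and> Upair (visit k x) y \<in> F p)" for p x y
    proof -
      have "(x, z) \<in> adj (F p) ^^ n \<Longrightarrow> z \<in> component E x" for z
        using relpow_imp_rtrancl[of "(x, z)" n "adj (F p)"] component_mono[OF sub, of p x]
        by (auto simp: component_def)
      then have "(x, y) \<in> adj (F p) ^^ Suc n \<longleftrightarrow> (\<exists>z\<in>component E x. (x, z) \<in> adj (F p) ^^ n \<and> Upair z y \<in> F p)"
        by (auto simp: adj_def relcomp_unfold)
      then show ?thesis unfolding Ex_component .
    qed
    define s where "s k q = (fst q, fst (snd q), visit k (fst (snd q)))" for k and q :: "'b \<times> 'a \<times> 'a"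
    define t where "t k q = (fst q, visit k (fst (snd q)), snd (snd q))" for k and q :: "'b \<times> 'a \<times> 'a"
    have s: "s k \<in> N \<Otimes>\<^sub>M (M \<Otimes>\<^sub>M M) \<rightarrow>\<^sub>M N \<Otimes>\<^sub>M (M \<Otimes>\<^sub>M M)" for k unfolding s_def by measurable
    have t: "t k \<in> N \<Otimes>\<^sub>M (M \<Otimes>\<^sub>M M) \<rightarrow>\<^sub>M N \<Otimes>\<^sub>M (M \<Otimes>\<^sub>M M)" for k unfolding t_def by measurable
    note [measurable] = measurable_compose[OF s Suc.IH] measurable_compose[OF t F]
    have "Measurable.pred (N \<Otimes>\<^sub>M (M \<Otimes>\<^sub>M M)) (\<lambda>q. \<exists>k. (\<lambda>(p, x, y). (x, y) \<in> adj (F p) ^^ n) (s k q) \<and> (\<lambda>(p, x, y). Upair x y \<in> F p) (t k q))"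
      by measurable
    also have "(\<lambda>q. \<exists>k. (\<lambda>(p, x, y). (x, y) \<in> adj (F p) ^^ n) (s k q) \<and> (\<lambda>(p, x, y). Upair x y \<in> F p) (t k q)) =
        (\<lambda>(p, x, y). (x, y) \<in> adj (F p) ^^ Suc n)"
      by (auto simp: fun_eq_iff rew s_def t_def simp del: relpow.simps)
    finally show ?case .
  qed
  have "(\<lambda>(p, x, y). y \<in> component (F p) x) = (\<lambda>q. \<exists>n. (\<lambda>(p, x, y). (x, y) \<in> adj (F p) ^^ n) q)"
    by (auto simp: fun_eq_iff component_def rtrancl_power)
  also have "Measurable.pred (N \<Otimes>\<^sub>M (M \<Otimes>\<^sub>M M)) \<dots>" using step by measurable
  finally show ?thesis .
qed

lemma edge_setsD:
  assumes "A \<in> edge_sets M E"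
  shows "A \<subseteq> E" and "Measurable.pred (M \<Otimes>\<^sub>M M) (\<lambda>(x, y). Upair x y \<in> A)"
  using assms unfolding edge_sets_def by (auto simp: pred_def space_pair_measure split_beta')

lemma edge_setsI:
  assumes "A \<subseteq> E" "Measurable.pred (M \<Otimes>\<^sub>M M) (\<lambda>(x, y). Upair x y \<in> A)"
  shows "A \<in> edge_sets M E"
  using assms unfolding edge_sets_def by (auto simp: pred_def space_pair_measure split_beta')

lemma measurable_edge_set:
  assumes "A \<in> edge_sets M E" "f \<in> N \<rightarrow>\<^sub>M M" "g \<in> N \<rightarrow>\<^sub>M M"
  shows "Measurable.pred N (\<lambda>p. Upair (f p) (g p) \<in> A)"
  using measurable_compose[OF measurable_Pair[OF assms(2,3)] edge_setsD(2)[OF assms(1)]] by simp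

lemma measurable_in_component:
  assumes A: "A \<in> edge_sets M E" and fg: "f \<in> N \<rightarrow>\<^sub>M M" "g \<in> N \<rightarrow>\<^sub>M M"
  shows "Measurable.pred N (\<lambda>p. g p \<in> component A (f p))"
proof -
  have "Measurable.pred (N \<Otimes>\<^sub>M (M \<Otimes>\<^sub>M M)) (\<lambda>q. Upair (fst (snd q)) (snd (snd q)) \<in> A)"
    by (rule measurable_edge_set[OF A]) measurable
  then have "Measurable.pred (N \<Otimes>\<^sub>M (M \<Otimes>\<^sub>M M)) (\<lambda>(p, x, y). y \<in> component A x)"
    by (intro measurable_component edge_setsD(1)[OF A]) (simp add: split_beta')
  from measurable_compose[OF measurable_Pair[OF measurable_ident measurable_Pair[OF fg]] this]
  show ?thesis by simp
qed

lemma measurable_card_component: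
  assumes A: "A \<in> edge_sets M E" and f: "f \<in> N \<rightarrow>\<^sub>M M"
  shows "Measurable.pred N (\<lambda>p. finite (component A (f p)))"
    and "(\<lambda>p. real (card (component A (f p)))) \<in> borel_measurable N"
proof -
  note [measurable] = f
  have "Measurable.pred (N \<Otimes>\<^sub>M M) (\<lambda>q. snd q \<in> component A (f (fst q)))"
    by (rule measurable_in_component[OF A]) measurable
  then have 1: "Measurable.pred (N \<Otimes>\<^sub>M M) (\<lambda>(p, y). y \<in> component A (f p))" by (simp add: split_beta')
  have 2: "component A (f p) \<subseteq> component E (f p)" for p by (rule component_mono[OF edge_setsD(1)[OF A]])
  show "Measurable.pred N (\<lambda>p. finite (component A (f p)))"
    "(\<lambda>p. real (card (component A (f p)))) \<in> borel_measurable N"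
    using measurable_card[OF 1 f 2] by auto
qed

end

context graphing_space
begin

lemma edge_sets_E: "E \<in> edge_sets M E"
  using graphing unfolding graphing_def edge_sets_def adj_def by blast

lemma nbrs_subset_component: "A \<subseteq> E \<Longrightarrow> {y. Upair x y \<in> A} \<subseteq> component E x"
  using component_step[OF component_refl, of x _ E] by auto

lemma finite_nbrs_subset: "A \<subseteq> E \<Longrightarrow> finite {y. Upair x y \<in> A}"
  by (rule finite_subset[OF _ finite_nbrs[of x]]) auto

text \<open>As a sum over the component, a degree can serve as the mass sent in
  \<open>mass_transport_component\<close>.\<close>

lemma deg_eq_count:
  assumes "A \<subseteq> E"
  shows "(of_nat (deg A x) :: ennreal) = (\<integral>\<^sup>+y. indicator A (Upair x y) \<partial>count_space (component E x))"
proof -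
  have "(\<integral>\<^sup>+y. indicator A (Upair x y) \<partial>count_space (component E x)) =
      (\<integral>\<^sup>+y. indicator {y. Upair x y \<in> A} y \<partial>count_space (component E x))"
    by (intro nn_integral_cong) (simp add: indicator_def)
  also have "\<dots> = emeasure (count_space UNIV) {y. Upair x y \<in> A}"
    by (rule count_component_indicator[OF nbrs_subset_component[OF assms]])
  also have "\<dots> = of_nat (deg A x)"
    using finite_nbrs_subset[OF assms] by (simp add: deg_def deg_in_def emeasure_count_space)
  finally show ?thesis ..
qed

lemma measurable_indicator_edge:
  assumes "A \<in> edge_sets M E" "f \<in> N \<rightarrow>\<^sub>M M" "g \<in> N \<rightarrow>\<^sub>M M"
  shows "(\<lambda>p. indicator A (Upair (f p) (g p)) :: ennreal) \<in> borel_measurable N"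
proof -
  note [measurable] = measurable_edge_set[OF assms]
  have "(\<lambda>p. if Upair (f p) (g p) \<in> A then 1 else 0 :: ennreal) \<in> borel_measurable N" by measurable
  then show ?thesis by (simp add: indicator_def)
qed

lemma measurable_deg:
  assumes "A \<in> edge_sets M E" shows "(\<lambda>x. of_nat (deg A x) :: ennreal) \<in> borel_measurable M"
proof -
  have "(\<lambda>q. indicator A (Upair (fst q) (snd q)) :: ennreal) \<in> borel_measurable (M \<Otimes>\<^sub>M M)"
    by (rule measurable_indicator_edge[OF assms]) measurable
  then have "(\<lambda>(x, y). indicator A (Upair x y) :: ennreal) \<in> borel_measurable (M \<Otimes>\<^sub>M M)"
    by (simp add: split_beta')
  then show ?thesis unfolding deg_eq_count[OF edge_setsD(1)[OF assms]]
    by (rule measurable_count_component) simp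
qed

end

text \<open>The guards \<open>Upair a b \<in> E\<close> are needed because the order comes from a function that is
  measurable only on \<open>E\<close>.\<close>

locale ordered_graphing = graphing_space M E + edge_order lt h
  for M :: "'a::polish_space measure" and E :: "'a uprod set" and lt :: "'a uprod \<Rightarrow> 'a uprod \<Rightarrow> bool" and h :: "'a \<Rightarrow> real" +
  assumes measurable_h [measurable]: "h \<in> borel_measurable M"
    and measurable_lt: "Measurable.pred ((M \<Otimes>\<^sub>M M) \<Otimes>\<^sub>M (M \<Otimes>\<^sub>M M)) (\<lambda>((a, b), x, y). Upair a b \<in> E \<and> Upair x y \<in> E \<and> lt (Upair a b) (Upair x y))"
begin

lemma measurable_in_component_above:
  assumes H: "H \<in> edge_sets M E"
    and fg: "a \<in> N \<rightarrow>\<^sub>M M" "b \<in> N \<rightarrow>\<^sub>M M" "f \<in> N \<rightarrow>\<^sub>M M" "g \<in> N \<rightarrow>\<^sub>M M"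
  shows "Measurable.pred N (\<lambda>p. Upair (a p) (b p) \<in> E \<and> g p \<in> component (edges_above lt H (Upair (a p) (b p))) (f p))"
proof -
  \<comment> \<open>Empty off \<open>E\<close>, where nothing is known about the measurability of
    the order; this makes \<open>F\<close> a measurable family of subsets of
    \<open>E\<close>.\<close>
  define F where "F p = (if Upair (fst p) (snd p) \<in> E then edges_above lt H (Upair (fst p) (snd p)) else {})" for p

  have HE: "H \<subseteq> E" by (rule edge_setsD(1)[OF H])
  have [measurable]: "Measurable.pred ((M \<Otimes>\<^sub>M M) \<Otimes>\<^sub>M (M \<Otimes>\<^sub>M M)) (\<lambda>q. Upair (fst (snd q)) (snd (snd q)) \<in> H)"
    by (rule measurable_edge_set[OF H]) measurable
  note [measurable] = measurable_lt
  have "Measurable.pred ((M \<Otimes>\<^sub>M M) \<Otimes>\<^sub>M (M \<Otimes>\<^sub>M M))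
      (\<lambda>q. Upair (fst (snd q)) (snd (snd q)) \<in> H \<and> (\<lambda>((a, b), x, y). Upair a b \<in> E \<and> Upair x y \<in> E \<and> lt (Upair a b) (Upair x y)) q)"
    by measurable
  also have "(\<lambda>q. Upair (fst (snd q)) (snd (snd q)) \<in> H \<and> (\<lambda>((a, b), x, y). Upair a b \<in> E \<and> Upair x y \<in> E \<and> lt (Upair a b) (Upair x y)) q) =
      (\<lambda>(p, x, y). Upair x y \<in> F p)"
    using HE by (auto simp: F_def edges_above_def fun_eq_iff)
  finally have F: "Measurable.pred ((M \<Otimes>\<^sub>M M) \<Otimes>\<^sub>M (M \<Otimes>\<^sub>M M)) (\<lambda>(p, x, y). Upair x y \<in> F p)" .
  have "F p \<subseteq> E" for p using HE by (auto simp: F_def edges_above_def)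
  from measurable_component[OF F this]
  have "Measurable.pred ((M \<Otimes>\<^sub>M M) \<Otimes>\<^sub>M (M \<Otimes>\<^sub>M M)) (\<lambda>(p, x, y). y \<in> component (F p) x)" .
  from measurable_compose[OF measurable_Pair[OF measurable_Pair[OF fg(1,2)] measurable_Pair[OF fg(3,4)]] this]
  have [measurable]: "Measurable.pred N (\<lambda>p. g p \<in> component (F (a p, b p)) (f p))" by simp
  have [measurable]: "Measurable.pred N (\<lambda>p. Upair (a p) (b p) \<in> E)"
    by (rule measurable_edge_set[OF edge_sets_E]) (simp_all add: fg)
  have "Measurable.pred N (\<lambda>p. Upair (a p) (b p) \<in> E \<and> g p \<in> component (F (a p, b p)) (f p))" by measurable
  also have "(\<lambda>p. Upair (a p) (b p) \<in> E \<and> g p \<in> component (F (a p, b p)) (f p)) =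
      (\<lambda>p. Upair (a p) (b p) \<in> E \<and> g p \<in> component (edges_above lt H (Upair (a p) (b p))) (f p))"
    by (auto simp: F_def)
  finally show ?thesis .
qed

lemma measurable_finite_component_above:
  assumes H: "H \<in> edge_sets M E"
    and fg [measurable]: "a \<in> N \<rightarrow>\<^sub>M M" "b \<in> N \<rightarrow>\<^sub>M M" "f \<in> N \<rightarrow>\<^sub>M M"
  shows "Measurable.pred N (\<lambda>p. Upair (a p) (b p) \<in> E \<and> finite (component (edges_above lt H (Upair (a p) (b p))) (f p)))"
proof -
  define S where "S p = {y. Upair (a p) (b p) \<in> E \<and> y \<in> component (edges_above lt H (Upair (a p) (b p))) (f p)}" for p

  have "Measurable.pred (N \<Otimes>\<^sub>M M) (\<lambda>q. Upair (a (fst q)) (b (fst q)) \<in> E \<and> snd q \<in> component (edges_above lt H (Upair (a (fst q)) (b (fst q)))) (f (fst q)))"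
    by (rule measurable_in_component_above[OF H]) measurable
  then have 1: "Measurable.pred (N \<Otimes>\<^sub>M M) (\<lambda>(p, y). y \<in> S p)" by (simp add: S_def split_beta')
  have 2: "S p \<subseteq> component E (f p)" for p
    using component_mono[of "edges_above lt H (Upair (a p) (b p))" E "f p"] edge_setsD(1)[OF H]
    by (auto simp: S_def edges_above_def)
  have [measurable]: "Measurable.pred N (\<lambda>p. finite (S p))" by (rule measurable_card(1)[OF 1 fg(3) 2])
  have [measurable]: "Measurable.pred N (\<lambda>p. Upair (a p) (b p) \<in> E)" by (rule measurable_edge_set[OF edge_sets_E]) measurable
  have "Measurable.pred N (\<lambda>p. Upair (a p) (b p) \<in> E \<and> finite (S p))" by measurable
  also have "(\<lambda>p. Upair (a p) (b p) \<in> E \<and> finite (S p)) =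
      (\<lambda>p. Upair (a p) (b p) \<in> E \<and> finite (component (edges_above lt H (Upair (a p) (b p))) (f p)))"
    by (auto simp: S_def fun_eq_iff)
  finally show ?thesis .
qed



lemma wired_forest_edge_set: "wired_forest lt E \<in> edge_sets M E"
proof (rule edge_setsI)
  show "wired_forest lt E \<subseteq> E" by (auto simp: wired_forest_def)
  \<comment> \<open>\<open>P\<close> fixes the first vertex as the finite side, whereas either
    endpoint of an unordered edge may play that part; hence both orders of the pair are tried
    below.\<close>
  define P where "P u v \<longleftrightarrow> (Upair u v \<in> E \<and> finite (component (edges_above lt E (Upair u v)) u)) \<and>
    \<not> (Upair u v \<in> E \<and> v \<in> component (edges_above lt E (Upair u v)) u)" for u v
  have P: "Measurable.pred N (\<lambda>p. P (a p) (b p))" if "a \<in> N \<rightarrow>\<^sub>M M" "b \<in> N \<rightarrow>\<^sub>M M" for N :: "('a \<times> 'a) measure" and a b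
  proof -
    note [measurable] = measurable_finite_component_above[OF edge_sets_E that that(1)]
      measurable_in_component_above[OF edge_sets_E that that]
    show ?thesis unfolding P_def by measurable
  qed
  have [measurable]: "Measurable.pred (M \<Otimes>\<^sub>M M) (\<lambda>q. P (fst q) (snd q))" "Measurable.pred (M \<Otimes>\<^sub>M M) (\<lambda>q. P (snd q) (fst q))"
    by (rule P; measurable)+
  have "Measurable.pred (M \<Otimes>\<^sub>M M) (\<lambda>q. P (fst q) (snd q) \<or> P (snd q) (fst q))" by measurable
  also have "(\<lambda>q. P (fst q) (snd q) \<or> P (snd q) (fst q)) = (\<lambda>(x, y). Upair x y \<in> wired_forest lt E)"
  proof -
    have "Upair x y \<in> wired_forest lt E \<longleftrightarrow> P x y \<or> P y x" for x y
    proof -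
      have sw: "Upair y x = Upair x y" by simp
      show ?thesis unfolding wired_forest_def P_def sw by auto
    qed
    then show ?thesis by (simp add: fun_eq_iff)
  qed
  finally show "Measurable.pred (M \<Otimes>\<^sub>M M) (\<lambda>(x, y). Upair x y \<in> wired_forest lt E)" .
qed

context
  fixes H :: "'a uprod set"
  assumes H: "H \<in> edge_sets M E"
begin

lemma H_E: "H \<subseteq> E" by (rule edge_setsD(1)[OF H])

lemma component_above_subset: "component (edges_above lt H e) u \<subseteq> component E u"
  using H_E by (intro component_mono) (auto simp: edges_above_def)

text \<open>The premise acts as a local definition of \<open>K\<close>, the elder rule for one
  orientation of the edge, with guards in \<open>E\<close> and with quantifiers over clusters turned
  into quantifiers over visits.\<close>

lemma kills_iff:
  "kills lt h H (Upair u v) z \<longleftrightarrow> Upair u v \<in> H \<and> (K u v z \<or> K v u z)"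
  if "\<And>u v z. K u v z \<longleftrightarrow> (Upair u v \<in> E \<and> finite (component (edges_above lt H (Upair u v)) u)) \<and>
     (Upair u v \<in> E \<and> z \<in> component (edges_above lt H (Upair u v)) u) \<and>
     (\<forall>k. (Upair u v \<in> E \<and> visit k u \<in> component (edges_above lt H (Upair u v)) u) \<longrightarrow> h z \<le> h (visit k u)) \<and>
     (\<not> (Upair u v \<in> E \<and> finite (component (edges_above lt H (Upair u v)) v)) \<or>
      (\<exists>k. (Upair u v \<in> E \<and> visit k v \<in> component (edges_above lt H (Upair u v)) v) \<and> h (visit k v) < h z))"
proof (cases "Upair u v \<in> H")
  case True
  have sw: "Upair v u = Upair u v" by simp
  have uE: "Upair u v \<in> E" "Upair v u \<in> E" using H_E True unfolding sw by auto
  have all: "(\<forall>w\<in>component (edges_above lt H e) a. P w) \<longleftrightarrow>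
      (\<forall>k. visit k a \<in> component (edges_above lt H e) a \<longrightarrow> P (visit k a))" for e a P
    using component_above_subset[of e a] by (auto simp: visit(2))
  have ex: "(\<exists>w\<in>component (edges_above lt H e) a. P w) \<longleftrightarrow>
      (\<exists>k. visit k a \<in> component (edges_above lt H e) a \<and> P (visit k a))" for e a P
    using all[of e a "\<lambda>w. \<not> P w"] by blast
  have K': "K a b z \<longleftrightarrow> finite (component (edges_above lt H (Upair a b)) a) \<and> leader h (component (edges_above lt H (Upair a b)) a) z \<and>
    (infinite (component (edges_above lt H (Upair a b)) b) \<or> (\<exists>w\<in>component (edges_above lt H (Upair a b)) b. h w < h z))"
    if "Upair a b \<in> E" for a b
    unfolding \<open>\<And>u v z. K u v z \<longleftrightarrow> _ u v z\<close> leader_def all ex using that by simp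
  have "kills lt h H (Upair u v) z \<longleftrightarrow> K u v z \<or> K v u z"
    unfolding K'[OF uE(1)] K'[OF uE(2)] kills_def sw using True by auto
  with True show ?thesis by simp
qed (simp add: kills_def)

lemma measurable_kills:
  assumes [measurable]: "a \<in> N \<rightarrow>\<^sub>M M" "b \<in> N \<rightarrow>\<^sub>M M" "c \<in> N \<rightarrow>\<^sub>M M"
  shows "Measurable.pred N (\<lambda>p. kills lt h H (Upair (a p) (b p)) (c p))"
proof -
  define K where "K u v z \<longleftrightarrow> (Upair u v \<in> E \<and> finite (component (edges_above lt H (Upair u v)) u)) \<and>
     (Upair u v \<in> E \<and> z \<in> component (edges_above lt H (Upair u v)) u) \<and>
     (\<forall>k. (Upair u v \<in> E \<and> visit k u \<in> component (edges_above lt H (Upair u v)) u) \<longrightarrow> h z \<le> h (visit k u)) \<and>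
     (\<not> (Upair u v \<in> E \<and> finite (component (edges_above lt H (Upair u v)) v)) \<or>
      (\<exists>k. (Upair u v \<in> E \<and> visit k v \<in> component (edges_above lt H (Upair u v)) v) \<and> h (visit k v) < h z))" for u v z
  have K: "Measurable.pred N (\<lambda>p. K (a p) (b p) (c p))"
    if ab [measurable]: "a \<in> N \<rightarrow>\<^sub>M M" "b \<in> N \<rightarrow>\<^sub>M M" for a b
  proof -
    have [measurable]: "(\<lambda>p. h (c p)) \<in> borel_measurable N"
      "(\<lambda>p. h (visit k (a p))) \<in> borel_measurable N" "(\<lambda>p. h (visit k (b p))) \<in> borel_measurable N" for k
      by (rule measurable_compose[OF _ measurable_h], measurable)+
    have [measurable]: "Measurable.pred N (\<lambda>p. Upair (a p) (b p) \<in> E \<and> finite (component (edges_above lt H (Upair (a p) (b p))) (a p)))"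
      "Measurable.pred N (\<lambda>p. Upair (a p) (b p) \<in> E \<and> finite (component (edges_above lt H (Upair (a p) (b p))) (b p)))"
      by (rule measurable_finite_component_above[OF H]; measurable)+
    have [measurable]: "Measurable.pred N (\<lambda>p. Upair (a p) (b p) \<in> E \<and> c p \<in> component (edges_above lt H (Upair (a p) (b p))) (a p))"
      "Measurable.pred N (\<lambda>p. Upair (a p) (b p) \<in> E \<and> visit k (a p) \<in> component (edges_above lt H (Upair (a p) (b p))) (a p))"
      "Measurable.pred N (\<lambda>p. Upair (a p) (b p) \<in> E \<and> visit k (b p) \<in> component (edges_above lt H (Upair (a p) (b p))) (b p))" for k
      by (rule measurable_in_component_above[OF H]; measurable)+
    show ?thesis unfolding K_def by measurable
  qed
  have [measurable]: "Measurable.pred N (\<lambda>p. K (a p) (b p) (c p))" "Measurable.pred N (\<lambda>p. K (b p) (a p) (c p))"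
    by (rule K; measurable)+
  have [measurable]: "Measurable.pred N (\<lambda>p. Upair (a p) (b p) \<in> H)" by (rule measurable_edge_set[OF H]) measurable
  show ?thesis unfolding kills_iff[of K, OF K_def] by measurable
qed

end

end

section \<open>Edge measure of wired forests\<close>

lemma count_space_single: "a \<in> C \<Longrightarrow> (\<integral>\<^sup>+y. indicator {a} y \<partial>count_space C) = 1"
  by (subst nn_integral_indicator) (auto simp: emeasure_count_space)

context ordered_graphing
begin

context
  fixes H :: "'a uprod set"
  assumes H: "H \<in> edge_sets M E" and W: "wired lt H"
begin

lemma fin_H: "finite {y. Upair x y \<in> H}" by (rule finite_nbrs_subset[OF edge_setsD(1)[OF H]])

lemma component_H_subset: "component H x \<subseteq> component E x"
  by (rule component_mono[OF edge_setsD(1)[OF H]])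

lemma kills_endpoints:
  assumes "kills lt h H (Upair u v) x"
  shows "u \<in> component E x" "v \<in> component E x" "u \<noteq> v" "Upair u v \<in> H"
proof -
  have uv: "Upair u v \<in> H" using assms by (simp add: kills_def)
  show "Upair u v \<in> H" by fact
  have uE: "Upair u v \<in> E" using uv edge_setsD(1)[OF H] by blast
  have "x \<in> component E u"
    using kills_unique_vertex(2)[OF W uv assms] component_H_subset by blast
  then show *: "u \<in> component E x" using component_sym by fast
  show "v \<in> component E x" by (rule component_step[OF * uE])
  show "u \<noteq> v" using uE no_loops by auto
qed

definition killed :: "'a \<Rightarrow> bool" where "killed x \<longleftrightarrow> (\<exists>e. kills lt h H e x)"

lemma measurable_killed [measurable]: "Measurable.pred M killed"
proof -
  have "killed x \<longleftrightarrow> (\<exists>k l. kills lt h H (Upair (visit k x) (visit l x)) x)" for x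
  proof
    assume "killed x"
    then obtain u v where k: "kills lt h H (Upair u v) x" unfolding killed_def by (metis uprod_exhaust)
    then show "\<exists>k l. kills lt h H (Upair (visit k x) (visit l x)) x"
      using kills_endpoints(1,2)[OF k] unfolding visit(2) by blast
  qed (auto simp: killed_def)
  moreover have "Measurable.pred M (\<lambda>x. kills lt h H (Upair (visit k x) (visit l x)) x)" for k l
    by (rule measurable_kills[OF H]) measurable
  note [measurable] = this
  have "Measurable.pred M (\<lambda>x. \<exists>k l. kills lt h H (Upair (visit k x) (visit l x)) x)" by measurable
  ultimately show ?thesis by presburger
qed

text \<open>Each endpoint of an edge sends mass 1 to the vertex that the edge kills. So x sends
  \<open>deg H x\<close> in total, and a killed vertex receives 2, from the two distinct endpoints
  of its only killing edge. The factor 1/2 in \<open>eta\<close> cancels this 2.\<close>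

lemma eta_eq_killed: "eta M H = emeasure M {x. killed x}"
proof -
  define K where "K x y z = (indicator {y. kills lt h H (Upair x y) z} y :: ennreal)" for x y z
  define m where "m x z = (\<integral>\<^sup>+y. K x y z \<partial>count_space (component E x))" for x z
  have "Measurable.pred ((M \<Otimes>\<^sub>M M) \<Otimes>\<^sub>M M) (\<lambda>q. kills lt h H (Upair (fst (fst q)) (snd q)) (snd (fst q)))"
    by (rule measurable_kills[OF H]) measurable
  note [measurable] = this
  have "(\<lambda>q. if kills lt h H (Upair (fst (fst q)) (snd q)) (snd (fst q)) then 1 else 0 :: ennreal) \<in> borel_measurable ((M \<Otimes>\<^sub>M M) \<Otimes>\<^sub>M M)"
    by measurable
  also have "(\<lambda>q. if kills lt h H (Upair (fst (fst q)) (snd q)) (snd (fst q)) then 1 else 0 :: ennreal) = (\<lambda>(p, y). K (fst p) y (snd p))"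
    by (auto simp: K_def indicator_def fun_eq_iff)
  finally have "(\<lambda>p. m (fst p) (snd p)) \<in> borel_measurable (M \<Otimes>\<^sub>M M)"
    unfolding m_def by (rule measurable_count_component) simp
  then have m: "(\<lambda>(x, z). m x z) \<in> borel_measurable (M \<Otimes>\<^sub>M M)" by (simp add: split_beta')
  have 1: "(\<integral>\<^sup>+z. m x z \<partial>count_space (component E x)) = of_nat (deg H x)" for x
  proof -
    have "(\<integral>\<^sup>+z. m x z \<partial>count_space (component E x)) =
        (\<integral>\<^sup>+y. \<integral>\<^sup>+z. K x y z \<partial>count_space (component E x) \<partial>count_space (component E x))"
      unfolding m_def by (rule nn_integral_count_space_nn_integral[OF countable_component]) simp
    also have "\<dots> = (\<integral>\<^sup>+y. indicator H (Upair x y) \<partial>count_space (component E x))"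
    proof (rule nn_integral_cong)
      fix y
      show "(\<integral>\<^sup>+z. K x y z \<partial>count_space (component E x)) = indicator H (Upair x y)"
      proof (cases "Upair x y \<in> H")
        case True
        obtain z0 where z0: "kills lt h H (Upair x y) z0" "\<And>z. kills lt h H (Upair x y) z \<Longrightarrow> z = z0"
          using kills_unique_vertex(1)[OF W True] by blast
        have "z0 \<in> component E x"
          using kills_unique_vertex(2)[OF W True z0(1)] component_H_subset by blast
        moreover have "kills lt h H (Upair x y) z \<longleftrightarrow> z = z0" for z using z0 by blast
        then have "K x y z = indicator {z0} z" for z by (simp add: K_def indicator_def)
        ultimately show ?thesis using True by (simp add: count_space_single del: nn_integral_indicator)
      qed (simp add: K_def kills_def)
    qed
    also have "\<dots> = of_nat (deg H x)" by (rule deg_eq_count[OF edge_setsD(1)[OF H], symmetric])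
    finally show ?thesis .
  qed
  have 2: "(\<integral>\<^sup>+z. m z x \<partial>count_space (component E x)) = 2 * indicator {x. killed x} x" for x
  proof (cases "killed x")
    case False
    then have "m z x = 0" for z by (simp add: m_def K_def killed_def)
    with False show ?thesis by simp
  next
    case True
    then obtain u v where k: "kills lt h H (Upair u v) x" unfolding killed_def by (metis uprod_exhaust)
    note uv = kills_endpoints[OF k]
    have iff: "kills lt h H e x \<longleftrightarrow> e = Upair u v" for e using k kills_unique_edge by blast
    have "(\<integral>\<^sup>+z. m z x \<partial>count_space (component E x)) =
        (\<integral>\<^sup>+z. indicator {u} z + indicator {v} z \<partial>count_space (component E x))"
    proof (rule nn_integral_cong)
      fix z assume "z \<in> space (count_space (component E x))"
      then have z: "component E z = component E x" by (intro component_eq) simp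
      consider "z = u" | "z = v" | "z \<noteq> u" "z \<noteq> v" by blast
      then show "m z x = indicator {u} z + indicator {v} z"
      proof cases
        case 1
        then have "K z y x = indicator {v} y" for y using uv(3) by (auto simp: K_def iff indicator_def)
        then show ?thesis unfolding m_def z using 1 uv by (simp add: count_space_single del: nn_integral_indicator)
      next
        case 2
        then have "K z y x = indicator {u} y" for y using uv(3) by (auto simp: K_def iff indicator_def)
        then show ?thesis unfolding m_def z using 2 uv by (simp add: count_space_single del: nn_integral_indicator)
      next
        case 3
        then have "K z y x = 0" for y by (auto simp: K_def iff indicator_def)
        then show ?thesis unfolding m_def using 3 by simp
      qed
    qed
    also have "\<dots> = 1 + 1"
      using uv by (subst nn_integral_add) (simp_all add: count_space_single del: nn_integral_indicator)
    finally show ?thesis using True by simp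
  qed
  have kM: "{x. killed x} \<in> sets M" using measurable_killed by (simp add: pred_def)
  have "(\<integral>\<^sup>+x. of_nat (deg H x) \<partial>M) = (\<integral>\<^sup>+x. 2 * indicator {x. killed x} x \<partial>M)"
    using mass_transport_component[OF m] unfolding 1 2 .
  also have "\<dots> = 2 * emeasure M {x. killed x}" using kM by (simp add: nn_integral_cmult)
  finally have "eta M H = ennreal (1/2) * (2 * emeasure M {x. killed x})" by (simp add: eta_def)
  also have "\<dots> = ennreal (1/2) * ennreal 2 * emeasure M {x. killed x}" by (simp add: mult.assoc)
  also have "ennreal (1/2) * ennreal 2 = 1" by (subst ennreal_mult[symmetric]) simp_all
  also have "1 * emeasure M {x. killed x} = emeasure M {x. killed x}" by simp
  finally show ?thesis .
qed

text \<open>In a finite component the only unkilled vertex is the leader; it spreads mass 1 evenly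
  over the component. An infinite component contributes nothing on the left because its
  \<open>card\<close> is 0.\<close>

lemma inverse_component_eq_unkilled:
  "(\<integral>\<^sup>+x. ennreal (1 / real (card (component H x))) \<partial>M) = emeasure M {x. finite (component H x) \<and> \<not> killed x}"
proof -
  define Z where "Z = {x. finite (component H x) \<and> \<not> killed x}"
  note [measurable] = measurable_card_component[OF H]
  have Z [measurable]: "Z \<in> sets M"
  proof -
    have "{x \<in> space M. finite (component H x) \<and> \<not> killed x} \<in> sets M" by measurable
    then show ?thesis by (simp add: Z_def)
  qed
  define c where "c x = ennreal (1 / real (card (component H x)))" for x
  define m where "m x y = (if x \<in> Z \<and> y \<in> component H x then c x else 0)" for x y
  have cM [measurable]: "c \<in> borel_measurable M" unfolding c_def by measurable
  have [measurable]: "Measurable.pred (M \<Otimes>\<^sub>M M) (\<lambda>q. snd q \<in> component H (fst q))"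
    by (rule measurable_in_component[OF H]) measurable
  have "(\<lambda>q. if fst q \<in> Z \<and> snd q \<in> component H (fst q) then c (fst q) else 0) \<in> borel_measurable (M \<Otimes>\<^sub>M M)"
    by measurable
  then have m: "(\<lambda>(x, y). m x y) \<in> borel_measurable (M \<Otimes>\<^sub>M M)" by (simp add: m_def split_beta')
  have 1: "(\<integral>\<^sup>+y. m x y \<partial>count_space (component E x)) = indicator Z x" for x
  proof (cases "x \<in> Z")
    case True
    then have fin: "finite (component H x)" by (simp add: Z_def)
    have "component H x \<noteq> {}" by (metis component_refl empty_iff)
    then have pos: "card (component H x) > 0" using fin by (simp add: card_gt_0_iff)
    have "(\<integral>\<^sup>+y. m x y \<partial>count_space (component E x)) = (\<integral>\<^sup>+y. c x * indicator (component H x) y \<partial>count_space (component E x))"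
      using True by (intro nn_integral_cong) (simp add: m_def indicator_def)
    also have "\<dots> = c x * (\<integral>\<^sup>+y. indicator (component H x) y \<partial>count_space (component E x))"
      by (rule nn_integral_cmult) simp
    also have "(\<integral>\<^sup>+y. indicator (component H x) y \<partial>count_space (component E x)) = ennreal (real (card (component H x)))"
      unfolding count_component_indicator[OF component_H_subset]
      using fin by (simp add: emeasure_count_space ennreal_of_nat_eq_real_of_nat)
    also have "c x * \<dots> = 1" using pos by (simp add: c_def ennreal_mult[symmetric])
    finally show ?thesis using True by simp
  qed (simp add: m_def)
  have 2: "(\<integral>\<^sup>+x. m x y \<partial>count_space (component E y)) = c y" for y
  proof (cases "finite (component H y)")
    case True
    have "component H y \<noteq> {}" by (metis component_refl empty_iff)
    then obtain x0 where x0: "leader h (component H y) x0" using leader_exists[OF True] by blast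
    have "x \<in> Z \<and> y \<in> component H x \<longleftrightarrow> x = x0" for x
    proof
      assume *: "x \<in> Z \<and> y \<in> component H x"
      then have "component H y = component H x" by (intro component_eq) simp
      moreover have "leader h (component H x) x"
        using * unkilled_iff_leader[OF fin_H, of x] unfolding Z_def killed_def by blast
      ultimately show "x = x0" using x0 leader_unique[OF inj_h] by metis
    next
      assume x: "x = x0"
      then have xy: "x \<in> component H y" using x0 by (simp add: leader_def)
      then have eq: "component H x = component H y" by (rule component_eq)
      then have "x \<in> Z" unfolding Z_def mem_Collect_eq killed_def
        using True x0 x unkilled_iff_leader[OF fin_H, of x] by simp
      with xy show "x \<in> Z \<and> y \<in> component H x" using component_sym by fast
    qed
    moreover have xE: "x0 \<in> component E y" and eq: "component H x0 = component H y"
      using x0 component_H_subset component_eq[of x0 H y] by (auto simp: leader_def)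
    ultimately have "m x y = c y * indicator {x0} x" for x
      by (simp add: m_def c_def indicator_def)
    then have "(\<integral>\<^sup>+x. m x y \<partial>count_space (component E y)) = (\<integral>\<^sup>+x. c y * indicator {x0} x \<partial>count_space (component E y))"
      by simp
    also have "\<dots> = c y * (\<integral>\<^sup>+x. indicator {x0} x \<partial>count_space (component E y))"
      by (rule nn_integral_cmult) simp
    finally show ?thesis using xE by (simp add: count_space_single del: nn_integral_indicator)
  next
    case False
    have "m x y = 0" for x
    proof -
      have "component H y = component H x" if "y \<in> component H x" using component_eq[OF that] .
      then show ?thesis using False unfolding m_def Z_def by auto
    qed
    then show ?thesis using False by (simp add: c_def)
  qed
  have "(\<integral>\<^sup>+x. indicator Z x \<partial>M) = (\<integral>\<^sup>+y. c y \<partial>M)"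
    using mass_transport_component[OF m] unfolding 1 2 .
  then show ?thesis using Z by (simp add: c_def Z_def)
qed

text \<open>An unkilled vertex of an infinite component sends mass 1 to every vertex of the finite
  clusters it leads, infinitely much in total. Each vertex receives at most 1, and \<open>M\<close>
  has total mass 1.\<close>

lemma unkilled_infinite_null: "emeasure M {x. infinite (component H x) \<and> \<not> killed x} = 0"
proof -
  define Z where "Z = {x. infinite (component H x) \<and> \<not> killed x}"
  note [measurable] = measurable_card_component[OF H]
  have Z [measurable]: "Z \<in> sets M"
  proof -
    have "{x \<in> space M. \<not> finite (component H x) \<and> \<not> killed x} \<in> sets M" by measurable
    then show ?thesis by (simp add: Z_def)
  qed
  define P where "P x y \<longleftrightarrow> (\<exists>u\<in>component H x. \<exists>v. Upair u v \<in> H \<and>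
     finite (component (edges_above lt H (Upair u v)) x) \<and> y \<in> component (edges_above lt H (Upair u v)) x)" for x y
  \<comment> \<open>A countable form of \<open>P\<close>, with the guards under which the
    measurability lemmas apply: both endpoints of the edge are visits of x.\<close>
  have P_iff: "P x y \<longleftrightarrow> (\<exists>k l. visit k x \<in> component H x \<and> Upair (visit k x) (visit l x) \<in> H \<and>
     (Upair (visit k x) (visit l x) \<in> E \<and> finite (component (edges_above lt H (Upair (visit k x) (visit l x))) x)) \<and>
     (Upair (visit k x) (visit l x) \<in> E \<and> y \<in> component (edges_above lt H (Upair (visit k x) (visit l x))) x))" for x y
  proof
    assume "P x y"
    then obtain u v where uv: "u \<in> component H x" "Upair u v \<in> H"
      "finite (component (edges_above lt H (Upair u v)) x)" "y \<in> component (edges_above lt H (Upair u v)) x"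
      unfolding P_def by blast
    have uE: "Upair u v \<in> E" using uv(2) edge_setsD(1)[OF H] by blast
    have "u \<in> component E x" using uv(1) component_H_subset by blast
    moreover have "v \<in> component E x" by (rule component_step[OF calculation uE])
    ultimately obtain k l where "u = visit k x" "v = visit l x" unfolding visit(2) by blast
    with uv uE show "\<exists>k l. visit k x \<in> component H x \<and> Upair (visit k x) (visit l x) \<in> H \<and>
     (Upair (visit k x) (visit l x) \<in> E \<and> finite (component (edges_above lt H (Upair (visit k x) (visit l x))) x)) \<and>
     (Upair (visit k x) (visit l x) \<in> E \<and> y \<in> component (edges_above lt H (Upair (visit k x) (visit l x))) x)"
      by (intro exI[of _ k] exI[of _ l]) simp
  qed (unfold P_def, blast)
  have [measurable]: "Measurable.pred (M \<Otimes>\<^sub>M M) (\<lambda>q. P (fst q) (snd q))"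
  proof -
    have [measurable]: "Measurable.pred (M \<Otimes>\<^sub>M M) (\<lambda>q. visit k (fst q) \<in> component H (fst q))" for k
      by (rule measurable_in_component[OF H]) measurable
    have [measurable]: "Measurable.pred (M \<Otimes>\<^sub>M M) (\<lambda>q. Upair (visit k (fst q)) (visit l (fst q)) \<in> H)" for k l
      by (rule measurable_edge_set[OF H]) measurable
    have [measurable]: "Measurable.pred (M \<Otimes>\<^sub>M M) (\<lambda>q. Upair (visit k (fst q)) (visit l (fst q)) \<in> E \<and>
        finite (component (edges_above lt H (Upair (visit k (fst q)) (visit l (fst q)))) (fst q)))" for k l
      by (rule measurable_finite_component_above[OF H]) measurable
    have [measurable]: "Measurable.pred (M \<Otimes>\<^sub>M M) (\<lambda>q. Upair (visit k (fst q)) (visit l (fst q)) \<in> E \<and>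
        snd q \<in> component (edges_above lt H (Upair (visit k (fst q)) (visit l (fst q)))) (fst q))" for k l
      by (rule measurable_in_component_above[OF H]) measurable
    show ?thesis unfolding P_iff by measurable
  qed
  define m where "m x y = (if x \<in> Z \<and> P x y then 1 else 0 :: ennreal)" for x y
  have "(\<lambda>q. if fst q \<in> Z \<and> P (fst q) (snd q) then 1 else 0 :: ennreal) \<in> borel_measurable (M \<Otimes>\<^sub>M M)"
    by measurable
  then have m: "(\<lambda>(x, y). m x y) \<in> borel_measurable (M \<Otimes>\<^sub>M M)" by (simp add: m_def split_beta')
  have P_sub: "{y. P x y} \<subseteq> component E x" for x
    unfolding P_def using component_above_subset[OF H] by blast
  have 1: "(\<integral>\<^sup>+y. m x y \<partial>count_space (component E x)) = \<infinity> * indicator Z x" for x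
  proof (cases "x \<in> Z")
    case True
    have "(\<integral>\<^sup>+y. m x y \<partial>count_space (component E x)) = (\<integral>\<^sup>+y. indicator {y. P x y} y \<partial>count_space (component E x))"
      using True by (intro nn_integral_cong) (simp add: m_def indicator_def)
    also have "\<dots> = emeasure (count_space UNIV) {y. P x y}" by (rule count_component_indicator[OF P_sub])
    also have "infinite {y. P x y}"
      using True unkilled_infinite_clusters[OF fin_H, of x] unfolding Z_def killed_def P_def by blast
    then have "emeasure (count_space UNIV) {y. P x y} = \<infinity>" by (simp add: emeasure_count_space)
    finally show ?thesis using True by simp
  qed (simp add: m_def)
  have 2: "(\<integral>\<^sup>+x. m x y \<partial>count_space (component E y)) \<le> 1" for y
  proof (cases "\<exists>x. x \<in> Z \<and> P x y")
    case False
    then have "m x y = 0" for x unfolding m_def by auto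
    then show ?thesis by simp
  next
    case True
    then obtain x0 where x0: "x0 \<in> Z" "P x0 y" by blast
    have "x = x0" if x: "x \<in> Z" "P x y" for x
    proof -
      obtain e where "finite (component (edges_above lt H e) x)" "y \<in> component (edges_above lt H e) x"
        using x(2) unfolding P_def by blast
      moreover obtain e' where "finite (component (edges_above lt H e') x0)" "y \<in> component (edges_above lt H e') x0"
        using x0(2) unfolding P_def by blast
      ultimately show ?thesis
        using unkilled_same_cluster[OF fin_H, of x x0 y e e'] x(1) x0(1) unfolding Z_def killed_def by blast
    qed
    then have "m x y \<le> indicator {x0} x" for x by (auto simp: m_def indicator_def)
    then have "(\<integral>\<^sup>+x. m x y \<partial>count_space (component E y)) \<le> (\<integral>\<^sup>+x. indicator {x0} x \<partial>count_space (component E y))"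
      by (intro nn_integral_mono)
    also have "\<dots> = 1"
    proof (rule count_space_single)
      have "y \<in> component E x0" using x0(2) P_sub by blast
      then show "x0 \<in> component E y" using component_sym by fast
    qed
    finally show ?thesis .
  qed
  have "\<infinity> * emeasure M Z = (\<integral>\<^sup>+x. \<infinity> * indicator Z x \<partial>M)"
    by (rule nn_integral_cmult_indicator[symmetric]) simp
  also have "\<dots> = (\<integral>\<^sup>+y. \<integral>\<^sup>+x. m x y \<partial>count_space (component E y) \<partial>M)"
    using mass_transport_component[OF m] unfolding 1 .
  also have "\<dots> \<le> (\<integral>\<^sup>+y. 1 \<partial>M)" by (intro nn_integral_mono 2)
  also have "\<dots> = 1" by (simp add: emeasure_space_1[simplified])
  finally have "emeasure M Z = 0" by (auto simp: ennreal_top_mult top_unique split: if_splits)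
  then show ?thesis by (simp add: Z_def)
qed

text \<open>The equality of edge measure and rank, written additively to avoid subtraction in
  \<open>ennreal\<close>. Every vertex is killed, or survives in a finite component, or lies in the
  null set of \<open>unkilled_infinite_null\<close>.\<close>

theorem eta_wired: "eta M H + (\<integral>\<^sup>+x. ennreal (1 / real (card (component H x))) \<partial>M) = 1"
proof -
  note [measurable] = measurable_card_component[OF H]
  have s: "{x \<in> space M. killed x} \<in> sets M" "{x \<in> space M. finite (component H x) \<and> \<not> killed x} \<in> sets M"
    "{x \<in> space M. \<not> finite (component H x) \<and> \<not> killed x} \<in> sets M" by measurable
  let ?A = "{x. killed x}" and ?B = "{x. finite (component H x) \<and> \<not> killed x}"
    and ?C = "{x. infinite (component H x) \<and> \<not> killed x}"
  have ABC: "?A \<in> sets M" "?B \<in> sets M" "?C \<in> sets M" using s by simp_all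
  have "emeasure M ?A + emeasure M ?B = emeasure M (?A \<union> ?B)"
    using ABC by (intro plus_emeasure) auto
  also have "\<dots> = emeasure M (?A \<union> ?B) + emeasure M ?C" by (simp add: unkilled_infinite_null)
  also have "\<dots> = emeasure M ((?A \<union> ?B) \<union> ?C)" using ABC by (intro plus_emeasure) auto
  also have "(?A \<union> ?B) \<union> ?C = space M" by auto
  finally show ?thesis by (simp add: eta_eq_killed inverse_component_eq_unkilled emeasure_space_1[simplified])
qed

end

end

section \<open>The extremal measure\<close>

text \<open>The coercion \<open>ennreal\<close> cuts f off at 0; accordingly only levels t >= 0 are
  integrated.\<close>

lemma nn_integral_layer_cake:
  fixes f :: "'b \<Rightarrow> real"
  assumes "sigma_finite_measure P" and [measurable]: "f \<in> borel_measurable P"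
  shows "(\<integral>\<^sup>+x. ennreal (f x) \<partial>P) = (\<integral>\<^sup>+t. indicator {0..} t * emeasure P {x \<in> space P. t < f x} \<partial>lborel)"
proof -
  interpret P: sigma_finite_measure P by fact
  interpret pair_sigma_finite P lborel ..
  have "(\<integral>\<^sup>+x. ennreal (f x) \<partial>P) = (\<integral>\<^sup>+x. \<integral>\<^sup>+t. indicator {0..<f x} t \<partial>lborel \<partial>P)"
  proof (rule nn_integral_cong)
    fix x
    show "ennreal (f x) = (\<integral>\<^sup>+t. indicator {0..<f x} t \<partial>lborel)"
      by (cases "0 \<le> f x") (simp_all add: ennreal_neg)
  qed
  also have "\<dots> = (\<integral>\<^sup>+x. \<integral>\<^sup>+t. (if 0 \<le> t \<and> t < f x then 1 else 0) \<partial>lborel \<partial>P)"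
    by (intro nn_integral_cong) (simp add: indicator_def)
  also have "\<dots> = (\<integral>\<^sup>+t. \<integral>\<^sup>+x. (if 0 \<le> t \<and> t < f x then 1 else 0) \<partial>P \<partial>lborel)"
    by (rule Fubini'[symmetric]) measurable
  also have "\<dots> = (\<integral>\<^sup>+t. indicator {0..} t * emeasure P {x \<in> space P. t < f x} \<partial>lborel)"
  proof (rule nn_integral_cong)
    fix t :: real
    have "(\<integral>\<^sup>+x. (if 0 \<le> t \<and> t < f x then 1 else 0) \<partial>P) =
        (\<integral>\<^sup>+x. indicator {0..} t * indicator {x \<in> space P. t < f x} x \<partial>P)"
      by (intro nn_integral_cong) (simp add: indicator_def)
    also have "\<dots> = indicator {0..} t * emeasure P {x \<in> space P. t < f x}"
      by (rule nn_integral_cmult_indicator) measurable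
    finally show "(\<integral>\<^sup>+x. (if 0 \<le> t \<and> t < f x then 1 else 0) \<partial>P) = indicator {0..} t * emeasure P {x \<in> space P. t < f x}" .
  qed
  finally show ?thesis .
qed

text \<open>Adding \<open>C\<close> makes \<open>g\<close> nonnegative almost everywhere, so the
  layer cake formula compares the integrals level by level. The total masses agree, so the added
  constant contributes equally to both sides.\<close>

lemma integral_mono_of_tails:
  fixes g :: "'b \<Rightarrow> real"
  assumes fin: "finite_measure P" "finite_measure Q" and sets: "sets P = sets Q"
    and g: "g \<in> borel_measurable P" and bound: "AE x in P. \<bar>g x\<bar> \<le> C" "AE x in Q. \<bar>g x\<bar> \<le> C"
    and mass: "emeasure P (space P) = emeasure Q (space Q)"
    and tails: "\<And>t. emeasure P {x \<in> space P. t < g x} \<le> emeasure Q {x \<in> space Q. t < g x}"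
  shows "(\<integral>x. g x \<partial>P) \<le> (\<integral>x. g x \<partial>Q)"
proof -
  interpret P: finite_measure P by fact
  interpret Q: finite_measure Q by fact
  have g' [measurable]: "g \<in> borel_measurable P" "g \<in> borel_measurable Q"
    using g measurable_cong_sets[OF sets refl] by auto
  have int: "integrable P g" "integrable Q g"
    using bound by (auto intro!: P.integrable_const_bound[where B=C] Q.integrable_const_bound[where B=C])
  have sh: "{x \<in> space R. t < g x + C} = {x \<in> space R. t - C < g x}" for t and R :: "'b measure" by auto
  have "(\<integral>\<^sup>+x. ennreal (g x + C) \<partial>P) \<le> (\<integral>\<^sup>+x. ennreal (g x + C) \<partial>Q)"
    unfolding nn_integral_layer_cake[OF P.sigma_finite_measure_axioms borel_measurable_add[OF g'(1) borel_measurable_const]]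
      nn_integral_layer_cake[OF Q.sigma_finite_measure_axioms borel_measurable_add[OF g'(2) borel_measurable_const]] sh
    by (intro nn_integral_mono mult_left_mono tails) simp
  moreover have eqP: "(\<integral>\<^sup>+x. ennreal (g x + C) \<partial>P) = ennreal (\<integral>x. g x + C \<partial>P)"
    using int bound by (intro nn_integral_eq_integral) auto
  moreover have eqQ: "(\<integral>\<^sup>+x. ennreal (g x + C) \<partial>Q) = ennreal (\<integral>x. g x + C \<partial>Q)"
    using int bound by (intro nn_integral_eq_integral) auto
  moreover have "0 \<le> (\<integral>x. g x + C \<partial>Q)" using bound(2) by (intro integral_nonneg_AE) auto
  ultimately have "(\<integral>x. g x + C \<partial>P) \<le> (\<integral>x. g x + C \<partial>Q)" by simp
  moreover have "measure P (space P) = measure Q (space Q)" using mass by (simp add: measure_def)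
  ultimately show ?thesis using int by simp
qed

section \<open>Edge measure and rank as set functions\<close>

context graphing_space
begin

lemma sigma_algebra_edge_sets: "sigma_algebra E (edge_sets M E)"
  unfolding sigma_algebra_iff2
proof (intro conjI ballI allI impI)
  show "edge_sets M E \<subseteq> Pow E" by (auto simp: edge_sets_def)
  show "{} \<in> edge_sets M E" by (simp add: edge_sets_def)
next
  fix A assume A: "A \<in> edge_sets M E"
  have [measurable]: "Measurable.pred (M \<Otimes>\<^sub>M M) (\<lambda>q. Upair (fst q) (snd q) \<in> A)" "Measurable.pred (M \<Otimes>\<^sub>M M) (\<lambda>q. Upair (fst q) (snd q) \<in> E)"
    using edge_setsD(2)[OF A] edge_setsD(2)[OF edge_sets_E] by (simp_all add: split_beta')
  have "Measurable.pred (M \<Otimes>\<^sub>M M) (\<lambda>q. Upair (fst q) (snd q) \<in> E \<and> \<not> Upair (fst q) (snd q) \<in> A)" by measurable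
  then show "E - A \<in> edge_sets M E" by (intro edge_setsI) (auto simp: split_beta')
next
  fix A :: "nat \<Rightarrow> 'a uprod set" assume A: "range A \<subseteq> edge_sets M E"
  have [measurable]: "Measurable.pred (M \<Otimes>\<^sub>M M) (\<lambda>q. Upair (fst q) (snd q) \<in> A i)" for i
    using edge_setsD(2)[of "A i"] A by (simp add: split_beta' image_subset_iff)
  have "Measurable.pred (M \<Otimes>\<^sub>M M) (\<lambda>q. \<exists>i. Upair (fst q) (snd q) \<in> A i)" by measurable
  moreover have "A i \<subseteq> E" for i using A edge_setsD(1)[of "A i"] by blast
  ultimately show "(\<Union>i. A i) \<in> edge_sets M E" by (intro edge_setsI) (auto simp: split_beta')
qed

lemma sets_eta_measure [simp]: "sets (eta_measure M E) = edge_sets M E"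
  unfolding eta_measure_def by (rule sigma_algebra.sets_measure_of_eq[OF sigma_algebra_edge_sets])

lemma space_eta_measure [simp]: "space (eta_measure M E) = E"
  unfolding eta_measure_def by (rule sigma_algebra.space_measure_of_eq[OF sigma_algebra_edge_sets])

lemma emeasure_eta_measure:
  assumes "A \<in> edge_sets M E" shows "emeasure (eta_measure M E) A = eta M A"
  unfolding eta_measure_def
proof (rule emeasure_measure_of_sigma[OF sigma_algebra_edge_sets _ _ assms])
  show "positive (edge_sets M E) (eta M)"
    by (simp add: positive_def eta_def deg_def deg_in_def)
  show "countably_additive (edge_sets M E) (eta M)"
  proof (rule countably_additiveI)
    fix A :: "nat \<Rightarrow> 'a uprod set"
    assume A: "range A \<subseteq> edge_sets M E" "disjoint_family A" "(\<Union>i. A i) \<in> edge_sets M E"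
    have Ai: "A i \<in> edge_sets M E" for i using A(1) by blast
    \<comment> \<open>The degree counts neighbours, so for each vertex it is countably additive in
      the edge set; integration over \<open>M\<close> preserves this.\<close>
    have "of_nat (deg (\<Union>i. A i) x) = (\<Sum>i. of_nat (deg (A i) x) :: ennreal)" for x
    proof -
      have "of_nat (deg (\<Union>i. A i) x) = (\<integral>\<^sup>+y. (\<Sum>i. indicator (A i) (Upair x y)) \<partial>count_space (component E x))"
        unfolding deg_eq_count[OF edge_setsD(1)[OF A(3)]] suminf_indicator[OF A(2)] ..
      also have "\<dots> = (\<Sum>i. \<integral>\<^sup>+y. indicator (A i) (Upair x y) \<partial>count_space (component E x))"
        by (rule nn_integral_suminf) simp
      finally show ?thesis unfolding deg_eq_count[OF edge_setsD(1)[OF Ai]] .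
    qed
    then have "(\<integral>\<^sup>+x. of_nat (deg (\<Union>i. A i) x) \<partial>M) = (\<Sum>i. \<integral>\<^sup>+x. of_nat (deg (A i) x) \<partial>M)"
      using measurable_deg[OF Ai] by (simp add: nn_integral_suminf)
    then show "(\<Sum>i. eta M (A i)) = eta M (\<Union>i. A i)"
      unfolding eta_def by simp
  qed
qed

lemma finite_eta_measure: "finite_measure (eta_measure M E)"
proof
  obtain D where D: "\<And>x. deg E x \<le> D" using graphing unfolding graphing_def by blast
  have "(\<integral>\<^sup>+x. of_nat (deg E x) \<partial>M) \<le> (\<integral>\<^sup>+x. of_nat D \<partial>M)" using D by (intro nn_integral_mono) simp
  also have "\<dots> < \<infinity>" using emeasure_space_1 by (simp add: ennreal_of_nat_eq_real_of_nat)
  finally have "eta M E < \<infinity>"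
    unfolding eta_def by (simp only: ennreal_mult_less_top ennreal_less_top infinity_ennreal_def simp_thms)
  then show "emeasure (eta_measure M E) (space (eta_measure M E)) \<noteq> \<infinity>"
    by (simp add: emeasure_eta_measure[OF edge_sets_E])
qed

lemma inverse_component:
  assumes A: "A \<in> edge_sets M E"
  shows "integrable M (\<lambda>x. 1 / real (card (component A x)))"
    and "(\<integral>\<^sup>+x. ennreal (1 / real (card (component A x))) \<partial>M) = ennreal (1 - rank M A)"
    and "rank M A \<le> 1" and "0 \<le> rank M A"
proof -
  have le: "1 / real (card (component A x)) \<le> 1" for x
  proof (cases "card (component A x) = 0")
    case False
    then show ?thesis by (simp add: divide_le_eq)
  qed simp
  have [measurable]: "(\<lambda>x. real (card (component A x))) \<in> borel_measurable M"
    by (rule measurable_card_component(2)[OF A]) simp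
  show int: "integrable M (\<lambda>x. 1 / real (card (component A x)))"
    using le by (intro integrable_const_bound[where B=1]) auto
  show "(\<integral>\<^sup>+x. ennreal (1 / real (card (component A x))) \<partial>M) = ennreal (1 - rank M A)"
    using nn_integral_eq_integral[OF int] by (simp add: rank_def)
  have "0 \<le> (\<integral>x. 1 / real (card (component A x)) \<partial>M)" by (intro integral_nonneg_AE) simp
  then show "rank M A \<le> 1" by (simp add: rank_def)
  have "(\<integral>x. 1 / real (card (component A x)) \<partial>M) \<le> (\<integral>x. 1 \<partial>M)"
    using le int by (intro integral_mono) auto
  then show "0 \<le> rank M A" using prob_space by (simp add: rank_def)
qed

lemma rank_mono:
  assumes A: "A \<in> edge_sets M E" and B: "B \<in> edge_sets M E" and "A \<subseteq> B"
  shows "rank M A \<le> rank M B"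
proof -
  have "1 / real (card (component B x)) \<le> 1 / real (card (component A x))" for x
  \<comment> \<open>An infinite component of \<open>B\<close> contributes 1/0 = 0, the least
    possible value.\<close>
  proof (cases "finite (component B x)")
    case True
    have sub: "component A x \<subseteq> component B x" by (rule component_mono) fact
    then have "card (component A x) > 0"
      using True finite_subset component_refl[of x A] by (metis card_gt_0_iff empty_iff)
    moreover have "card (component A x) \<le> card (component B x)" by (rule card_mono[OF True sub])
    ultimately show ?thesis by (simp add: frac_le)
  qed simp
  then show ?thesis
    unfolding rank_def using integral_mono[OF inverse_component(1)[OF B] inverse_component(1)[OF A]] by simp
qed

text \<open>Almost every vertex is isolated in a null edge set. Together with the bound by
  \<open>rank\<close> this makes every element of \<open>mm_plus\<close> absolutely continuous with
  respect to the edge measure.\<close>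

lemma rank_null:
  assumes A: "A \<in> edge_sets M E" and null: "eta M A = 0" shows "rank M A = 0"
proof -
  have "(\<integral>\<^sup>+x. of_nat (deg A x) \<partial>M) = 0" using null by (simp add: eta_def ennreal_eq_0_iff)
  then have "AE x in M. (of_nat (deg A x) :: ennreal) = 0"
    using nn_integral_0_iff_AE[OF measurable_deg[OF A]] by simp
  then have "AE x in M. 1 / real (card (component A x)) = 1"
  proof eventually_elim
    case (elim x)
    then have "{y. Upair x y \<in> A} = {}"
      using finite_nbrs_subset[OF edge_setsD(1)[OF A], of x] by (simp add: deg_def deg_in_def)
    then have "component A x \<subseteq> {x}" by (intro component_subsetI) auto
    then have "component A x = {x}" using component_refl[of x A] by (simp add: subset_singleton_iff) (metis component_refl empty_iff)
    then show ?case by simp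
  qed
  then have "(\<integral>x. 1 / real (card (component A x)) \<partial>M) = (\<integral>x. 1 \<partial>M)"
    using inverse_component(1)[OF A] by (intro integral_cong_AE) auto
  then show ?thesis using prob_space by (simp add: rank_def)
qed

end

section \<open>The wired forest against the rank function\<close>

context ordered_graphing
begin

lemma eta_eq_rank:
  assumes H: "H \<in> edge_sets M E" "H \<subseteq> wired_forest lt E"
  shows "eta M H = ennreal (rank M H)"
proof -
  note r = inverse_component[OF H(1)]
  have "eta M H + ennreal (1 - rank M H) = 1"
    using eta_wired[OF H(1) wired_subset_wired_forest[OF H(2)]] unfolding r(2) .
  moreover have "ennreal (rank M H) + ennreal (1 - rank M H) = 1"
    using r(3,4) by (subst ennreal_plus[symmetric]) auto
  ultimately show ?thesis by (metis add.commute ennreal_add_left_cancel ennreal_neq_top infinity_ennreal_def)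
qed

lemma eta_wired_forest_Int_le:
  assumes A: "A \<in> edge_sets M E"
  shows "eta M (wired_forest lt E \<inter> A) \<le> ennreal (rank M A)"
proof -
  interpret S: sigma_algebra E "edge_sets M E" by (rule sigma_algebra_edge_sets)
  have FA: "wired_forest lt E \<inter> A \<in> edge_sets M E" by (intro S.Int wired_forest_edge_set A)
  have "eta M (wired_forest lt E \<inter> A) = ennreal (rank M (wired_forest lt E \<inter> A))"
    by (rule eta_eq_rank[OF FA]) simp
  also have "\<dots> \<le> ennreal (rank M A)" by (intro ennreal_leI rank_mono FA A) simp
  finally show ?thesis .
qed

text \<open>\<open>rank\<close> depends only on the cardinalities of components. These agree: finite
  forest components are components of \<open>U\<close>, and an infinite one lies in an infinite
  component of \<open>U\<close>.\<close>

lemma eta_wired_forest_Int_up_closed: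
  assumes U: "U \<in> edge_sets M E" "up_closed lt E U"
  shows "eta M (wired_forest lt E \<inter> U) = ennreal (rank M U)"
proof -
  interpret S: sigma_algebra E "edge_sets M E" by (rule sigma_algebra_edge_sets)
  have FU: "wired_forest lt E \<inter> U \<in> edge_sets M E" by (intro S.Int wired_forest_edge_set U)
  have "card (component (wired_forest lt E \<inter> U) x) = card (component U x)" for x
  proof (cases "finite (component (wired_forest lt E \<inter> U) x)")
    case True
    then show ?thesis using component_wired_forest_Int[OF finite_nbrs U(2)] by simp
  next
    case False
    then have "infinite (component U x)"
      using component_mono[of "wired_forest lt E \<inter> U" U x] finite_subset by blast
    with False show ?thesis by simp
  qed
  then have "rank M (wired_forest lt E \<inter> U) = rank M U" by (simp add: rank_def)
  then show ?thesis using eta_eq_rank[OF FU] by simp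
qed

end

theorem theorem4p2:
  fixes M :: "'a::polish_space measure" and E :: "'a uprod set"
    and \<alpha> :: "'a uprod measure" and g :: "'a uprod \<Rightarrow> real"
  assumes "graphing M E"
    and "\<alpha> \<in> bmm_plus M E"
    and "g \<in> borel_measurable (eta_measure M E)"
    and "\<exists>C. AE e in eta_measure M E. \<bar>g e\<bar> \<le> C"
    and "\<forall>\<beta>\<in>bmm_plus M E.
           \<not> (AE e in eta_measure M E.
                RN_deriv (eta_measure M E) \<beta> e = RN_deriv (eta_measure M E) \<alpha> e) \<longrightarrow>
           (\<integral> e. enn2real (RN_deriv (eta_measure M E) \<alpha> e) * g e \<partial>eta_measure M E) >
           (\<integral> e. enn2real (RN_deriv (eta_measure M E) \<beta> e) * g e \<partial>eta_measure M E)"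
  shows "AE e in eta_measure M E.
           RN_deriv (eta_measure M E) \<alpha> e = 0 \<or> RN_deriv (eta_measure M E) \<alpha> e = 1"
proof -
  interpret graphing_space M E by unfold_locales fact
  define N where "N = eta_measure M E"
  have sets_N: "sets N = edge_sets M E" and space_N: "space N = E" by (simp_all add: N_def)
  have emN: "emeasure N A = eta M A" if "A \<in> edge_sets M E" for A
    using emeasure_eta_measure[OF that] by (simp add: N_def)
  interpret N: finite_measure N unfolding N_def by (rule finite_eta_measure)
  have g [measurable]: "g \<in> borel_measurable N" using assms(3) by (simp add: N_def)
  have MM: "sets (M \<Otimes>\<^sub>M M) = sets (borel :: ('a \<times> 'a) measure)"
    using sets_pair_measure_cong[OF sets_M sets_M] unfolding borel_prod .

  obtain h :: "'a \<Rightarrow> real" where h: "h \<in> borel_measurable borel" "inj h"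
    using borel_injection_real_exists by blast
  obtain k :: "'a \<times> 'a \<Rightarrow> real" where k: "k \<in> borel_measurable borel" "inj k"
    using borel_injection_real_exists by blast
  have k_M [measurable]: "k \<in> borel_measurable (M \<Otimes>\<^sub>M M)"
    using k(1) measurable_cong_sets[OF MM refl] by blast
  \<comment> \<open>The tie-breaking label. \<open>k\<close> labels ordered pairs injectively, and
    the minimum over the two orientations still determines the unordered pair.\<close>
  define \<iota> where "\<iota> e = Min (k ` {(x, y). Upair x y = e})" for e
  have \<iota>: "\<iota> (Upair x y) = min (k (x, y)) (k (y, x))" for x y
  proof -
    have "{(a, b). Upair a b = Upair x y} = {(x, y), (y, x)}" by auto
    then show ?thesis by (simp add: \<iota>_def)
  qed
  have inj_\<iota>: "e = f" if eq: "\<iota> e = \<iota> f" for e f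
  proof -
    obtain x y where e: "e = Upair x y" by (cases e)
    obtain z w where f: "f = Upair z w" by (cases f)
    have "k (x, y) = k (z, w) \<or> k (x, y) = k (w, z) \<or> k (y, x) = k (z, w) \<or> k (y, x) = k (w, z)"
      using eq unfolding e f \<iota> min_def by (auto split: if_splits)
    then show ?thesis using injD[OF k(2)] unfolding e f by force
  qed
  define lt where "lt e f \<longleftrightarrow> g e < g f \<or> g e = g f \<and> \<iota> e < \<iota> f" for e f
  \<comment> \<open>\<open>g\<close> is known to be measurable only on the space \<open>E\<close>;
    extended by 0 it becomes a Borel function of two vertices.\<close>
  have G: "(\<lambda>q. if Upair (fst q) (snd q) \<in> E then g (Upair (fst q) (snd q)) else 0) \<in> borel_measurable (M \<Otimes>\<^sub>M M)"
  proof (rule borel_measurableI_less)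
    fix t :: real
    have "{e \<in> space N. g e < t} \<in> sets N" by measurable
    then have A: "{e \<in> E. g e < t} \<in> edge_sets M E" by (simp add: sets_N space_N)
    have [measurable]: "Measurable.pred (M \<Otimes>\<^sub>M M) (\<lambda>q. Upair (fst q) (snd q) \<in> {e \<in> E. g e < t})"
      "Measurable.pred (M \<Otimes>\<^sub>M M) (\<lambda>q. Upair (fst q) (snd q) \<in> E)"
      by (rule measurable_edge_set[OF A] measurable_edge_set[OF edge_sets_E]; measurable)+
    have "{q \<in> space (M \<Otimes>\<^sub>M M). Upair (fst q) (snd q) \<in> {e \<in> E. g e < t} \<or> \<not> Upair (fst q) (snd q) \<in> E \<and> 0 < t} \<in> sets (M \<Otimes>\<^sub>M M)"
      by measurable
    also have "{q \<in> space (M \<Otimes>\<^sub>M M). Upair (fst q) (snd q) \<in> {e \<in> E. g e < t} \<or> \<not> Upair (fst q) (snd q) \<in> E \<and> 0 < t} =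
      {q \<in> space (M \<Otimes>\<^sub>M M). (if Upair (fst q) (snd q) \<in> E then g (Upair (fst q) (snd q)) else 0) < t}" by auto
    finally show "{q \<in> space (M \<Otimes>\<^sub>M M). (if Upair (fst q) (snd q) \<in> E then g (Upair (fst q) (snd q)) else 0) < t} \<in> sets (M \<Otimes>\<^sub>M M)" .
  qed
  have lt_meas: "Measurable.pred ((M \<Otimes>\<^sub>M M) \<Otimes>\<^sub>M (M \<Otimes>\<^sub>M M))
      (\<lambda>((a, b), x, y). Upair a b \<in> E \<and> Upair x y \<in> E \<and> lt (Upair a b) (Upair x y))"
  proof -
    define G where "G q = (if Upair (fst q) (snd q) \<in> E then g (Upair (fst q) (snd q)) else 0)" for q
    define I where "I q = min (k (fst q, snd q)) (k (snd q, fst q))" for q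
    have [measurable]: "G \<in> borel_measurable (M \<Otimes>\<^sub>M M)" using G unfolding G_def .
    have [measurable]: "I \<in> borel_measurable (M \<Otimes>\<^sub>M M)" unfolding I_def by measurable
    have [measurable]: "Measurable.pred (M \<Otimes>\<^sub>M M) (\<lambda>q. Upair (fst q) (snd q) \<in> E)"
      by (rule measurable_edge_set[OF edge_sets_E]) measurable
    have [measurable]: "Measurable.pred ((M \<Otimes>\<^sub>M M) \<Otimes>\<^sub>M (M \<Otimes>\<^sub>M M)) (\<lambda>r. Upair (fst (fst r)) (snd (fst r)) \<in> E)"
      "Measurable.pred ((M \<Otimes>\<^sub>M M) \<Otimes>\<^sub>M (M \<Otimes>\<^sub>M M)) (\<lambda>r. Upair (fst (snd r)) (snd (snd r)) \<in> E)"
      by (rule measurable_edge_set[OF edge_sets_E]; measurable)+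
    have "Measurable.pred ((M \<Otimes>\<^sub>M M) \<Otimes>\<^sub>M (M \<Otimes>\<^sub>M M)) (\<lambda>r. Upair (fst (fst r)) (snd (fst r)) \<in> E \<and>
        Upair (fst (snd r)) (snd (snd r)) \<in> E \<and> (G (fst r) < G (snd r) \<or> G (fst r) = G (snd r) \<and> I (fst r) < I (snd r)))"
      by measurable
    also have "(\<lambda>r. Upair (fst (fst r)) (snd (fst r)) \<in> E \<and>
        Upair (fst (snd r)) (snd (snd r)) \<in> E \<and> (G (fst r) < G (snd r) \<or> G (fst r) = G (snd r) \<and> I (fst r) < I (snd r))) =
      (\<lambda>((a, b), x, y). Upair a b \<in> E \<and> Upair x y \<in> E \<and> lt (Upair a b) (Upair x y))"
      by (auto simp: fun_eq_iff lt_def G_def I_def \<iota>)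
    finally show ?thesis .
  qed
  interpret ordered_graphing M E lt h
  proof unfold_locales
    show "\<not> lt e e" for e by (simp add: lt_def)
    show "lt e k" if "lt e f" "lt f k" for e f k using that by (auto simp: lt_def)
    show "lt e f \<or> lt f e" if "e \<noteq> f" for e f
    proof -
      have "\<iota> e \<noteq> \<iota> f" using that inj_\<iota> by blast
      then show ?thesis unfolding lt_def by linarith
    qed
    show "inj h" by fact
    show "h \<in> borel_measurable M" using h(1) measurable_cong_sets[OF sets_M refl] by blast
  qed (fact lt_meas)

  define F where "F = wired_forest lt E"
  define \<beta> where "\<beta> = density N (indicator F)"
  have F: "F \<in> edge_sets M E" unfolding F_def by (rule wired_forest_edge_set)
  then have F_N [measurable]: "F \<in> sets N" by (simp add: sets_N)
  have em\<beta>: "emeasure \<beta> A = eta M (F \<inter> A)" if A: "A \<in> edge_sets M E" for A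
  proof -
    have "emeasure \<beta> A = emeasure N (F \<inter> A)"
      unfolding \<beta>_def using A by (intro emeasure_restricted) (simp_all add: sets_N F)
    also have "\<dots> = eta M (F \<inter> A)"
      by (rule emN) (metis A F_N sets.Int sets_N)
    finally show ?thesis .
  qed
  have upE: "up_closed lt E E" by (simp add: up_closed_def)
  have "sets \<beta> = edge_sets M E" "space \<beta> = E" by (simp_all add: \<beta>_def sets_N space_N)
  then have \<beta>: "\<beta> \<in> bmm_plus M E"
    unfolding bmm_plus_def mm_plus_def
    using eta_wired_forest_Int_le eta_wired_forest_Int_up_closed[OF edge_sets_E upE]
    by (auto simp: em\<beta> edge_sets_E F_def[symmetric])
  have \<alpha>: "sets \<alpha> = edge_sets M E" "space \<alpha> = E" "emeasure \<alpha> E = ennreal (rank M E)"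
    and \<alpha>_le: "\<And>A. A \<in> edge_sets M E \<Longrightarrow> emeasure \<alpha> A \<le> ennreal (rank M A)"
    using assms(2) unfolding bmm_plus_def mm_plus_def by auto
  have \<beta>': "sets \<beta> = edge_sets M E" "space \<beta> = E" "emeasure \<beta> E = ennreal (rank M E)"
    using \<beta> unfolding bmm_plus_def mm_plus_def by auto
  interpret \<alpha>: finite_measure \<alpha> by (rule finite_measureI) (simp add: \<alpha>)
  interpret \<beta>: finite_measure \<beta> by (rule finite_measureI) (simp add: \<beta>')
  have ac\<alpha>: "absolutely_continuous N \<alpha>"
    unfolding absolutely_continuous_def
  proof
    fix A assume A: "A \<in> null_sets N"
    then have A': "A \<in> edge_sets M E" "eta M A = 0" using emN[of A] by (auto simp: null_sets_def sets_N)
    then have "emeasure \<alpha> A = 0" using \<alpha>_le[OF A'(1)] rank_null[OF A'] by simp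
    with A' show "A \<in> null_sets \<alpha>" by (auto simp: \<alpha>)
  qed
  have ac\<beta>: "absolutely_continuous N \<beta>"
    unfolding absolutely_continuous_def
  proof
    fix A assume A: "A \<in> null_sets N"
    then have A': "A \<in> edge_sets M E" by (auto simp: sets_N)
    have "emeasure \<beta> A = emeasure N (F \<inter> A)"
      unfolding \<beta>_def using A' by (intro emeasure_restricted) (simp_all add: sets_N F)
    also have "\<dots> = 0" using A by (metis Int_lower2 null_setsD1 null_setsD2 emeasure_mono le_zero_eq)
    finally show "A \<in> null_sets \<beta>" using A' by (auto simp: \<beta>')
  qed
  have RN\<beta>: "AE e in N. indicator F e = RN_deriv N \<beta> e"
    by (rule N.RN_deriv_unique) (simp_all add: \<beta>_def)
  obtain C where C: "AE e in N. \<bar>g e\<bar> \<le> C" using assms(4) unfolding N_def[symmetric] by blast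
  \<comment> \<open>The bound on \<open>g\<close> holds almost everywhere for \<open>N\<close>, and
    absolute continuity carries it over to \<alpha> and \<beta>.\<close>
  have AE_ac: "AE e in P. \<bar>g e\<bar> \<le> C" if ac: "absolutely_continuous N P" and sets: "sets P = sets N" for P
  proof -
    obtain A where A: "A \<in> null_sets N" "{e \<in> space N. \<not> \<bar>g e\<bar> \<le> C} \<subseteq> A"
      using C unfolding eventually_ae_filter by auto
    then show ?thesis
      using ac sets_eq_imp_space_eq[OF sets] unfolding absolutely_continuous_def eventually_ae_filter by auto
  qed
  have le: "(\<integral>e. g e \<partial>\<alpha>) \<le> (\<integral>e. g e \<partial>\<beta>)"
  proof (rule integral_mono_of_tails)
    show "finite_measure \<alpha>" "finite_measure \<beta>" by unfold_locales
    show "sets \<alpha> = sets \<beta>" by (simp add: \<alpha> \<beta>')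
    show "g \<in> borel_measurable \<alpha>"
      using g by (subst measurable_cong_sets[of _ N _ borel]) (simp_all add: \<alpha> sets_N)
    show "AE e in \<alpha>. \<bar>g e\<bar> \<le> C" by (rule AE_ac[OF ac\<alpha>]) (simp add: \<alpha> sets_N)
    show "AE e in \<beta>. \<bar>g e\<bar> \<le> C" by (rule AE_ac[OF ac\<beta>]) (simp add: \<beta>' sets_N)
    show "emeasure \<alpha> (space \<alpha>) = emeasure \<beta> (space \<beta>)" by (simp add: \<alpha> \<beta>')
    fix t
    have "{e \<in> space N. t < g e} \<in> sets N" by measurable
    then have U: "{e \<in> E. t < g e} \<in> edge_sets M E" by (simp add: sets_N space_N)
    \<comment> \<open>\<open>lt e f\<close> implies \<open>g e \<le> g f\<close>, so upper level
      sets of \<open>g\<close> are up-closed. On them the rank bound, an inequality for \<alpha>, is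
      an equality for \<beta>.\<close>
    have up: "up_closed lt E {e \<in> E. t < g e}" by (auto simp: up_closed_def lt_def)
    have "emeasure \<alpha> {e \<in> E. t < g e} \<le> emeasure \<beta> {e \<in> E. t < g e}"
      using \<alpha>_le[OF U] eta_wired_forest_Int_up_closed[OF U up] unfolding em\<beta>[OF U] F_def by simp
    then show "emeasure \<alpha> {e \<in> space \<alpha>. t < g e} \<le> emeasure \<beta> {e \<in> space \<beta>. t < g e}" by (simp add: \<alpha> \<beta>')
  qed
  \<comment> \<open>Turns the functional of the exposure hypothesis into a plain integral of
    \<open>g\<close>, the form in which \<open>le\<close> compares \<alpha> and \<beta>.\<close>
  have int: "(\<integral>e. enn2real (RN_deriv N P e) * g e \<partial>N) = (\<integral>e. g e \<partial>P)"
    if "finite_measure P" "absolutely_continuous N P" "sets P = sets N" for P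
  proof -
    interpret P: finite_measure P by fact
    show ?thesis
      by (rule N.RN_deriv_integral[OF P.sigma_finite_measure_axioms that(2,3) g, symmetric])
  qed
  \<comment> \<open>Otherwise exposure would give \<alpha> a strictly larger integral of
    \<open>g\<close> than \<beta>, contradicting \<open>le\<close>.\<close>
  have "AE e in N. RN_deriv N \<beta> e = RN_deriv N \<alpha> e"
  proof (rule ccontr)
    assume "\<not> ?thesis"
    then have "(\<integral>e. enn2real (RN_deriv N \<beta> e) * g e \<partial>N) < (\<integral>e. enn2real (RN_deriv N \<alpha> e) * g e \<partial>N)"
      using assms(5) \<beta> unfolding N_def by blast
    then have "(\<integral>e. g e \<partial>\<beta>) < (\<integral>e. g e \<partial>\<alpha>)"
      using int[OF \<alpha>.finite_measure_axioms ac\<alpha>] int[OF \<beta>.finite_measure_axioms ac\<beta>] by (simp add: \<alpha> \<beta>' sets_N)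
    with le show False by simp
  qed
  with RN\<beta> have "AE e in N. RN_deriv N \<alpha> e = 0 \<or> RN_deriv N \<alpha> e = 1"
  proof eventually_elim
    case (elim e)
    then show ?case by (cases "e \<in> F") auto
  qed
  then show ?thesis unfolding N_def .
qed

end
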